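(* Let $A$ be a fixed finite alphabet with $r=|A|\ge 2$ and let $F=F(A)$ be the free group with basis $A$. There is a randomized algorithm which, given $n\ge 1$, outputs the graphical representation of a size $n$ subgroup of $F$, distributed uniformly over the (finite) set of all size $n$ subgroups of $F$, with the following complexity. (1) In the RAM (unit-cost) model, after a precomputation (depending only on $n$) that takes time $\mathcal{O}(n)$, each random draw takes $\mathcal{O}(n)$ operations on average. (2) In the bit-cost model, the precomputation takes time and space $\mathcal{O}(n^2\log n)$, and each random draw takes time $\mathcal{O}(n^2\log^2 n)$ on average.
   Context: An $A$-graph is a pair $\Gamma=(V,E)$ with $V$ finite and $E\subseteq V\times A\times V$ such that $(u,a,v),(u,a,v')\in E$ implies $v=v'$, and $(u,a,v),(u',a,v)\in E$ implies $u=u'$. It is connected if its underlying undirected graph is connected. A vertex is a leaf if it occurs at most once in the list of triples defining $E$ (a loop $(v,a,v)$ counts as two occurrences of $v$). Given a vertex $v$, $\Gamma$ is $v$-trim if no vertex $w\neq v$ is a leaf, and the pair $(\Gamma,v)$ is admissible if $\Gamma$ is connected and $v$-trim. By Stallings foldings, each finitely generated subgroup $H\le F(A)$ is represented by an admissible pair $(\Gamma,1)$ (with $1$ a designated vertex), unique up to isomorphism, called the graphical representation of $H$; $H$ is the set of reduced words over $A\sqcup A^{-1}$ labeling closed paths at the vertex $1$ (edges may be traversed backwards, reading the inverse letter). Conversely every admissible pair is the graphical representation of a unique finitely generated subgroup. The size of $H$ is the number of vertices of $\Gamma$; there are finitely many subgroups of each size. Cost models. In the RAM (unit-cost) model each integer,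 however large, is stored in one unit of space, and reading, writing, comparing, performing an arithmetic operation, and drawing an integer uniformly at random from $[0,N[$ each take one unit of time. In the bit-cost model an integer $N$ is represented in binary with length $\mathcal{O}(\log N)$; for integers whose binary length is $\mathcal{O}(n\log n)$, reading, writing, comparison, addition, and multiplication by an integer of binary length $\mathcal{O}(\log n)$ take time $\mathcal{O}(n\log n)$, multiplication of two such integers takes time $\mathcal{O}(n\log^2 n)$, and drawing a uniform random integer in $[0,N[$ takes average time $\mathcal{O}(\log N)$. "On average" refers to expectation over the random choices of the algorithm. The constants may depend on $A$. *)

theory Defs
  imports
    "HOL-Probability.Probability"
    "HOL-Algebra.Generated_Groups"
    "HOL-Library.Landau_Symbols"
    "HOL-Library.Log_Nat"
begin

section \<open>The free group\<close>

text \<open>The pair \<open>(a, True)\<close> is the letter \<open>a\<close>, the pair \<open>(a, False)\<close> its formal inverse.\<close>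

type_synonym 'a word = "('a \<times> bool) list"

definition flip :: "'a \<times> bool \<Rightarrow> 'a \<times> bool" where
  "flip x = (fst x, \<not> snd x)"

fun reduced_word :: "'a word \<Rightarrow> bool" where
  "reduced_word (x # y # w) \<longleftrightarrow> y \<noteq> flip x \<and> reduced_word (y # w)"
| "reduced_word w \<longleftrightarrow> True"

fun cancel_cons :: "'a \<times> bool \<Rightarrow> 'a word \<Rightarrow> 'a word" where
  "cancel_cons x [] = [x]"
| "cancel_cons x (y # w) = (if y = flip x then w else x # y # w)"

definition reduce :: "'a word \<Rightarrow> 'a word" where
  "reduce w = foldr cancel_cons w []"

definition free_group :: "'a set \<Rightarrow> 'a word monoid" where
  "free_group A =
     \<lparr>carrier = {w. w \<in> lists (A \<times> UNIV) \<and> reduced_word w},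
      monoid.mult = (\<lambda>u v. reduce (u @ v)),
      one = []\<rparr>"

definition fg_subgroup :: "'a set \<Rightarrow> 'a word set \<Rightarrow> bool" where
  "fg_subgroup A H \<longleftrightarrow>
     subgroup H (free_group A) \<and>
     (\<exists>S. finite S \<and> S \<subseteq> carrier (free_group A) \<and> H = generate (free_group A) S)"

lemma flip_flip [simp]: "flip (flip x) = x"
  by (simp add: flip_def)

lemma flip_neq [simp]: "flip x \<noteq> x" "x \<noteq> flip x"
  by (auto simp: flip_def prod_eq_iff)

lemma reduced_tl: "reduced_word (x # w) \<Longrightarrow> reduced_word w"
  by (cases w) auto

lemma reduced_cancel_cons: "reduced_word w \<Longrightarrow> reduced_word (cancel_cons x w)"
  by (cases w) (auto dest: reduced_tl)

lemma cancel_cons_flip: "reduced_word w \<Longrightarrow> cancel_cons x (cancel_cons (flip x) w) = w"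
  by (cases w rule: reduced_word.cases) auto

lemma reduced_foldr: "reduced_word w \<Longrightarrow> reduced_word (foldr cancel_cons u w)"
  by (induction u) (auto intro: reduced_cancel_cons)

lemma foldr_cancel_cons:
  "reduced_word w \<Longrightarrow> foldr cancel_cons (cancel_cons x u) w = cancel_cons x (foldr cancel_cons u w)"
  by (cases u) (auto simp: cancel_cons_flip reduced_foldr)

lemma foldr_reduce: "reduced_word w \<Longrightarrow> foldr cancel_cons (reduce u) w = foldr cancel_cons u w"
  by (induction u) (auto simp: reduce_def foldr_cancel_cons)

lemma foldr_foldr:
  "reduced_word w \<Longrightarrow>
     foldr cancel_cons (foldr cancel_cons u v) w = foldr cancel_cons u (foldr cancel_cons v w)"
  by (induction u) (auto simp: foldr_cancel_cons)

lemma reduce_reduced: "reduced_word w \<Longrightarrow> reduce w = w"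
proof (induction w)
  case (Cons x w)
  then have "reduce w = w" by (blast dest: reduced_tl)
  with Cons.prems show ?case by (cases w) (auto simp: reduce_def)
qed (simp add: reduce_def)

lemma reduced_reduce: "reduced_word (reduce w)"
  by (simp add: reduce_def reduced_foldr)

lemma reduce_append: "reduce (u @ v) = foldr cancel_cons u (reduce v)"
  by (simp add: reduce_def)

lemma set_cancel_cons: "set (cancel_cons x w) \<subseteq> insert x (set w)"
  by (cases w) auto

lemma set_reduce: "set (reduce w) \<subseteq> set w"
proof (induction w)
  case (Cons x w)
  then show ?case using set_cancel_cons[of x "reduce w"] by (auto simp: reduce_def)
qed (simp add: reduce_def)

lemma reduce_rev_flip: "reduce (map flip (rev w) @ w) = []"
proof (induction w)
  case (Cons x w)
  have "cancel_cons (flip x) (cancel_cons x (reduce w)) = reduce w"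
    using cancel_cons_flip[of "reduce w" "flip x"] by (simp add: reduced_reduce)
  then have "reduce (map flip (rev (x # w)) @ x # w) = reduce (map flip (rev w) @ w)"
    by (simp add: reduce_def)
  with Cons.IH show ?case by simp
qed (simp add: reduce_def)

lemma group_free_group: "group (free_group A)"
proof (rule groupI)
  fix u v w
  assume "u \<in> carrier (free_group A)" "v \<in> carrier (free_group A)" "w \<in> carrier (free_group A)"
  then show "u \<otimes>\<^bsub>free_group A\<^esub> v \<otimes>\<^bsub>free_group A\<^esub> w = u \<otimes>\<^bsub>free_group A\<^esub> (v \<otimes>\<^bsub>free_group A\<^esub> w)"
    by (simp add: free_group_def reduce_append reduce_reduced foldr_foldr reduced_foldr)
next
  fix u assume u: "u \<in> carrier (free_group A)"
  let ?v = "reduce (map flip (rev u))"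
  have "set ?v \<subseteq> A \<times> UNIV"
    using set_reduce[of "map flip (rev u)"] u
    by (fastforce simp: free_group_def flip_def in_lists_conv_set)
  then have "?v \<in> carrier (free_group A)"
    by (auto simp: free_group_def reduced_reduce in_lists_conv_set)
  moreover have "?v \<otimes>\<^bsub>free_group A\<^esub> u = \<one>\<^bsub>free_group A\<^esub>"
    using u reduce_rev_flip[of u]
    by (simp add: free_group_def reduce_append reduce_reduced foldr_reduce)
  ultimately show "\<exists>v\<in>carrier (free_group A). v \<otimes>\<^bsub>free_group A\<^esub> u = \<one>\<^bsub>free_group A\<^esub>" by blast
next
  fix u v assume "u \<in> carrier (free_group A)" "v \<in> carrier (free_group A)"
  then show "u \<otimes>\<^bsub>free_group A\<^esub> v \<in> carrier (free_group A)"
    using set_reduce[of "u @ v"] by (fastforce simp: free_group_def reduced_reduce in_lists_conv_set)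
qed (auto simp: free_group_def reduce_reduced)


section \<open>Graphs over an alphabet and the subgroups they represent\<close>

type_synonym ('v, 'a) graph = "'v set \<times> ('v \<times> 'a \<times> 'v) set"

definition A_graph :: "'a set \<Rightarrow> ('v, 'a) graph \<Rightarrow> bool" where
  "A_graph A = (\<lambda>(V, E).
     finite V \<and> E \<subseteq> V \<times> A \<times> V \<and>
     (\<forall>u a v v'. (u, a, v) \<in> E \<and> (u, a, v') \<in> E \<longrightarrow> v = v') \<and>
     (\<forall>u u' a v. (u, a, v) \<in> E \<and> (u', a, v) \<in> E \<longrightarrow> u = u'))"

definition connected_graph :: "('v, 'a) graph \<Rightarrow> bool" where
  "connected_graph = (\<lambda>(V, E).
     \<forall>u\<in>V. \<forall>v\<in>V. (u, v) \<in> {(x, y). \<exists>a. (x, a, y) \<in> E \<or> (y, a, x) \<in> E}\<^sup>*)"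

text \<open>A loop at \<open>w\<close> is counted once as an outgoing and once as an incoming edge.\<close>

definition is_leaf :: "('v, 'a) graph \<Rightarrow> 'v \<Rightarrow> bool" where
  "is_leaf = (\<lambda>(V, E) w.
     card {e \<in> E. fst e = w} + card {e \<in> E. snd (snd e) = w} \<le> 1)"

definition trim :: "('v, 'a) graph \<Rightarrow> 'v \<Rightarrow> bool" where
  "trim \<Gamma> v \<longleftrightarrow> (\<forall>w\<in>fst \<Gamma>. w \<noteq> v \<longrightarrow> \<not> is_leaf \<Gamma> w)"

definition admissible :: "'a set \<Rightarrow> ('v, 'a) graph \<Rightarrow> 'v \<Rightarrow> bool" where
  "admissible A \<Gamma> v \<longleftrightarrow> A_graph A \<Gamma> \<and> v \<in> fst \<Gamma> \<and> connected_graph \<Gamma> \<and> trim \<Gamma> v"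

fun labels_path :: "('v, 'a) graph \<Rightarrow> 'v \<Rightarrow> 'a word \<Rightarrow> 'v \<Rightarrow> bool" where
  "labels_path \<Gamma> u [] v \<longleftrightarrow> u = v"
| "labels_path \<Gamma> u ((a, True) # w) v \<longleftrightarrow> (\<exists>x. (u, a, x) \<in> snd \<Gamma> \<and> labels_path \<Gamma> x w v)"
| "labels_path \<Gamma> u ((a, False) # w) v \<longleftrightarrow> (\<exists>x. (x, a, u) \<in> snd \<Gamma> \<and> labels_path \<Gamma> x w v)"

definition graphical_rep :: "'a set \<Rightarrow> ('v, 'a) graph \<Rightarrow> 'v \<Rightarrow> 'a word set \<Rightarrow> bool" where
  "graphical_rep A \<Gamma> v H \<longleftrightarrow>
     admissible A \<Gamma> v \<and> H = {w. reduced_word w \<and> labels_path \<Gamma> v w v}"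

text \<open>Graphical representations are unique only up to isomorphism, so the vertices may be
  taken to be natural numbers.\<close>

definition subgroups_of_size :: "'a set \<Rightarrow> nat \<Rightarrow> 'a word set set" where
  "subgroups_of_size A n =
     {H. fg_subgroup A H \<and>
         (\<exists>(\<Gamma> :: (nat, 'a) graph) v. graphical_rep A \<Gamma> v H \<and> card (fst \<Gamma>) = n)}"


section \<open>A randomized random access machine\<close>

text \<open>
  Programs are finite while-programs over integer arrays with random access. Memory cells
  are addressed by an array name and an index; a scalar is a cell of fixed index. Since the
  alphabet is fixed, there is one output array \<open>Edge a\<close> for each letter \<open>a\<close>. Only addition,
  subtraction, multiplication, equality and order tests are available; there is no division.
\<close>

datatype 'a name = Input | Edge 'a | Work nat

datatype 'a exp =
    Lit int
  | Cell "'a name" "'a exp"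
  | Add "'a exp" "'a exp"
  | Sub "'a exp" "'a exp"
  | Mul "'a exp" "'a exp"

datatype 'a test = Lt "'a exp" "'a exp" | Eq "'a exp" "'a exp"

text \<open>\<open>Assign x i e\<close> stores the value of \<open>e\<close> in cell \<open>i\<close> of the array \<open>x\<close>;
  \<open>Draw x i N\<close> stores there a uniform random integer from \<open>[0, N[\<close>.\<close>

datatype 'a com =
    Skip
  | Assign "'a name" "'a exp" "'a exp"
  | Draw "'a name" "'a exp" "'a exp"
  | Seq "'a com" "'a com"
  | If "'a test" "'a com" "'a com"
  | While "'a test" "'a com"

primrec random_free :: "'a com \<Rightarrow> bool" where
  "random_free Skip \<longleftrightarrow> True"
| "random_free (Assign x i e) \<longleftrightarrow> True"
| "random_free (Draw x i e) \<longleftrightarrow> False"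
| "random_free (Seq c d) \<longleftrightarrow> random_free c \<and> random_free d"
| "random_free (If b c d) \<longleftrightarrow> random_free c \<and> random_free d"
| "random_free (While b c) \<longleftrightarrow> random_free c"

text \<open>\<open>None\<close> marks the cells that have never been written. They are read as 0.\<close>

type_synonym 'a mem = "'a name \<times> int \<Rightarrow> int option"

definition content :: "'a mem \<Rightarrow> 'a name \<times> int \<Rightarrow> int" where
  "content m c = (case m c of None \<Rightarrow> 0 | Some x \<Rightarrow> x)"

primrec eval_exp :: "'a mem \<Rightarrow> 'a exp \<Rightarrow> int" where
  "eval_exp m (Lit k) = k"
| "eval_exp m (Cell x i) = content m (x, eval_exp m i)"
| "eval_exp m (Add e f) = eval_exp m e + eval_exp m f"
| "eval_exp m (Sub e f) = eval_exp m e - eval_exp m f"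
| "eval_exp m (Mul e f) = eval_exp m e * eval_exp m f"

primrec eval_test :: "'a mem \<Rightarrow> 'a test \<Rightarrow> bool" where
  "eval_test m (Lt e f) \<longleftrightarrow> eval_exp m e < eval_exp m f"
| "eval_test m (Eq e f) \<longleftrightarrow> eval_exp m e = eval_exp m f"

text \<open>The value 0 for \<open>N \<le> 0\<close> is a convention for the empty range.\<close>

definition random_int :: "int \<Rightarrow> int pmf" where
  "random_int N = (if N \<le> 0 then return_pmf 0 else pmf_of_set {0..<N})"

primrec step :: "'a com \<Rightarrow> 'a mem \<Rightarrow> ('a com \<times> 'a mem) pmf" where
  "step Skip m = return_pmf (Skip, m)"
| "step (Assign x i e) m = return_pmf (Skip, m((x, eval_exp m i) \<mapsto> eval_exp m e))"
| "step (Draw x i e) m =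
     map_pmf (\<lambda>v. (Skip, m((x, eval_exp m i) \<mapsto> v))) (random_int (eval_exp m e))"
| "step (Seq c d) m =
     (if c = Skip then return_pmf (d, m)
      else map_pmf (\<lambda>(c', m'). (Seq c' d, m')) (step c m))"
| "step (If b c d) m = return_pmf (if eval_test m b then c else d, m)"
| "step (While b c) m = return_pmf (if eval_test m b then Seq c (While b c) else Skip, m)"

primrec run :: "'a com \<Rightarrow> 'a mem \<Rightarrow> nat \<Rightarrow> ('a com \<times> 'a mem) pmf" where
  "run c m 0 = return_pmf (c, m)"
| "run c m (Suc t) = bind_pmf (run c m t) (\<lambda>(c', m'). step c' m')"

definition reachable :: "'a com \<Rightarrow> 'a mem \<Rightarrow> ('a com \<times> 'a mem) set" where
  "reachable c m = (\<Union>t. set_pmf (run c m t))"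

text \<open>\<open>Skip\<close> is absorbing, so the supremum below is the limit as the number of steps grows.\<close>

definition halt_prob :: "'a com \<Rightarrow> 'a mem \<Rightarrow> ('a mem \<Rightarrow> bool) \<Rightarrow> real" where
  "halt_prob c m P =
     (SUP t. measure_pmf.prob (run c m t) {(c', m'). c' = Skip \<and> P m'})"


section \<open>Cost models\<close>

text \<open>
  The arguments are the operands of the operation; for \<open>c_read\<close> and \<open>c_write\<close> they are the
  index of the accessed cell and the integer transferred.
  \<open>c_draw C N\<close> is the average time for drawing from \<open>[0, N[\<close>: by linearity of expectation,
  charging this average at each draw does not change the expected cost of a program.
\<close>

record cost_model =
  c_read :: "int \<Rightarrow> int \<Rightarrow> real"
  c_write :: "int \<Rightarrow> int \<Rightarrow> real"
  c_compare :: "int \<Rightarrow> int \<Rightarrow> real"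
  c_add :: "int \<Rightarrow> int \<Rightarrow> real"
  c_sub :: "int \<Rightarrow> int \<Rightarrow> real"
  c_mul :: "int \<Rightarrow> int \<Rightarrow> real"
  c_draw :: "int \<Rightarrow> real"

text \<open>Literals are part of the program text and are free; so is passing control.\<close>

primrec exp_cost :: "cost_model \<Rightarrow> 'a mem \<Rightarrow> 'a exp \<Rightarrow> real" where
  "exp_cost C m (Lit k) = 0"
| "exp_cost C m (Cell x i) =
     exp_cost C m i + c_read C (eval_exp m i) (content m (x, eval_exp m i))"
| "exp_cost C m (Add e f) =
     exp_cost C m e + exp_cost C m f + c_add C (eval_exp m e) (eval_exp m f)"
| "exp_cost C m (Sub e f) =
     exp_cost C m e + exp_cost C m f + c_sub C (eval_exp m e) (eval_exp m f)"
| "exp_cost C m (Mul e f) =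
     exp_cost C m e + exp_cost C m f + c_mul C (eval_exp m e) (eval_exp m f)"

primrec test_cost :: "cost_model \<Rightarrow> 'a mem \<Rightarrow> 'a test \<Rightarrow> real" where
  "test_cost C m (Lt e f) =
     exp_cost C m e + exp_cost C m f + c_compare C (eval_exp m e) (eval_exp m f)"
| "test_cost C m (Eq e f) =
     exp_cost C m e + exp_cost C m f + c_compare C (eval_exp m e) (eval_exp m f)"

text \<open>Storing the outcome of a draw from \<open>[0, N[\<close> is charged like storing \<open>N\<close>.\<close>

primrec step_cost :: "cost_model \<Rightarrow> 'a com \<Rightarrow> 'a mem \<Rightarrow> real" where
  "step_cost C Skip m = 0"
| "step_cost C (Assign x i e) m =
     exp_cost C m i + exp_cost C m e + c_write C (eval_exp m i) (eval_exp m e)"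
| "step_cost C (Draw x i e) m =
     exp_cost C m i + exp_cost C m e + c_draw C (eval_exp m e)
     + c_write C (eval_exp m i) (eval_exp m e)"
| "step_cost C (Seq c d) m = step_cost C c m"
| "step_cost C (If b c d) m = test_cost C m b"
| "step_cost C (While b c) m = test_cost C m b"

definition expected_cost :: "cost_model \<Rightarrow> 'a com \<Rightarrow> 'a mem \<Rightarrow> ennreal" where
  "expected_cost C c m =
     (\<Sum>t. \<integral>\<^sup>+ (c', m'). ennreal (step_cost C c' m') \<partial>measure_pmf (run c m t))"

definition unit_cost :: cost_model where
  "unit_cost =
     \<lparr>c_read = (\<lambda>_ _. 1), c_write = (\<lambda>_ _. 1), c_compare = (\<lambda>_ _. 1), c_add = (\<lambda>_ _. 1),
      c_sub = (\<lambda>_ _. 1), c_mul = (\<lambda>_ _. 1), c_draw = (\<lambda>_. 1)\<rparr>"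

text \<open>Binary length, with one further bit for the sign (so that also 0 has positive length).\<close>

definition bit_length :: "int \<Rightarrow> real" where
  "bit_length x = real_of_int (bitlen \<bar>x\<bar>) + 1"

text \<open>
  The bit-cost model fixes the cost of the operations only up to constant factors: it stands
  for every cost model that obeys the following upper bounds. Subtraction is treated like
  addition.
\<close>

definition bit_cost_model :: "cost_model \<Rightarrow> bool" where
  "bit_cost_model C \<longleftrightarrow>
     (\<forall>x y. 0 \<le> c_read C x y \<and> 0 \<le> c_write C x y \<and> 0 \<le> c_compare C x y \<and>
            0 \<le> c_add C x y \<and> 0 \<le> c_sub C x y \<and> 0 \<le> c_mul C x y \<and> 0 \<le> c_draw C x) \<and>
     (\<forall>f\<in>{c_read C, c_write C, c_compare C, c_add C, c_sub C}. \<forall>K. \<exists>B. \<forall>n\<ge>2. \<forall>x y.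
        bit_length x \<le> K * (real n * log 2 n) \<and> bit_length y \<le> K * (real n * log 2 n) \<longrightarrow>
        f x y \<le> B * (real n * log 2 n)) \<and>
     (\<forall>K. \<exists>B. \<forall>n\<ge>2. \<forall>x y.
        bit_length x \<le> K * (real n * log 2 n) \<and> bit_length y \<le> K * log 2 n \<longrightarrow>
        c_mul C x y \<le> B * (real n * log 2 n) \<and> c_mul C y x \<le> B * (real n * log 2 n)) \<and>
     (\<forall>K. \<exists>B. \<forall>n\<ge>2. \<forall>x y.
        bit_length x \<le> K * (real n * log 2 n) \<and> bit_length y \<le> K * (real n * log 2 n) \<longrightarrow>
        c_mul C x y \<le> B * (real n * (log 2 n)\<^sup>2)) \<and>
     (\<exists>B. \<forall>N\<ge>1. c_draw C N \<le> B * bit_length N)"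

text \<open>
  Number of bits of the cells in use, including the addresses of these cells. Only finitely
  many cells are in use in a run from a finite memory.
\<close>

definition bit_space :: "'a mem \<Rightarrow> real" where
  "bit_space m = (\<Sum>c\<in>dom m. bit_length (snd c) + bit_length (content m c))"


section \<open>Input, output and repeated draws\<close>

definition input_mem :: "nat \<Rightarrow> 'a mem" where
  "input_mem n = [(Input, 0) \<mapsto> int n]"

text \<open>
  The output has the vertices \<open>1, \<dots>, n\<close>, and 1 is the designated vertex. The cell of index
  \<open>u\<close> in the array \<open>Edge a\<close> holds the end vertex of the edge labelled \<open>a\<close> that starts at \<open>u\<close>;
  any integer that is not a vertex (say 0) means that there is no such edge.
\<close>

definition output_graph :: "'a set \<Rightarrow> nat \<Rightarrow> 'a mem \<Rightarrow> (int, 'a) graph" where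
  "output_graph A n m =
     ({1..int n},
      {(u, a, v). u \<in> {1..int n} \<and> a \<in> A \<and> v \<in> {1..int n} \<and> content m (Edge a, u) = v})"

text \<open>
  The memories in which a draw may start: those that the program \<open>pre\<close> leaves on input \<open>n\<close>,
  and those left by earlier draws. Requiring a uniform output from each of them makes
  successive draws uniform and independent.
\<close>

inductive ready :: "'a com \<Rightarrow> 'a com \<Rightarrow> nat \<Rightarrow> 'a mem \<Rightarrow> bool" for pre draw n where
  after_pre: "(Skip, m) \<in> reachable pre (input_mem n) \<Longrightarrow> ready pre draw n m"
| after_draw: "ready pre draw n m \<Longrightarrow> (Skip, m') \<in> reachable draw m \<Longrightarrow> ready pre draw n m'"

definition uniform_subgroup_output :: "'a set \<Rightarrow> nat \<Rightarrow> 'a com \<Rightarrow> 'a mem \<Rightarrow> bool" where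
  "uniform_subgroup_output A n draw m \<longleftrightarrow>
     (\<forall>H\<in>subgroups_of_size A n.
        halt_prob draw m (\<lambda>m'. graphical_rep A (output_graph A n m') 1 H)
          = 1 / card (subgroups_of_size A n))"

end

theory Submission
  imports Defs "HOL-Real_Asymp.Real_Asymp"
begin

text \<open>
  A size \<open>n\<close> subgroup corresponds to exactly \<open>(n - 1)!\<close> admissible
  graphs on the vertices \<open>1, \<dots>, n\<close> with root 1 (\<open>card_fibre\<close>): the permutations that fix the
  root act on these graphs, transitively because the graphical representation is unique up to
  isomorphism (\<open>graphical_rep_unique\<close>), and freely because a connected deterministic graph has no nontrivial
  automorphism that fixes a vertex. So it suffices to draw an admissible graph uniformly. A graph
  over \<open>A\<close> is a tuple of partial injections of \<open>{1..n}\<close>, one for each letter; the program draws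
  these independently and uniformly and starts again until the result is admissible.

  A positive proportion of all graphs is admissible, uniformly in \<open>n\<close>
  (\<open>admissible_fraction\<close>), and two letters suffice to see this. A random partial injection leaves
  about \<open>sqrt n\<close> vertices without image, so that the expected number of vertices incident with at
  most one of the four half-edges of two letters is \<open>O(1 / sqrt n)\<close> (\<open>card_leaf_pairs\<close>); and a
  union bound over the vertex sets that may be separated from the rest shows that a graph is
  disconnected with probability \<open>O(1 / n)\<close> (\<open>card_split_pairs\<close>). Hence the expected number of attempts is bounded.

  There are \<open>(n choose k)\<^sup>2 * k!\<close> partial injections of rank \<open>k\<close>. After
  a suitable scaling the tails of this distribution obey a recurrence with multiplications by
  integers at most \<open>n\<close> only (\<open>tail_weight\<close>), so no division is ever needed: starting from \<open>k = n\<close>,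
  the rank \<open>k\<close> is accepted with probability \<open>rank_weight n k / tail_weight n k\<close> and lowered
  otherwise. Given the rank, the vertices are scanned once; each is declared to have an image or not
  with the right odds, and images are taken from a pool that is kept contiguous by moving its last
  entry into the gap. Every partial injection arises from a single sequence of decisions, of
  probability \<open>1 / card (pinj {1..n})\<close> (\<open>sample\<close>). Building the tables costs no more than a draw, so
  they are computed anew each time and the precomputation is empty.

  An attempt always consists of \<open>O(n)\<close> operations on integers with \<open>O(n log n)\<close>
  bits; this includes the test of admissibility, by counting half-edges and by a graph search that
  also uses the inverse injections (\<open>check\<close>). A single bound for the cost of one operation
  (\<open>ops_bounded\<close>) then yields both cost models. The reasoning about programs uses triples that
  combine safety, a bound on the number of operations and a lower bound for an expectation
  (\<open>ptriple\<close>). Lower bounds are enough: the targets are as many as the reciprocal of the bound for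
  each of them, so that all the bounds are attained (\<open>uniform_of_lower_bound\<close>).
\<close>

section \<open>Rooted graphs and their subgroups\<close>

text \<open>
  A half-edge: the edges are traversed in both directions, and the second component of the
  letter \<open>y\<close> gives the direction.
\<close>

definition hop :: "('v, 'a) graph \<Rightarrow> 'v \<Rightarrow> 'a \<times> bool \<Rightarrow> 'v \<Rightarrow> bool" where
  "hop \<Gamma> u y x \<longleftrightarrow> (if snd y then (u, fst y, x) \<in> snd \<Gamma> else (x, fst y, u) \<in> snd \<Gamma>)"

abbreviation inv_word :: "'a word \<Rightarrow> 'a word" where "inv_word w \<equiv> map flip (rev w)"

lemma labels_path_Cons [simp]: "labels_path \<Gamma> u (y # w) v \<longleftrightarrow> (\<exists>x. hop \<Gamma> u y x \<and> labels_path \<Gamma> x w v)"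
  by (cases y; cases "snd y") (auto simp: hop_def)

declare labels_path.simps(2,3) [simp del]

lemma hop_flip: "hop \<Gamma> u (flip y) x \<longleftrightarrow> hop \<Gamma> x y u"
  by (auto simp: hop_def flip_def)

lemma labels_path_append: "labels_path \<Gamma> u (w @ w') v \<longleftrightarrow> (\<exists>x. labels_path \<Gamma> u w x \<and> labels_path \<Gamma> x w' v)"
  by (induction w arbitrary: u) auto

lemma labels_path_inv: "labels_path \<Gamma> u (inv_word w) v \<longleftrightarrow> labels_path \<Gamma> v w u"
  by (induction w arbitrary: v) (auto simp: labels_path_append hop_flip)

lemma hop_det: "A_graph A \<Gamma> \<Longrightarrow> hop \<Gamma> u y x \<Longrightarrow> hop \<Gamma> u y x' \<Longrightarrow> x = x'"
  by (cases \<Gamma>) (simp add: A_graph_def hop_def split: if_splits, blast+)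

lemma hop_det': "A_graph A \<Gamma> \<Longrightarrow> hop \<Gamma> u y x \<Longrightarrow> hop \<Gamma> u' y x \<Longrightarrow> u = u'"
  using hop_det[of A \<Gamma> x "flip y" u u'] by (simp add: hop_flip)

lemma hop_vertices: "A_graph A \<Gamma> \<Longrightarrow> hop \<Gamma> u y x \<Longrightarrow> u \<in> fst \<Gamma> \<and> x \<in> fst \<Gamma> \<and> fst y \<in> A"
  by (cases \<Gamma>) (auto simp: A_graph_def hop_def split: if_splits)

lemma labels_path_det: "A_graph A \<Gamma> \<Longrightarrow> labels_path \<Gamma> u w v \<Longrightarrow> labels_path \<Gamma> u w v' \<Longrightarrow> v = v'"
  by (induction w arbitrary: u) (auto dest: hop_det)

lemma labels_path_vertex: "A_graph A \<Gamma> \<Longrightarrow> u \<in> fst \<Gamma> \<Longrightarrow> labels_path \<Gamma> u w v \<Longrightarrow> v \<in> fst \<Gamma>"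
  by (induction w arbitrary: u) (auto dest: hop_vertices)

lemma labels_path_letters: "A_graph A \<Gamma> \<Longrightarrow> labels_path \<Gamma> u w v \<Longrightarrow> w \<in> lists (A \<times> UNIV)"
  by (induction w arbitrary: u) (auto dest!: hop_vertices simp: mem_Times_iff)

lemma labels_path_cancel:
  assumes "A_graph A \<Gamma>" "labels_path \<Gamma> u (y # w) v"
  shows "labels_path \<Gamma> u (cancel_cons y w) v"
proof (cases w)
  case (Cons z w')
  show ?thesis
  proof (cases "z = flip y")
    case True
    with assms(2) Cons obtain x x' where "hop \<Gamma> u y x" "hop \<Gamma> x (flip y) x'" "labels_path \<Gamma> x' w' v" by auto
    moreover from this have "x' = u" using hop_det'[OF assms(1)] by (auto simp: hop_flip)
    ultimately show ?thesis using Cons True by simp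
  next
    case False
    then show ?thesis using assms(2) Cons by simp
  qed
qed (use assms in auto)

text \<open>
  In a deterministic graph a letter followed by its inverse leads back to the same vertex, so
  that free reduction does not change the end point of a path.
\<close>

lemma labels_path_reduce:
  assumes "A_graph A \<Gamma>" shows "labels_path \<Gamma> u w v \<Longrightarrow> labels_path \<Gamma> u (reduce w) v"
proof (induction w arbitrary: u)
  case (Cons y w)
  then obtain x where "hop \<Gamma> u y x" "labels_path \<Gamma> x (reduce w) v" by auto
  then show ?case using labels_path_cancel[OF assms, of u y "reduce w" v] by (auto simp: reduce_def)
qed (simp add: reduce_def)

definition lang :: "('v, 'a) graph \<Rightarrow> 'v \<Rightarrow> 'a word set" where
  "lang \<Gamma> v = {w. reduced_word w \<and> labels_path \<Gamma> v w v}"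

lemma graphical_rep_lang: "graphical_rep A \<Gamma> v H \<longleftrightarrow> admissible A \<Gamma> v \<and> H = lang \<Gamma> v"
  by (simp add: graphical_rep_def lang_def)

lemma connected_path:
  assumes "connected_graph \<Gamma>" "u \<in> fst \<Gamma>" "v \<in> fst \<Gamma>"
  shows "\<exists>w. labels_path \<Gamma> u w v"
proof -
  obtain V E where \<Gamma>: "\<Gamma> = (V, E)" by force
  have "(u, v) \<in> {(x, y). \<exists>a. (x, a, y) \<in> E \<or> (y, a, x) \<in> E}\<^sup>*"
    using assms by (auto simp: \<Gamma> connected_graph_def)
  then show ?thesis
  proof (induction rule: converse_rtrancl_induct)
    case base
    show ?case by (rule exI[of _ "[]"]) simp
  next
    case (step x y)
    then obtain w a where w: "labels_path \<Gamma> y w v" "(x, a, y) \<in> E \<or> (y, a, x) \<in> E" by auto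
    then have "hop \<Gamma> x (a, True) y \<or> hop \<Gamma> x (a, False) y" by (auto simp: hop_def \<Gamma>)
    with w(1) show ?case by (metis labels_path_Cons)
  qed
qed

lemma path_connected_graph:
  assumes "\<And>u v. u \<in> fst \<Gamma> \<Longrightarrow> v \<in> fst \<Gamma> \<Longrightarrow> \<exists>w. labels_path \<Gamma> u w v"
  shows "connected_graph \<Gamma>"
proof -
  obtain V E where \<Gamma>: "\<Gamma> = (V, E)" by force
  have "labels_path \<Gamma> u w v \<Longrightarrow> (u, v) \<in> {(x, y). \<exists>a. (x, a, y) \<in> E \<or> (y, a, x) \<in> E}\<^sup>*" for u v w
  proof (induction w arbitrary: u)
    case (Cons y w)
    then obtain x where "hop \<Gamma> u y x" "(x, v) \<in> {(x, y). \<exists>a. (x, a, y) \<in> E \<or> (y, a, x) \<in> E}\<^sup>*" by auto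
    moreover from this have "(u, x) \<in> {(x, y). \<exists>a. (x, a, y) \<in> E \<or> (y, a, x) \<in> E}"
      by (auto simp: hop_def \<Gamma> split: if_splits)
    ultimately show ?case by (rule_tac converse_rtrancl_into_rtrancl)
  qed simp
  with assms show ?thesis by (fastforce simp: \<Gamma> connected_graph_def)
qed

lemma reduced_word_iff: "reduced_word w \<longleftrightarrow> (\<forall>i. Suc i < length w \<longrightarrow> w ! Suc i \<noteq> flip (w ! i))"
  by (induction w rule: reduced_word.induct) (auto simp: nth_Cons less_Suc_eq_0_disj split: nat.splits)

lemma reduced_inv: "reduced_word w \<Longrightarrow> reduced_word (inv_word w)"
  unfolding reduced_word_iff
proof (intro allI impI)
  fix i assume r: "\<forall>i. Suc i < length w \<longrightarrow> w ! Suc i \<noteq> flip (w ! i)" and i: "Suc i < length (inv_word w)"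
  let ?j = "length w - Suc (Suc i)"
  have "Suc ?j < length w" "Suc ?j = length w - Suc i" using i by auto
  with r have "w ! (length w - Suc i) \<noteq> flip (w ! ?j)" by metis
  then show "inv_word w ! Suc i \<noteq> flip (inv_word w ! i)"
    using i by (auto simp: rev_nth)
qed

lemma reduced_glue: "reduced_word (u @ [y]) \<Longrightarrow> reduced_word (y # v) \<Longrightarrow> reduced_word (u @ y # v)"
  by (induction u rule: reduced_word.induct) auto

lemma reduce_reduce_append: "reduce (reduce u @ v) = reduce (u @ v)" "reduce (u @ reduce v) = reduce (u @ v)"
  by (simp_all add: reduce_append foldr_reduce reduced_reduce reduce_reduced)

lemma reduce_cancel_mid: "reduce (u @ inv_word w @ w @ v) = reduce (u @ v)"
  by (metis append.assoc append_Nil reduce_reduce_append reduce_rev_flip)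

lemma inv_inv_word: "inv_word (inv_word w) = w"
  by (simp add: rev_map comp_def)

lemma reduce_cancel_mid': "reduce (u @ w @ inv_word w @ v) = reduce (u @ v)"
  using reduce_cancel_mid[of u "inv_word w" v] unfolding inv_inv_word .

lemma lang_subgroup:
  assumes "A_graph A \<Gamma>" "v \<in> fst \<Gamma>"
  shows "subgroup (lang \<Gamma> v) (free_group A)"
proof -
  interpret F: group "free_group A" by (rule group_free_group)
  have sub: "lang \<Gamma> v \<subseteq> carrier (free_group A)"
    unfolding lang_def free_group_def using labels_path_letters[OF assms(1)] by fastforce
  have inv: "inv\<^bsub>free_group A\<^esub> w \<in> lang \<Gamma> v" if w: "w \<in> lang \<Gamma> v" for w
  proof -
    have i: "inv_word w \<in> lang \<Gamma> v" using w reduced_inv by (auto simp: lang_def labels_path_inv)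
    have "inv_word w \<otimes>\<^bsub>free_group A\<^esub> w = \<one>\<^bsub>free_group A\<^esub>"
      using reduce_rev_flip[of w] by (simp add: free_group_def)
    then have "inv\<^bsub>free_group A\<^esub> w = inv_word w"
      by (intro F.inv_equality) (use w i sub in auto)
    with i show ?thesis by simp
  qed
  have "[] \<in> lang \<Gamma> v" by (simp add: lang_def)
  moreover have "x \<otimes>\<^bsub>free_group A\<^esub> y \<in> lang \<Gamma> v" if "x \<in> lang \<Gamma> v" "y \<in> lang \<Gamma> v" for x y
    using that labels_path_reduce[OF assms(1), of v "x @ y" v]
    by (auto simp: lang_def free_group_def labels_path_append reduced_reduce)
  ultimately show ?thesis using sub inv by (intro F.subgroupI) auto
qed

lemma finite_hops:
  assumes "A_graph A \<Gamma>" "finite A" shows "finite {(u, y, x). hop \<Gamma> u y x}"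
proof (rule finite_subset)
  show "{(u, y, x). hop \<Gamma> u y x} \<subseteq> fst \<Gamma> \<times> (A \<times> UNIV) \<times> fst \<Gamma>"
    using hop_vertices[OF assms(1)] by (auto simp: mem_Times_iff)
  show "finite (fst \<Gamma> \<times> (A \<times> (UNIV :: bool set)) \<times> fst \<Gamma>)"
    using assms by (cases \<Gamma>) (auto simp: A_graph_def)
qed

text \<open>
  The generators are the loops that run to the beginning of a half-edge along a fixed path
  \<open>s\<close>, traverse it, and return along the fixed path from its end. A closed path is
  the product of the loops of its half-edges, as the auxiliary paths cancel.
\<close>

lemma lang_fg:
  assumes "A_graph A \<Gamma>" "v \<in> fst \<Gamma>" "connected_graph \<Gamma>" "finite A"
  shows "fg_subgroup A (lang \<Gamma> v)"
proof -
  interpret F: group "free_group A" by (rule group_free_group)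
  have "\<exists>s. \<forall>u\<in>fst \<Gamma>. labels_path \<Gamma> v (s u) u \<and> (u = v \<longrightarrow> s u = [])"
  proof (rule bchoice, rule ballI)
    fix u assume "u \<in> fst \<Gamma>"
    then show "\<exists>w. labels_path \<Gamma> v w u \<and> (u = v \<longrightarrow> w = [])"
      using connected_path[OF assms(3,2)] by (cases "u = v") auto
  qed
  then obtain s where s: "\<And>u. u \<in> fst \<Gamma> \<Longrightarrow> labels_path \<Gamma> v (s u) u" "s v = []" using assms(2) by blast
  define S where "S = (\<lambda>(u, y, x). reduce (s u @ [y] @ inv_word (s x))) ` {(u, y, x). hop \<Gamma> u y x}"
  have fin: "finite S" unfolding S_def by (intro finite_imageI finite_hops[OF assms(1,4)])
  have SL: "S \<subseteq> lang \<Gamma> v"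
  proof
    fix g assume "g \<in> S"
    then obtain u y x where h: "hop \<Gamma> u y x" and g: "g = reduce (s u @ [y] @ inv_word (s x))" unfolding S_def by auto
    have "labels_path \<Gamma> v (s u @ [y] @ inv_word (s x)) v"
      using h hop_vertices[OF assms(1) h] s(1) by (auto simp: labels_path_append labels_path_inv)
    then show "g \<in> lang \<Gamma> v"
      unfolding g lang_def using labels_path_reduce[OF assms(1)] reduced_reduce by blast
  qed
  note sub = lang_subgroup[OF assms(1,2)]
  then have LC: "lang \<Gamma> v \<subseteq> carrier (free_group A)" by (rule subgroup.subset)
  have "generate (free_group A) S \<subseteq> lang \<Gamma> v" by (rule F.generate_subgroup_incl[OF SL sub])
  moreover have "reduce (s u @ w @ inv_word (s x)) \<in> generate (free_group A) S"
    if "labels_path \<Gamma> u w x" "u \<in> fst \<Gamma>" for u w x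
    using that
  proof (induction w arbitrary: u)
    case Nil
    have "reduce (s u @ inv_word (s u)) = []" using reduce_cancel_mid'[of "[]" "s u" "[]"] by (simp add: reduce_def)
    with Nil generate.one[of "free_group A" S] show ?case by (simp add: free_group_def)
  next
    case (Cons y w)
    then obtain t where t: "hop \<Gamma> u y t" "labels_path \<Gamma> t w x" by auto
    then have "t \<in> fst \<Gamma>" using hop_vertices[OF assms(1)] by blast
    with Cons.IH t have 1: "reduce (s t @ w @ inv_word (s x)) \<in> generate (free_group A) S" by blast
    have 2: "reduce (s u @ [y] @ inv_word (s t)) \<in> generate (free_group A) S"
    proof (rule generate.incl)
      show "reduce (s u @ [y] @ inv_word (s t)) \<in> S"
        unfolding S_def by (rule image_eqI[of _ _ "(u, y, t)"]) (use t(1) in auto)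
    qed
    have "reduce (reduce (s u @ [y] @ inv_word (s t)) @ reduce (s t @ w @ inv_word (s x))) = reduce (s u @ (y # w) @ inv_word (s x))"
      using reduce_cancel_mid[of "s u @ [y]" "s t" "w @ inv_word (s x)"] by (simp add: reduce_reduce_append)
    with generate.eng[OF 2 1] show ?case by (simp add: free_group_def)
  qed
  then have "lang \<Gamma> v \<subseteq> generate (free_group A) S"
    using s(2) assms(2) reduce_reduced by (fastforce simp: lang_def)
  ultimately have "lang \<Gamma> v = generate (free_group A) S" by blast
  with fin SL LC sub show ?thesis unfolding fg_subgroup_def by blast
qed

text \<open>
  The half-edges at a vertex carry different letters, hence at a vertex that is not a leaf no
  single letter is the only way on.
\<close>

lemma not_leaf_other_letter:
  fixes \<Gamma> :: "('v, 'a) graph"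
  assumes "A_graph A \<Gamma>" "\<not> is_leaf \<Gamma> w"
  shows "\<exists>y x. hop \<Gamma> w y x \<and> y \<noteq> z"
proof (rule ccontr)
  assume *: "\<not> ?thesis"
  obtain V E where \<Gamma>: "\<Gamma> = (V, E)" by force
  let ?O = "{e \<in> E. fst e = w}" and ?I = "{e \<in> E. snd (snd e) = w}"
  have O: "snd z \<and> fst (snd e) = fst z \<and> hop \<Gamma> w z (snd (snd e))" if "e \<in> ?O" for e
  proof -
    have h: "hop \<Gamma> w (fst (snd e), True) (snd (snd e))" using that by (auto simp: hop_def \<Gamma>)
    with * have "z = (fst (snd e), True)" by blast
    with that h show ?thesis by (cases e) auto
  qed
  have I: "\<not> snd z \<and> fst (snd e) = fst z \<and> hop \<Gamma> w z (fst e)" if "e \<in> ?I" for e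
  proof -
    have h: "hop \<Gamma> w (fst (snd e), False) (fst e)" using that by (auto simp: hop_def \<Gamma>)
    with * have "z = (fst (snd e), False)" by blast
    with that h show ?thesis by (cases e) auto
  qed
  have one: "card X \<le> 1" if "\<And>x y. x \<in> X \<Longrightarrow> y \<in> X \<Longrightarrow> x = y" for X :: "('v \<times> 'a \<times> 'v) set"
  proof (cases "X = {}")
    case False
    then obtain x where "x \<in> X" by blast
    with that have "X = {x}" by blast
    then show ?thesis by simp
  qed simp
  have O1: "card ?O \<le> 1"
  proof (rule one)
    fix x y assume xy: "x \<in> ?O" "y \<in> ?O"
    then have "snd (snd x) = snd (snd y)" using O hop_det[OF assms(1)] by blast
    with xy O[OF xy(1)] O[OF xy(2)] show "x = y" by (simp add: prod_eq_iff)
  qed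
  have I1: "card ?I \<le> 1"
  proof (rule one)
    fix x y assume xy: "x \<in> ?I" "y \<in> ?I"
    then have "fst x = fst y" using I hop_det[OF assms(1)] by blast
    with xy I[OF xy(1)] I[OF xy(2)] show "x = y" by (simp add: prod_eq_iff)
  qed
  have "card ?O + card ?I \<le> 1"
  proof (cases "snd z")
    case True
    then have "?I = {}" using I by blast
    then have "card ?I = 0" by (metis card.empty)
    with O1 show ?thesis by linarith
  next
    case False
    then have "?O = {}" using O by blast
    then have "card ?O = 0" by (metis card.empty)
    with I1 show ?thesis by linarith
  qed
  then have "is_leaf \<Gamma> w" unfolding is_leaf_def \<Gamma> prod.case .
  with assms(2) show False ..
qed

text \<open>
  The paths of this relation are the walks without backtracking, that is, the walks labelled by
  reduced words.
\<close>

definition nb_succ :: "('v, 'a) graph \<Rightarrow> (('v \<times> ('a \<times> bool) \<times> 'v) \<times> ('v \<times> ('a \<times> bool) \<times> 'v)) set" where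
  "nb_succ \<Gamma> = {((u, y, x), (x, z, t)) | u y x z t. hop \<Gamma> u y x \<and> hop \<Gamma> x z t \<and> z \<noteq> flip y}"

lemma nb_succ_path:
  assumes "(e, f) \<in> (nb_succ \<Gamma>)\<^sup>*" "hop \<Gamma> (fst e) (fst (snd e)) (snd (snd e))"
  shows "\<exists>w. labels_path \<Gamma> (snd (snd e)) w (snd (snd f)) \<and> reduced_word (fst (snd e) # w)"
  using assms
proof (induction rule: converse_rtrancl_induct)
  case base
  show ?case by (rule exI[of _ "[]"]) simp
next
  case (step e g)
  then obtain u y x z t where e: "e = (u, y, x)" "g = (x, z, t)" "hop \<Gamma> x z t" "z \<noteq> flip y" by (auto simp: nb_succ_def)
  with step.IH obtain w where "labels_path \<Gamma> t w (snd (snd f))" "reduced_word (z # w)" by auto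
  with e show ?case by (intro exI[of _ "z # w"]) auto
qed

text \<open>
  A walk without backtracking need not end at the root by itself, but it cannot avoid the root
  for ever. Let \<open>S\<close> be the set of half-edges reachable from \<open>(u, y,
  x)\<close> without backtracking and \<open>X\<close> the set of their end points, and suppose
  that \<open>v\<close> is not in \<open>X\<close>. If \<open>u\<close> is in \<open>X\<close>,
  then \<open>X\<close> is closed under adjacency, and connectedness puts \<open>v\<close> into
  \<open>X\<close>. If not, then no two half-edges of \<open>S\<close> end at the same vertex,
  since otherwise the walk could turn round and return to \<open>u\<close>. As no vertex of
  \<open>X\<close> is a leaf, each half-edge of \<open>S\<close> has a successor in
  \<open>S\<close>, and choosing one is an injection of the finite set \<open>S\<close> into
  itself that misses \<open>(u, y, x)\<close>.
\<close>

lemma reduced_continuation: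
  assumes adm: "admissible A \<Gamma> v" and "finite A" and h: "hop \<Gamma> u y x"
  shows "\<exists>w. labels_path \<Gamma> x w v \<and> reduced_word (y # w)"
proof (rule ccontr)
  assume no: "\<not> ?thesis"
  have AG: "A_graph A \<Gamma>" and conn: "connected_graph \<Gamma>" and v: "v \<in> fst \<Gamma>"
    and trim: "\<And>w. w \<in> fst \<Gamma> \<Longrightarrow> w \<noteq> v \<Longrightarrow> \<not> is_leaf \<Gamma> w"
    using adm by (auto simp: admissible_def trim_def)
  define S where "S = (nb_succ \<Gamma>)\<^sup>* `` {(u, y, x)}"
  define X where "X = (\<lambda>e. snd (snd e)) ` S"
  have hopS: "hop \<Gamma> a z b" if "(a, z, b) \<in> S" for a z b
    using that[unfolded S_def, simplified] by (cases rule: rtranclE) (use h in \<open>auto simp: nb_succ_def\<close>)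
  have e0: "(u, y, x) \<in> S" by (simp add: S_def)
  have succS: "(b, z', c) \<in> S" if "(a, z, b) \<in> S" "hop \<Gamma> b z' c" "z' \<noteq> flip z" for a z b z' c
  proof -
    have "((a, z, b), (b, z', c)) \<in> nb_succ \<Gamma>"
      unfolding nb_succ_def using that hopS[OF that(1)] by blast
    with that(1) show ?thesis unfolding S_def by (auto intro: rtrancl_into_rtrancl)
  qed
  have "v \<notin> X"
  proof
    assume "v \<in> X"
    then obtain a z where "((u, y, x), (a, z, v)) \<in> (nb_succ \<Gamma>)\<^sup>*" by (auto simp: X_def S_def)
    from nb_succ_path[OF this] h no show False by auto
  qed
  have finS: "finite S"
    by (rule finite_subset[OF _ finite_hops[OF AG assms(2)]]) (use hopS in auto)
  have predS: "a \<in> X \<or> (a, z, b) = (u, y, x)" if "(a, z, b) \<in> S" for a z b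
    using that[unfolded S_def, simplified]
  proof (cases rule: rtranclE)
    case (step f)
    then have "f \<in> S" "snd (snd f) = a" by (auto simp: S_def nb_succ_def)
    then show ?thesis unfolding X_def by force
  qed auto
  have XV: "X \<subseteq> fst \<Gamma>" using hopS hop_vertices[OF AG] by (force simp: X_def)
  have "x \<in> X" using e0 by (force simp: X_def)
  have "u \<notin> X"
  proof
    assume "u \<in> X"
    have closed: "c \<in> X" if "b \<in> X" "hop \<Gamma> b z c" for b z c
    proof -
      from that(1) obtain a y' where a: "(a, y', b) \<in> S" by (auto simp: X_def)
      show ?thesis
      proof (cases "z = flip y'")
        case True
        then have "hop \<Gamma> c y' b" using that(2) by (simp add: hop_flip)
        then have "c = a" using hop_det'[OF AG _ hopS[OF a]] by blast
        with predS[OF a] \<open>u \<in> X\<close> show ?thesis by auto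
      next
        case False
        from succS[OF a that(2) this] show ?thesis by (force simp: X_def)
      qed
    qed
    have "labels_path \<Gamma> b w c \<Longrightarrow> b \<in> X \<Longrightarrow> c \<in> X" for b w c
      by (induction w arbitrary: b) (auto dest: closed)
    moreover obtain w where "labels_path \<Gamma> x w v" using connected_path[OF conn _ v] XV \<open>x \<in> X\<close> by blast
    ultimately show False using \<open>x \<in> X\<close> \<open>v \<notin> X\<close> by blast
  qed
  have inj: "(a, z, b) = (a', z', b)" if "(a, z, b) \<in> S" "(a', z', b) \<in> S" for a z a' z' b
  proof (rule ccontr)
    assume ne: "(a, z, b) \<noteq> (a', z', b)"
    have zz: "z \<noteq> z'" using ne hop_det'[OF AG hopS[OF that(1)]] hopS[OF that(2)] by blast
    \<comment> \<open>The walk that enters \<open>b\<close> by the second half-edge may leave by the reverse of the first one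
      and then retrace the way from \<open>(u, y, x)\<close> to the first one.\<close>
    have "flip z \<noteq> flip z'" using zz by (metis flip_flip)
    then have "(b, flip z, a) \<in> S"
      using succS[OF that(2)] hopS[OF that(1)] by (simp add: hop_flip)
    moreover have "((u, y, x), (a, z, b)) \<in> (nb_succ \<Gamma>)\<^sup>*" using that(1) by (simp add: S_def)
    then have "((b, flip z, a), (x, flip y, u)) \<in> (nb_succ \<Gamma>)\<^sup>*"
    proof (induction "(a, z, b)" arbitrary: a z b rule: rtrancl_induct)
      case base
      then show ?case by auto
    next
      case (step f)
      then obtain a' z' where f: "f = (a', z', a)" "hop \<Gamma> a' z' a" "hop \<Gamma> a z b" "z \<noteq> flip z'" by (auto simp: nb_succ_def)
      from f have "hop \<Gamma> b (flip z) a" "hop \<Gamma> a (flip z') a'" "flip z' \<noteq> flip (flip z)" by (auto simp: hop_flip)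
      then have "((b, flip z, a), (a, flip z', a')) \<in> nb_succ \<Gamma>"
        unfolding nb_succ_def by blast
      from converse_rtrancl_into_rtrancl[OF this step.hyps(3)[OF f(1)]] show ?case .
    qed
    ultimately have "(x, flip y, u) \<in> S" unfolding S_def by (auto intro: rtrancl_trans)
    then show False using \<open>u \<notin> X\<close> by (force simp: X_def)
  qed
  have "\<exists>g\<in>S. fst g = snd (snd f)" if f: "f \<in> S" for f
  proof -
    obtain a z b where f': "f = (a, z, b)" by (cases f)
    with f have b: "b \<in> X" by (force simp: X_def)
    with \<open>v \<notin> X\<close> XV have "\<not> is_leaf \<Gamma> b" by (intro trim) auto
    from not_leaf_other_letter[OF AG this, of "flip z"] obtain z' c where "hop \<Gamma> b z' c" "z' \<noteq> flip z" by blast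
    with succS[of a z b z' c] f f' have "(b, z', c) \<in> S" by simp
    with f' show ?thesis by (intro bexI[of _ "(b, z', c)"]) auto
  qed
  then obtain nx where nx: "\<And>f. f \<in> S \<Longrightarrow> nx f \<in> S" "\<And>f. f \<in> S \<Longrightarrow> fst (nx f) = snd (snd f)" by metis
  have "inj_on nx S"
  proof (rule inj_onI)
    fix f g assume fg: "f \<in> S" "g \<in> S" "nx f = nx g"
    then have "snd (snd f) = snd (snd g)" using nx(2) by metis
    then show "f = g" using inj fg(1,2) by (cases f; cases g) auto
  qed
  then have "nx ` S = S" using finS nx(1) by (intro endo_inj_surj) auto
  then obtain f where "f \<in> S" "nx f = (u, y, x)" using e0 by (metis imageE)
  with nx(2)[of f] have "u \<in> X" unfolding X_def by force
  with \<open>u \<notin> X\<close> show False ..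
qed

text \<open>
  The half-edge is continued to the root in both directions. This is why the subgroup sees every
  edge and thus determines the graph.
\<close>

lemma hop_on_closed_path:
  assumes adm: "admissible A \<Gamma> v" and "finite A" and h: "hop \<Gamma> u y x"
  shows "\<exists>w w'. labels_path \<Gamma> v w u \<and> labels_path \<Gamma> x w' v \<and> reduced_word (w @ y # w')"
proof -
  obtain w' where w': "labels_path \<Gamma> x w' v" "reduced_word (y # w')"
    using reduced_continuation[OF assms] by blast
  obtain w where w: "labels_path \<Gamma> u w v" "reduced_word (flip y # w)"
    using reduced_continuation[OF adm assms(2), of x "flip y" u] h by (auto simp: hop_flip)
  have "reduced_word (inv_word (flip y # w))" by (rule reduced_inv[OF w(2)])
  then have "reduced_word (inv_word w @ y # w')" by (intro reduced_glue[OF _ w'(2)]) simp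
  then show ?thesis
    using w(1) w'(1) by (intro exI[of _ "inv_word w"] exI[of _ w'] conjI) (simp_all add: labels_path_inv)
qed

section \<open>Uniqueness of the graphical representation and its labellings\<close>

lemma vertex_on_closed_path:
  assumes adm: "admissible A \<Gamma> v" and "finite A" and u: "u \<in> fst \<Gamma>"
  shows "\<exists>w w'. labels_path \<Gamma> v w u \<and> labels_path \<Gamma> u w' v \<and> reduced_word (w @ w')"
proof (cases "u = v")
  case True
  then show ?thesis by (intro exI[of _ "[]"]) simp
next
  case False
  obtain w where "labels_path \<Gamma> u w v" using connected_path[of \<Gamma> u v] adm u by (auto simp: admissible_def)
  with False obtain y x where h: "hop \<Gamma> u y x" by (cases w) auto
  from hop_on_closed_path[OF assms(1,2) h] obtain w w' where
    "labels_path \<Gamma> v w u" "labels_path \<Gamma> x w' v" "reduced_word (w @ y # w')" by blast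
  with h show ?thesis by (intro exI[of _ w] exI[of _ "y # w'"]) auto
qed

text \<open>
  The isomorphism between two graphs with the same subgroup, as a relation: vertices correspond
  if some word leads to both of them.
\<close>

definition corr :: "('v, 'a) graph \<Rightarrow> 'v \<Rightarrow> ('w, 'a) graph \<Rightarrow> 'w \<Rightarrow> 'v \<Rightarrow> 'w \<Rightarrow> bool" where
  "corr \<Gamma> v \<Delta> v' u u' \<longleftrightarrow> (\<exists>w. labels_path \<Gamma> v w u \<and> labels_path \<Delta> v' w u')"

lemma corr_sym: "corr \<Gamma> v \<Delta> v' u u' \<Longrightarrow> corr \<Delta> v' \<Gamma> v u' u"
  by (auto simp: corr_def)

text \<open>
  Two words that lead to \<open>u\<close> differ by an element of the common subgroup, which
  closes up in the second graph as well.
\<close>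

lemma corr_det:
  assumes "A_graph A \<Gamma>" "A_graph A \<Delta>" "lang \<Gamma> v = lang \<Delta> v'"
    and "corr \<Gamma> v \<Delta> v' u u'" "corr \<Gamma> v \<Delta> v' u u''"
  shows "u' = u''"
proof -
  obtain w1 w2 where w1: "labels_path \<Gamma> v w1 u" "labels_path \<Delta> v' w1 u'"
    and w2: "labels_path \<Gamma> v w2 u" "labels_path \<Delta> v' w2 u''" using assms(4,5) by (auto simp: corr_def)
  have "labels_path \<Gamma> v (w1 @ inv_word w2) v" using w1 w2 by (auto simp: labels_path_append labels_path_inv)
  then have "reduce (w1 @ inv_word w2) \<in> lang \<Gamma> v"
    using labels_path_reduce[OF assms(1)] reduced_reduce by (auto simp: lang_def)
  then have "labels_path \<Delta> v' (reduce (w1 @ inv_word w2)) v'" using assms(3) by (auto simp: lang_def)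
  then have "labels_path \<Delta> u' (inv_word w1 @ reduce (w1 @ inv_word w2) @ w2) u''"
    using w1 w2 by (auto simp: labels_path_append labels_path_inv)
  then have "labels_path \<Delta> u' (reduce (inv_word w1 @ reduce (w1 @ inv_word w2) @ w2)) u''"
    by (rule labels_path_reduce[OF assms(2)])
  also have "reduce (inv_word w1 @ reduce (w1 @ inv_word w2) @ w2) = reduce (inv_word w1 @ w1 @ inv_word w2 @ w2)"
    using reduce_reduce_append(1)[of "w1 @ inv_word w2" w2] reduce_reduce_append(2)[of "inv_word w1" "reduce (w1 @ inv_word w2) @ w2"]
      reduce_reduce_append(2)[of "inv_word w1" "(w1 @ inv_word w2) @ w2"] by simp
  also have "\<dots> = []"
    using reduce_cancel_mid[of "[]" w1 "inv_word w2 @ w2"] reduce_rev_flip[of w2] by simp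
  finally show ?thesis by simp
qed

lemma corr_total:
  assumes "admissible A \<Gamma> v" "finite A" "lang \<Gamma> v = lang \<Delta> v'" "u \<in> fst \<Gamma>"
  shows "\<exists>u'. corr \<Gamma> v \<Delta> v' u u'"
proof -
  obtain w w' where w: "labels_path \<Gamma> v w u" "labels_path \<Gamma> u w' v" "reduced_word (w @ w')"
    using vertex_on_closed_path[OF assms(1,2,4)] by blast
  then have "w @ w' \<in> lang \<Gamma> v" by (auto simp: lang_def labels_path_append)
  then have "labels_path \<Delta> v' (w @ w') v'" using assms(3) by (auto simp: lang_def)
  with w show ?thesis by (auto simp: labels_path_append corr_def)
qed

lemma corr_hop:
  assumes adm: "admissible A \<Gamma> v" "finite A" "A_graph A \<Delta>" "lang \<Gamma> v = lang \<Delta> v'"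
    and h: "hop \<Gamma> u y x" "corr \<Gamma> v \<Delta> v' u u'"
  shows "\<exists>x'. hop \<Delta> u' y x' \<and> corr \<Gamma> v \<Delta> v' x x'"
proof -
  obtain w w' where w: "labels_path \<Gamma> v w u" "labels_path \<Gamma> x w' v" "reduced_word (w @ y # w')"
    using hop_on_closed_path[OF adm(1,2) h(1)] by blast
  with h(1) have "w @ y # w' \<in> lang \<Gamma> v" by (auto simp: lang_def labels_path_append)
  then have "labels_path \<Delta> v' (w @ y # w') v'" using adm(4) by (auto simp: lang_def)
  then obtain u0 x' where u0: "labels_path \<Delta> v' w u0" "hop \<Delta> u0 y x'" by (auto simp: labels_path_append)
  have "A_graph A \<Gamma>" using adm(1) by (simp add: admissible_def)
  moreover have "corr \<Gamma> v \<Delta> v' u u0" using w u0 by (auto simp: corr_def)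
  ultimately have "u0 = u'" using corr_det[OF _ adm(3,4) _ h(2)] by blast
  moreover have "corr \<Gamma> v \<Delta> v' x x'"
    unfolding corr_def using w(1) h(1) u0 by (intro exI[of _ "w @ [y]"]) (auto simp: labels_path_append)
  ultimately show ?thesis using u0 by blast
qed

definition relabel :: "('v \<Rightarrow> 'w) \<Rightarrow> ('v \<times> 'a \<times> 'v) set \<Rightarrow> ('w \<times> 'a \<times> 'w) set" where
  "relabel \<phi> E = (\<lambda>(u, a, x). (\<phi> u, a, \<phi> x)) ` E"

text \<open>
  By symmetry of \<open>corr\<close>, one half of each property of an isomorphism gives the
  other half.
\<close>

lemma graphical_rep_unique:
  assumes adm: "admissible A (V, E) v" "admissible A (V', E') v'" "finite A"
    and lang: "lang (V, E) v = lang (V', E') v'"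
  shows "\<exists>\<phi>. bij_betw \<phi> V V' \<and> \<phi> v = v' \<and> E' = relabel \<phi> E"
proof -
  let ?G = "(V, E)" and ?D = "(V', E')"
  have AG: "A_graph A ?G" "A_graph A ?D" using adm by (auto simp: admissible_def)
  have vV: "v \<in> V" "v' \<in> V'" using adm by (auto simp: admissible_def)
  define \<phi> where "\<phi> u = (SOME u'. corr ?G v ?D v' u u')" for u
  have \<phi>: "corr ?G v ?D v' u (\<phi> u)" if "u \<in> V" for u
    unfolding \<phi>_def by (rule someI_ex, rule corr_total[OF adm(1,3) lang]) (use that in auto)
  have uniq: "corr ?G v ?D v' u u' \<Longrightarrow> u \<in> V \<Longrightarrow> u' = \<phi> u" for u u'
    by (rule corr_det[OF AG lang _ \<phi>])
  have corrV: "corr ?G v ?D v' u u' \<Longrightarrow> u \<in> V \<and> u' \<in> V'" for u u'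
    unfolding corr_def using labels_path_vertex[OF AG(1), of v] labels_path_vertex[OF AG(2), of v'] vV by auto
  have inj: "inj_on \<phi> V"
  proof (rule inj_onI)
    fix u x assume ux: "u \<in> V" "x \<in> V" "\<phi> u = \<phi> x"
    from \<phi>[OF ux(1)] have 1: "corr ?D v' ?G v (\<phi> u) u" by (rule corr_sym)
    from \<phi>[OF ux(2)] have 2: "corr ?D v' ?G v (\<phi> u) x" unfolding ux(3) by (rule corr_sym)
    show "u = x" by (rule corr_det[OF AG(2,1) lang[symmetric] 1 2])
  qed
  have "\<phi> ` V = V'"
  proof
    show "V' \<subseteq> \<phi> ` V"
    proof
      fix u' assume "u' \<in> V'"
      then obtain u where "corr ?D v' ?G v u' u" using corr_total[OF adm(2,3) lang[symmetric], of u'] by auto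
      then have "corr ?G v ?D v' u u'" by (rule corr_sym)
      then show "u' \<in> \<phi> ` V" using uniq corrV by blast
    qed
  qed (use \<phi> corrV in auto)
  moreover have "\<phi> v = v'"
  proof -
    have "corr ?G v ?D v' v v'" unfolding corr_def by (rule exI[of _ "[]"]) simp
    from uniq[OF this vV(1)] show ?thesis by simp
  qed
  moreover have "E' = relabel \<phi> E"
  proof (intro subset_antisym subsetI)
    fix e assume "e \<in> E'"
    then obtain u' a x' where e: "e = (u', a, x')" and h: "hop ?D u' (a, True) x'" by (cases e) (auto simp: hop_def)
    then have "u' \<in> V'" using hop_vertices[OF AG(2)] by auto
    then obtain u where u: "corr ?D v' ?G v u' u" using corr_total[OF adm(2,3) lang[symmetric], of u'] by auto
    from corr_hop[OF adm(2,3) AG(1) lang[symmetric] h u] obtain x where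
      x: "hop ?G u (a, True) x" "corr ?D v' ?G v x' x" by blast
    have "u' = \<phi> u" "x' = \<phi> x" using uniq corrV corr_sym[OF u] corr_sym[OF x(2)] by blast+
    with x(1) show "e \<in> relabel \<phi> E" unfolding relabel_def e by (force simp: hop_def)
  next
    fix e assume "e \<in> relabel \<phi> E"
    then obtain u a x where e: "e = (\<phi> u, a, \<phi> x)" and h: "hop ?G u (a, True) x" by (auto simp: hop_def relabel_def)
    then have u: "u \<in> V" using hop_vertices[OF AG(1)] by auto
    from corr_hop[OF adm(1,3) AG(2) lang h \<phi>[OF u]] obtain x' where
      x: "hop ?D (\<phi> u) (a, True) x'" "corr ?G v ?D v' x x'" by blast
    then have "x' = \<phi> x" using uniq corrV by blast
    with x(1) show "e \<in> E'" unfolding e by (simp add: hop_def)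
  qed
  ultimately show ?thesis using inj by (auto simp: bij_betw_def)
qed

lemma relabel_relabel: "relabel \<psi> (relabel \<phi> E) = relabel (\<psi> \<circ> \<phi>) E"
  by (force simp: relabel_def)

lemma relabel_cong: "E \<subseteq> V \<times> UNIV \<times> V \<Longrightarrow> (\<And>u. u \<in> V \<Longrightarrow> \<phi> u = \<psi> u) \<Longrightarrow> relabel \<phi> E = relabel \<psi> E"
  unfolding relabel_def by (intro image_cong) auto

lemma relabel_id: "E \<subseteq> V \<times> UNIV \<times> V \<Longrightarrow> (\<And>u. u \<in> V \<Longrightarrow> \<phi> u = u) \<Longrightarrow> relabel \<phi> E = E"
  using relabel_cong[of E V \<phi> id] by (auto simp: relabel_def)

lemma A_graph_edges: "A_graph A (V, E) \<Longrightarrow> E \<subseteq> V \<times> UNIV \<times> V"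
  by (auto simp: A_graph_def)

lemma hop_relabel: "hop (V, E) u y x \<Longrightarrow> hop (V', relabel \<phi> E) (\<phi> u) y (\<phi> x)"
  by (force simp: hop_def relabel_def split: if_splits)

lemma labels_path_relabel: "labels_path (V, E) u w x \<Longrightarrow> labels_path (V', relabel \<phi> E) (\<phi> u) w (\<phi> x)"
  by (induction w arbitrary: u) (auto intro: hop_relabel)

lemma lang_relabel:
  assumes "A_graph A (V, E)" "inj_on \<phi> V" "v \<in> V"
  shows "lang (\<phi> ` V, relabel \<phi> E) (\<phi> v) = lang (V, E) v"
proof -
  let ?\<psi> = "inv_into V \<phi>"
  have "relabel ?\<psi> (relabel \<phi> E) = E"
    unfolding relabel_relabel
    by (rule relabel_id[OF A_graph_edges[OF assms(1)]]) (use assms(2) in auto)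
  moreover have "?\<psi> (\<phi> v) = v" using assms by simp
  ultimately have "labels_path (\<phi> ` V, relabel \<phi> E) (\<phi> v) w (\<phi> v) \<Longrightarrow> labels_path (V, E) v w v" for w
    using labels_path_relabel[of "\<phi> ` V" "relabel \<phi> E" "\<phi> v" w "\<phi> v" V ?\<psi>] by simp
  then show ?thesis using labels_path_relabel[of V E v _ v "\<phi> ` V" \<phi>] by (auto simp: lang_def)
qed

lemma admissible_relabel:
  assumes adm: "admissible A (V, E) v" and inj: "inj_on \<phi> V"
  shows "admissible A (\<phi> ` V, relabel \<phi> E) (\<phi> v)"
proof -
  have AG: "A_graph A (V, E)" and conn: "connected_graph (V, E)" and trim: "trim (V, E) v" and v: "v \<in> V"
    using adm by (auto simp: admissible_def)
  have EV: "(u, a, x) \<in> E \<Longrightarrow> u \<in> V \<and> x \<in> V \<and> a \<in> A" for u a x using AG by (auto simp: A_graph_def)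
  have shape: "\<exists>u x. e = (\<phi> u, a, \<phi> x) \<and> u \<in> V \<and> x \<in> V \<and> a \<in> A \<and> (u, a, x) \<in> E" if "e \<in> relabel \<phi> E" "fst (snd e) = a" for e a
    using that EV by (force simp: relabel_def)
  have "A_graph A (\<phi> ` V, relabel \<phi> E)"
    unfolding A_graph_def prod.case
  proof (intro conjI allI impI)
    show "finite (\<phi> ` V)" using AG by (auto simp: A_graph_def)
    show "relabel \<phi> E \<subseteq> \<phi> ` V \<times> A \<times> \<phi> ` V" using EV by (auto simp: relabel_def)
  next
    fix u a x x' assume *: "(u, a, x) \<in> relabel \<phi> E \<and> (u, a, x') \<in> relabel \<phi> E"
    from * shape[of "(u, a, x)" a] obtain u0 x0 where
      "u = \<phi> u0" "x = \<phi> x0" "u0 \<in> V" "(u0, a, x0) \<in> E" by auto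
    moreover from * shape[of "(u, a, x')" a] obtain u1 x1 where
      "u = \<phi> u1" "x' = \<phi> x1" "u1 \<in> V" "(u1, a, x1) \<in> E" by auto
    moreover from calculation have "u0 = u1" using inj by (auto dest: inj_onD)
    moreover have "x0 = x1" using calculation AG unfolding A_graph_def by blast
    ultimately show "x = x'" by simp
  next
    fix u u' a x assume *: "(u, a, x) \<in> relabel \<phi> E \<and> (u', a, x) \<in> relabel \<phi> E"
    from * shape[of "(u, a, x)" a] obtain u0 x0 where
      "u = \<phi> u0" "x = \<phi> x0" "x0 \<in> V" "(u0, a, x0) \<in> E" by auto
    moreover from * shape[of "(u', a, x)" a] obtain u1 x1 where
      "u' = \<phi> u1" "x = \<phi> x1" "x1 \<in> V" "(u1, a, x1) \<in> E" by auto
    moreover from calculation have "x0 = x1" using inj by (auto dest: inj_onD)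
    moreover have "u0 = u1" using calculation AG unfolding A_graph_def by blast
    ultimately show "u = u'" by simp
  qed
  moreover have "connected_graph (\<phi> ` V, relabel \<phi> E)"
  proof (rule path_connected_graph)
    fix u x assume "u \<in> fst (\<phi> ` V, relabel \<phi> E)" "x \<in> fst (\<phi> ` V, relabel \<phi> E)"
    then obtain u0 x0 where *: "u = \<phi> u0" "x = \<phi> x0" "u0 \<in> V" "x0 \<in> V" by auto
    then obtain w where "labels_path (V, E) u0 w x0" using connected_path[OF conn, of u0 x0] by auto
    with * labels_path_relabel show "\<exists>w. labels_path (\<phi> ` V, relabel \<phi> E) u w x" by metis
  qed
  moreover have "trim (\<phi> ` V, relabel \<phi> E) (\<phi> v)"
    unfolding trim_def
  proof (intro ballI impI)
    fix w' assume "w' \<in> fst (\<phi> ` V, relabel \<phi> E)" "w' \<noteq> \<phi> v"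
    then obtain w where w: "w' = \<phi> w" "w \<in> V" "w \<noteq> v" by auto
    let ?f = "\<lambda>(u, a, x). (\<phi> u, a, \<phi> x)"
    have inj_f: "inj_on ?f E" by (rule inj_onI) (use EV inj in \<open>auto dest: inj_onD\<close>)
    have "{e \<in> relabel \<phi> E. fst e = w'} = ?f ` {e \<in> E. fst e = w}"
      using w EV inj by (force simp: relabel_def dest: inj_onD)
    then have 1: "card {e \<in> relabel \<phi> E. fst e = w'} = card {e \<in> E. fst e = w}"
      using card_image[OF inj_on_subset[OF inj_f]] by auto
    have "{e \<in> relabel \<phi> E. snd (snd e) = w'} = ?f ` {e \<in> E. snd (snd e) = w}"
      using w EV inj by (force simp: relabel_def dest: inj_onD)
    then have 2: "card {e \<in> relabel \<phi> E. snd (snd e) = w'} = card {e \<in> E. snd (snd e) = w}"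
      using card_image[OF inj_on_subset[OF inj_f]] by auto
    from 1 2 trim w show "\<not> is_leaf (\<phi> ` V, relabel \<phi> E) w'" by (auto simp: is_leaf_def trim_def)
  qed
  ultimately show ?thesis using v by (auto simp: admissible_def)
qed

definition labelled :: "'a set \<Rightarrow> nat \<Rightarrow> (int \<times> 'a \<times> int) set set" where
  "labelled A n = {E. admissible A ({1..int n}, E) 1}"

definition label_lang :: "nat \<Rightarrow> (int \<times> 'a \<times> int) set \<Rightarrow> 'a word set" where
  "label_lang n E = lang ({1..int n}, E) 1"

lemma finite_labelled: "finite A \<Longrightarrow> finite (labelled A n)"
  by (rule finite_subset[of _ "Pow ({1..int n} \<times> A \<times> {1..int n})"])
     (auto simp: labelled_def admissible_def A_graph_def)

lemma subgroups_of_size_eq: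
  assumes "finite A" "n \<ge> 1"
  shows "subgroups_of_size A n = label_lang n ` labelled A n"
proof (intro subset_antisym subsetI)
  fix H assume "H \<in> subgroups_of_size A n"
  then obtain V :: "nat set" and E v where adm: "admissible A (V, E) v" and H: "H = lang (V, E) v" and n: "card V = n"
    by (auto simp: subgroups_of_size_def graphical_rep_lang)
  have "finite V" and v: "v \<in> V" using adm by (auto simp: admissible_def A_graph_def)
  then have "card (V - {v}) = card {2..int n}" using n by simp
  then obtain g where g: "bij_betw g (V - {v}) {2..int n}"
    using finite_same_card_bij[of "V - {v}" "{2..int n}"] \<open>finite V\<close> by auto
  define \<phi> where "\<phi> u = (if u = v then 1 else g u)" for u
  have bij: "bij_betw \<phi> ({v} \<union> (V - {v})) ({1} \<union> {2..int n})"
  proof (rule bij_betw_combine)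
    show "bij_betw \<phi> (V - {v}) {2..int n}"
      using g by (rule bij_betw_cong[THEN iffD2, rotated]) (auto simp: \<phi>_def)
  qed (auto simp: \<phi>_def bij_betw_def)
  have V: "{v} \<union> (V - {v}) = V" using v by blast
  have V': "{1} \<union> {2..int n} = {1..int n}" using assms by auto
  have "bij_betw \<phi> V {1..int n}" using bij unfolding V V' .
  then have \<phi>: "inj_on \<phi> V" "\<phi> ` V = {1..int n}" unfolding bij_betw_def by blast+
  have "\<phi> v = 1" by (simp add: \<phi>_def)
  with \<phi> admissible_relabel[OF adm \<phi>(1)] have "relabel \<phi> E \<in> labelled A n" by (simp add: labelled_def)
  moreover have "label_lang n (relabel \<phi> E) = H"
    using lang_relabel[OF _ \<phi>(1) v, of A E] \<phi> \<open>\<phi> v = 1\<close> adm unfolding H label_lang_def by (auto simp: admissible_def)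
  ultimately show "H \<in> label_lang n ` labelled A n" by blast
next
  fix H assume "H \<in> label_lang n ` labelled A n"
  then obtain E where adm: "admissible A ({1..int n}, E) 1" and H: "H = lang ({1..int n}, E) 1"
    by (auto simp: label_lang_def labelled_def)
  then have AG: "A_graph A ({1..int n}, E)" "connected_graph ({1..int n}, E)" by (auto simp: admissible_def)
  have inj: "inj_on nat {1..int n}" by (auto intro!: inj_onI)
  have "card (nat ` {1..int n}) = n" using card_image[OF inj] by simp
  moreover have "graphical_rep A (nat ` {1..int n}, relabel nat E) (nat 1) H"
    unfolding graphical_rep_lang H
    using admissible_relabel[OF adm inj] lang_relabel[OF AG(1) inj, of 1] assms(2) by auto
  moreover have "fg_subgroup A H" unfolding H by (rule lang_fg[OF AG(1) _ AG(2) assms(1)]) (use assms in auto)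
  ultimately show "H \<in> subgroups_of_size A n"
    unfolding subgroups_of_size_def by (intro CollectI conjI exI[of _ "(nat ` {1..int n}, relabel nat E)"] exI[of _ "nat 1"]) auto
qed

text \<open>
  The permutations of \<open>{2..n}\<close> act freely on the labelled graphs, since each vertex
  is determined by a word leading to it from the root 1, and transitively on the graphs of a
  given subgroup, by uniqueness.
\<close>

lemma card_fibre:
  assumes "finite A" "n \<ge> 1" "E \<in> labelled A n"
  shows "card {E' \<in> labelled A n. label_lang n E' = label_lang n E} = fact (n - 1)"
proof -
  let ?V = "{1..int n}" and ?P = "{\<pi>. \<pi> permutes {2..int n}}"
  have adm: "admissible A (?V, E) 1" using assms(3) by (simp add: labelled_def)
  then have AG: "A_graph A (?V, E)" by (simp add: admissible_def)
  have P: "\<pi> permutes ?V \<and> \<pi> 1 = 1 \<and> inj_on \<pi> ?V \<and> \<pi> ` ?V = ?V" if "\<pi> \<in> ?P" for \<pi>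
  proof -
    have "\<pi> permutes ?V" by (rule permutes_subset[of _ "{2..int n}"]) (use that in auto)
    then show ?thesis using that permutes_not_in[of \<pi> "{2..int n}" 1] by (auto simp: permutes_image permutes_inj_on)
  qed
  have "bij_betw (\<lambda>\<pi>. relabel \<pi> E) ?P {E' \<in> labelled A n. label_lang n E' = label_lang n E}"
    unfolding bij_betw_def
  proof (intro conjI subset_antisym subsetI)
    show "inj_on (\<lambda>\<pi>. relabel \<pi> E) ?P"
    proof (rule inj_onI, rule ext)
      fix \<pi> \<sigma> u assume p: "\<pi> \<in> ?P" "\<sigma> \<in> ?P" "relabel \<pi> E = relabel \<sigma> E"
      show "\<pi> u = \<sigma> u"
      proof (cases "u \<in> ?V")
        case True
        then obtain w where w: "labels_path (?V, E) 1 w u"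
          using connected_path[of "(?V, E)" 1 u] adm assms(2) by (auto simp: admissible_def)
        have "labels_path (?V, relabel \<pi> E) 1 w (\<pi> u)" "labels_path (?V, relabel \<pi> E) 1 w (\<sigma> u)"
          using labels_path_relabel[OF w, of ?V \<pi>] labels_path_relabel[OF w, of ?V \<sigma>] P[OF p(1)] P[OF p(2)] p(3) by auto
        moreover have "A_graph A (?V, relabel \<pi> E)"
          using admissible_relabel[OF adm, of \<pi>] P[OF p(1)] by (auto simp: admissible_def)
        ultimately show ?thesis using labels_path_det by metis
      next
        case False
        then show ?thesis using p(1,2) by (auto simp: permutes_def)
      qed
    qed
  next
    fix E' assume "E' \<in> (\<lambda>\<pi>. relabel \<pi> E) ` ?P"
    then obtain \<pi> where p: "\<pi> \<in> ?P" "E' = relabel \<pi> E" by blast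
    show "E' \<in> {E' \<in> labelled A n. label_lang n E' = label_lang n E}"
      using admissible_relabel[OF adm, of \<pi>] lang_relabel[OF AG, of \<pi> 1] P[OF p(1)] p(2) assms(2)
      by (auto simp: labelled_def label_lang_def)
  next
    fix E' assume "E' \<in> {E' \<in> labelled A n. label_lang n E' = label_lang n E}"
    then have adm': "admissible A (?V, E') 1" and eq: "lang (?V, E) 1 = lang (?V, E') 1" by (auto simp: labelled_def label_lang_def)
    from graphical_rep_unique[OF adm adm' assms(1) eq] obtain \<phi> where
      \<phi>: "bij_betw \<phi> ?V ?V" "\<phi> 1 = 1" "E' = relabel \<phi> E" by blast
    define \<pi> where "\<pi> u = (if u \<in> {2..int n} then \<phi> u else u)" for u
    have V: "{2..int n} = ?V - {1}" by auto
    have "bij_betw \<phi> (?V - {1}) (?V - {\<phi> 1})"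
      using \<phi>(1) by (rule bij_betw_DiffI) (use assms(2) \<phi>(2) in auto)
    then have "bij_betw \<phi> {2..int n} {2..int n}" by (simp add: \<phi>(2) V)
    then have "bij_betw \<pi> {2..int n} {2..int n}"
      by (rule bij_betw_cong[THEN iffD2, rotated]) (auto simp: \<pi>_def)
    then have "\<pi> permutes {2..int n}" by (rule bij_imp_permutes) (auto simp: \<pi>_def)
    moreover have "relabel \<pi> E = relabel \<phi> E"
    proof (rule relabel_cong[OF A_graph_edges[OF AG]])
      fix u assume "u \<in> ?V"
      then show "\<pi> u = \<phi> u" using \<phi>(2) by (cases "u = 1") (auto simp: \<pi>_def)
    qed
    ultimately show "E' \<in> (\<lambda>\<pi>. relabel \<pi> E) ` ?P" using \<phi>(3) by auto
  qed
  then have "card {E' \<in> labelled A n. label_lang n E' = label_lang n E} = card ?P" by (simp add: bij_betw_same_card)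
  also have "\<dots> = fact (card {2..int n})" by (rule card_permutations) auto
  also have "card {2..int n} = n - 1" by simp
  finally show ?thesis .
qed

lemma card_labelled:
  assumes "finite A" "n \<ge> 1"
  shows "card (labelled A n) = card (subgroups_of_size A n) * fact (n - 1)"
proof -
  have "card (labelled A n) = (\<Sum>H\<in>label_lang n ` labelled A n. card {E \<in> labelled A n. label_lang n E = H})"
    using card_eq_sum sum.image_gen[OF finite_labelled[OF assms(1)], of "\<lambda>_. 1::nat" n "label_lang n"] by simp
  also have "\<dots> = (\<Sum>H\<in>label_lang n ` labelled A n. fact (n - 1))"
    by (intro sum.cong refl) (use card_fibre[OF assms] in auto)
  finally show ?thesis by (simp add: subgroups_of_size_eq[OF assms])
qed

text \<open>
  A single cycle is admissible.
\<close>

lemma labelled_nonempty: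
  assumes "a \<in> A" "n \<ge> 1"
  shows "labelled A n \<noteq> {}"
proof -
  let ?V = "{1..int n}"
  define nx where "nx u = (if u = int n then 1 else u + 1)" for u
  define E where "E = (\<lambda>u. (u, a, nx u)) ` ?V"
  have nxV: "nx u \<in> ?V" if "u \<in> ?V" for u using that by (auto simp: nx_def)
  have inj: "inj_on nx ?V" by (auto simp: inj_on_def nx_def)
  then have surj: "nx ` ?V = ?V" using nxV by (intro endo_inj_surj) auto
  have AG: "A_graph A (?V, E)"
    using assms(1) nxV inj by (auto simp: A_graph_def E_def dest: inj_onD)
  have hop: "hop (?V, E) u (a, True) (nx u)" if "u \<in> ?V" for u using that by (auto simp: hop_def E_def)
  have "\<exists>w. labels_path (?V, E) 1 w (int k)" if "k \<ge> 1" "k \<le> n" for k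
    using that
  proof (induction k rule: nat_induct_at_least)
    case base
    then show ?case by (intro exI[of _ "[]"]) simp
  next
    case (Suc k)
    then obtain w where "labels_path (?V, E) 1 w (int k)" by auto
    moreover have "hop (?V, E) (int k) (a, True) (int (Suc k))"
      using hop[of "int k"] Suc by (auto simp: nx_def add.commute)
    ultimately show ?case by (intro exI[of _ "w @ [(a, True)]"]) (auto simp: labels_path_append)
  qed
  note p = this
  have p1: "\<exists>w. labels_path (?V, E) 1 w u" if "u \<in> ?V" for u using p[of "nat u"] that by auto
  have "connected_graph (?V, E)"
  proof (rule path_connected_graph)
    fix u v assume "u \<in> fst (?V, E)" "v \<in> fst (?V, E)"
    then have "u \<in> ?V" "v \<in> ?V" by auto
    with p1 obtain w w' where "labels_path (?V, E) 1 w u" "labels_path (?V, E) 1 w' v" by blast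
    then show "\<exists>w. labels_path (?V, E) u w v"
      by (intro exI[of _ "inv_word w @ w'"]) (auto simp: labels_path_append labels_path_inv)
  qed
  moreover have "\<not> is_leaf (?V, E) w" if "w \<in> ?V" for w
  proof -
    have pos: "x \<in> X \<Longrightarrow> finite X \<Longrightarrow> 0 < card X" for x and X :: "(int \<times> 'a \<times> int) set"
      using card_gt_0_iff by blast
    have fin: "finite E" by (simp add: E_def)
    have "w \<in> nx ` ?V" using that unfolding surj .
    then obtain u where u: "w = nx u" "u \<in> ?V" by (rule imageE)
    have "(u, a, w) \<in> {e \<in> E. snd (snd e) = w}" using u unfolding E_def by simp
    from pos[OF this] have "card {e \<in> E. snd (snd e) = w} > 0" using fin by simp
    moreover have "(w, a, nx w) \<in> {e \<in> E. fst e = w}" using that unfolding E_def by simp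
    from pos[OF this] have "card {e \<in> E. fst e = w} > 0" using fin by simp
    ultimately show ?thesis by (simp add: is_leaf_def)
  qed
  ultimately have "E \<in> labelled A n" using AG assms(2) by (auto simp: labelled_def admissible_def trim_def)
  then show ?thesis by blast
qed

section \<open>Counting partial injections\<close>

definition pinj :: "'v set \<Rightarrow> ('v \<times> 'v) set set" where
  "pinj S = {R. R \<subseteq> S \<times> S \<and> single_valued R \<and> single_valued (R\<inverse>)}"

lemma finite_pinj: "finite S \<Longrightarrow> finite (pinj S)"
  by (rule finite_subset[of _ "Pow (S \<times> S)"]) (auto simp: pinj_def)

lemma pinj_converse: "R \<in> pinj S \<Longrightarrow> R\<inverse> \<in> pinj S"
  by (auto simp: pinj_def)

lemma card_Domain: "R \<in> pinj S \<Longrightarrow> card (Domain R) = card R"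
  by (rule card_image[of fst R, unfolded Domain_fst[symmetric]])
     (auto simp: pinj_def inj_on_def single_valued_def)

lemma card_Range: "R \<in> pinj S \<Longrightarrow> card (Range R) = card R"
  using card_Domain[OF pinj_converse] by (simp add: card_inverse)

lemma Field_pinj: "R \<in> pinj S \<Longrightarrow> Domain R \<subseteq> S" "R \<in> pinj S \<Longrightarrow> Range R \<subseteq> S"
  by (auto simp: pinj_def)

lemma card_pinj_le: "finite S \<Longrightarrow> R \<in> pinj S \<Longrightarrow> card R \<le> card S"
  using card_mono[OF _ Field_pinj(1)] card_Domain by metis

lemma finite_pinj_elem: "finite S \<Longrightarrow> R \<in> pinj S \<Longrightarrow> finite R"
  by (rule finite_subset[of _ "S \<times> S"]) (auto simp: pinj_def)

lemma card_Diff_pinj: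
  assumes "finite S" "R \<in> pinj S"
  shows "card (S - Domain R) = card S - card R" "card (S - Range R) = card S - card R"
  using card_Diff_subset[OF finite_subset[OF Field_pinj(1)[OF assms(2)] assms(1)] Field_pinj(1)[OF assms(2)]]
    card_Diff_subset[OF finite_subset[OF Field_pinj(2)[OF assms(2)] assms(1)] Field_pinj(2)[OF assms(2)]]
  unfolding card_Domain[OF assms(2)] card_Range[OF assms(2)] by auto

definition rank_count :: "'v set \<Rightarrow> nat \<Rightarrow> nat" where
  "rank_count S k = card {R \<in> pinj S. card R = k}"

text \<open>
  Both sides count the partial injections of rank \<open>Suc k\<close> with a marked pair: the
  pair can be chosen among \<open>Suc k\<close> ones, or be added to a partial injection of rank
  \<open>k\<close>, joining a vertex without image to one without preimage.
\<close>

lemma rank_count_Suc: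
  assumes "finite S"
  shows "Suc k * rank_count S (Suc k) = (card S - k)\<^sup>2 * rank_count S k"
proof -
  let ?X = "{R \<in> pinj S. card R = Suc k}" and ?Y = "{R \<in> pinj S. card R = k}"
  let ?A = "SIGMA R:?X. R" and ?B = "SIGMA R:?Y. (S - Domain R) \<times> (S - Range R)"
  have fin: "finite ?X" "finite ?Y" using finite_pinj[OF assms] by auto
  have "bij_betw (\<lambda>(R, e). (R - {e}, e)) ?A ?B"
  proof (rule bij_betw_byWitness[where f' = "\<lambda>(R, e). (insert e R, e)"])
    show "\<forall>a\<in>?A. (\<lambda>(R, e). (insert e R, e)) ((\<lambda>(R, e). (R - {e}, e)) a) = a" by auto
    show "\<forall>b\<in>?B. (\<lambda>(R, e). (R - {e}, e)) ((\<lambda>(R, e). (insert e R, e)) b) = b" by auto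
    show "(\<lambda>(R, e). (R - {e}, e)) ` ?A \<subseteq> ?B"
    proof clarify
      fix R u v assume R: "R \<in> pinj S" "card R = Suc k" "(u, v) \<in> R"
      then have "card (R - {(u, v)}) = k" using finite_pinj_elem[OF assms] by simp
      moreover have "R - {(u, v)} \<in> pinj S" "u \<in> S" "v \<in> S" using R by (auto simp: pinj_def single_valued_def)
      moreover have "u \<notin> Domain (R - {(u, v)})" "v \<notin> Range (R - {(u, v)})" using R by (auto simp: pinj_def single_valued_def)
      ultimately show "R - {(u, v)} \<in> ?Y \<and> (u, v) \<in> (S - Domain (R - {(u, v)})) \<times> (S - Range (R - {(u, v)}))" by blast
    qed
    show "(\<lambda>(R, e). (insert e R, e)) ` ?B \<subseteq> ?A"
    proof clarify
      fix R u v assume R: "R \<in> pinj S" "k = card R" "u \<in> S" "u \<notin> Domain R" "v \<in> S" "v \<notin> Range R"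
      then have "card (insert (u, v) R) = Suc (card R)" using finite_pinj_elem[OF assms R(1)] by (subst card_insert_disjoint) auto
      moreover have "insert (u, v) R \<in> pinj S"
        unfolding pinj_def single_valued_def
      proof (intro CollectI conjI allI impI)
        show "insert (u, v) R \<subseteq> S \<times> S" using R by (auto simp: pinj_def)
      next
        fix x y z assume "(x, y) \<in> insert (u, v) R" "(x, z) \<in> insert (u, v) R"
        with R(1,4) show "y = z" unfolding pinj_def single_valued_def Domain_iff by auto
      next
        fix x y z assume "(x, y) \<in> (insert (u, v) R)\<inverse>" "(x, z) \<in> (insert (u, v) R)\<inverse>"
        with R(1,6) show "y = z" unfolding pinj_def single_valued_def Range_iff by auto
      qed
      ultimately show "insert (u, v) R \<in> {R' \<in> pinj S. card R' = Suc (card R)} \<and> (u, v) \<in> insert (u, v) R" by blast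
    qed
  qed
  then have "card ?A = card ?B" by (rule bij_betw_same_card)
  moreover have "card ?A = Suc k * rank_count S (Suc k)"
    using fin finite_pinj_elem[OF assms] by (subst card_SigmaI) (auto simp: rank_count_def)
  moreover have "card ?B = (\<Sum>R\<in>?Y. (card S - k)\<^sup>2)"
  proof (subst card_SigmaI)
    show "(\<Sum>R\<in>?Y. card ((S - Domain R) \<times> (S - Range R))) = (\<Sum>R\<in>?Y. (card S - k)\<^sup>2)"
    proof (rule sum.cong[OF refl])
      fix R assume R: "R \<in> ?Y"
      then have "card (S - Domain R) = card S - k" "card (S - Range R) = card S - k"
        using card_Diff_pinj[OF assms, of R] by auto
      then show "card ((S - Domain R) \<times> (S - Range R)) = (card S - k)\<^sup>2" by (simp add: power2_eq_square card_cartesian_product)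
    qed
  qed (use fin assms in auto)
  ultimately show ?thesis by (simp add: rank_count_def)
qed

lemma Suc_binomial_Suc: "Suc k * (n choose Suc k) = (n - k) * (n choose k)"
  using times_binomial_minus1_eq[of "Suc k" n] binomial_absorb_comp[of n k] by simp

lemma rank_count:
  assumes "finite S"
  shows "rank_count S k = (card S choose k)\<^sup>2 * fact k"
proof (induction k)
  case 0
  have "{R \<in> pinj S. card R = 0} = {{}}"
    using finite_pinj_elem[OF assms] by (auto simp: pinj_def single_valued_def)
  then show ?case by (simp add: rank_count_def)
next
  case (Suc k)
  have "Suc k * rank_count S (Suc k) = ((card S - k) * (card S choose k))\<^sup>2 * fact k"
    unfolding rank_count_Suc[OF assms] Suc by (simp add: power_mult_distrib)
  also have "\<dots> = Suc k * ((card S choose Suc k)\<^sup>2 * fact (Suc k))"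
    unfolding Suc_binomial_Suc[symmetric] by (simp add: power2_eq_square algebra_simps)
  finally show ?case by (simp only: mult_left_cancel)
qed

lemma sum_by_rank:
  assumes "finite S"
  shows "(\<Sum>R\<in>pinj S. g (card R)) = (\<Sum>k\<le>card S. of_nat (rank_count S k) * (g k :: 'b :: comm_semiring_1))"
proof -
  have "(\<Sum>R\<in>pinj S. g (card R)) = (\<Sum>k\<le>card S. \<Sum>R | R \<in> pinj S \<and> card R = k. g (card R))"
    using card_pinj_le[OF assms] by (intro sum.group[symmetric] finite_pinj assms) auto
  also have "\<dots> = (\<Sum>k\<le>card S. of_nat (rank_count S k) * g k)"
    by (intro sum.cong refl) (auto simp: rank_count_def)
  finally show ?thesis .
qed

text \<open>
  The number of partial injections of a set of size \<open>n\<close>, divided by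
  \<open>n!\<close>; it grows like \<open>exp (2 * sqrt n)\<close> up to a power of
  \<open>n\<close>.
\<close>

definition pinj_weight :: "nat \<Rightarrow> real" where
  "pinj_weight n = (\<Sum>j\<le>n. real (n choose j) / fact j)"

lemma card_pinj:
  assumes "finite S"
  shows "real (card (pinj S)) = fact (card S) * pinj_weight (card S)"
proof -
  let ?n = "card S"
  have "real (card (pinj S)) = (\<Sum>k\<le>?n. real (rank_count S k) * 1)"
    using sum_by_rank[OF assms, of "\<lambda>_. 1 :: real"] by simp
  also have "\<dots> = (\<Sum>j\<le>?n. real (rank_count S (?n - j)))"
    by (rule sum.reindex_bij_witness[of _ "\<lambda>j. ?n - j" "\<lambda>j. ?n - j"]) auto
  also have "\<dots> = (\<Sum>j\<le>?n. fact ?n * (real (?n choose j) / fact j))"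
  proof (intro sum.cong refl)
    fix j assume "j \<in> {..?n}"
    then have j: "j \<le> ?n" by simp
    have f: "fact j * fact (?n - j) * real (?n choose j) = fact ?n"
      using binomial_fact_lemma[OF j] by (metis of_nat_fact of_nat_mult)
    have "real (rank_count S (?n - j)) = (real (?n choose j))\<^sup>2 * fact (?n - j)"
      using binomial_symmetric[OF j] by (simp add: rank_count[OF assms])
    also have "\<dots> = fact ?n * (real (?n choose j) / fact j)"
      unfolding f[symmetric] by (simp add: power2_eq_square)
    finally show "real (rank_count S (?n - j)) = fact ?n * (real (?n choose j) / fact j)" .
  qed
  finally show ?thesis by (simp add: pinj_weight_def sum_distrib_left)
qed

lemma pinj_weight_mono: "m \<le> n \<Longrightarrow> pinj_weight m \<le> pinj_weight n"
  unfolding pinj_weight_def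
  by (rule order_trans[OF sum_mono sum_mono2]) (auto intro!: divide_right_mono binomial_right_mono)

lemma pinj_weight_pos: "pinj_weight n > 0"
proof -
  have "pinj_weight 0 \<le> pinj_weight n" by (rule pinj_weight_mono) simp
  then show ?thesis by (simp add: pinj_weight_def)
qed

text \<open>
  Any base whose square is below 2 would do instead of \<open>5 / 4\<close>: the square competes
  with a binomial coefficient \<open>n choose s\<close>, \<open>2 * s \<le> n\<close>.
\<close>

lemma pinj_weight_le: "pinj_weight n \<le> exp 4 * (5 / 4) ^ n"
proof -
  have "real (n choose j) / fact j \<le> exp 4 * (real (n choose j) * (1/4) ^ j)" for j
  proof -
    have "(4::real) ^ j /\<^sub>R fact j \<le> exp 4"
      using sum_le_suminf[OF sums_summable[OF exp_converges[of "4::real"]], of "{j}"]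
        sums_unique[OF exp_converges[of "4::real"]] by simp
    then have "4 ^ j / fact j \<le> exp (4::real)" by (simp add: divide_inverse mult.commute)
    then have "(4 ^ j / fact j) * (real (n choose j) * (1/4) ^ j) \<le> exp 4 * (real (n choose j) * (1/4) ^ j)"
      by (rule mult_right_mono) auto
    then show ?thesis by (simp add: power_divide)
  qed
  then have "pinj_weight n \<le> (\<Sum>j\<le>n. exp 4 * (real (n choose j) * (1/4) ^ j))"
    unfolding pinj_weight_def by (rule sum_mono)
  also have "\<dots> = exp 4 * (1/4 + 1) ^ n"
    by (subst binomial_ring) (simp add: sum_distrib_left)
  finally show ?thesis by simp
qed

lemma card_pinj_minus:
  assumes "finite S" "w \<in> S"
  shows "real (card S) * card (pinj (S - {w})) \<le> card (pinj S)"
proof -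
  obtain n where n: "card S = Suc n" using assms by (metis card.empty card_0_eq empty_iff not0_implies_Suc)
  then have "card (S - {w}) = n" using assms by simp
  with n have "real (card S) * card (pinj (S - {w})) = fact (card S) * pinj_weight n"
    using assms by (simp add: card_pinj)
  also have "\<dots> \<le> fact (card S) * pinj_weight (card S)"
    by (intro mult_left_mono pinj_weight_mono) (auto simp: n)
  finally show ?thesis using assms by (simp add: card_pinj)
qed

text \<open>
  Summed over all partial injections, the square of the number of vertices without image equals
  the rank, by the double counting behind \<open>rank_count_Suc\<close>. So it is at most
  \<open>n\<close> on average, and the number itself is at most \<open>sqrt n\<close> on
  average.
\<close>

lemma sum_deficiency:
  assumes "finite S" "S \<noteq> {}"
  shows "(\<Sum>R\<in>pinj S. real (card S) - real (card R)) \<le> sqrt (card S) * card (pinj S)"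
proof -
  let ?n = "card S" and ?N = "real (card (pinj S))"
  have n: "?n > 0" using assms by (simp add: card_gt_0_iff)
  have "(\<Sum>R\<in>pinj S. (real ?n - real (card R))\<^sup>2) = (\<Sum>k\<le>?n. real (rank_count S k) * (real ?n - real k)\<^sup>2)"
    by (rule sum_by_rank[OF assms(1)])
  also have "\<dots> = (\<Sum>k\<le>?n. real ((?n - k)\<^sup>2 * rank_count S k))"
    by (intro sum.cong refl) (auto simp: of_nat_diff)
  also have "\<dots> = (\<Sum>k\<le>?n. real (Suc k * rank_count S (Suc k)))" by (simp only: rank_count_Suc[OF assms(1)])
  also have "\<dots> = (\<Sum>k\<le>Suc ?n. real (k * rank_count S k))"
    by (subst sum.atMost_Suc_shift) simp
  also have "\<dots> = (\<Sum>k\<le>?n. real (rank_count S k) * real k)"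
    by (simp add: rank_count[OF assms(1)] mult.commute)
  also have "\<dots> = (\<Sum>R\<in>pinj S. real (card R))" by (rule sum_by_rank[OF assms(1), symmetric])
  also have "\<dots> \<le> (\<Sum>R\<in>pinj S. real ?n)" using card_pinj_le[OF assms(1)] by (intro sum_mono) auto
  finally have sq: "(\<Sum>R\<in>pinj S. (real ?n - real (card R))\<^sup>2) \<le> ?N * ?n" by simp
  \<comment> \<open>The scaling balances the two summands, as \<open>x\<^sup>2\<close> is at most \<open>?n\<close> on average.\<close>
  have "x \<le> (x\<^sup>2 / sqrt ?n + sqrt ?n) / 2" for x :: real
  proof -
    have "0 \<le> (x - sqrt ?n)\<^sup>2 / sqrt ?n" by simp
    also have "\<dots> = x\<^sup>2 / sqrt ?n + sqrt ?n - 2 * x"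
      using n by (simp add: power2_diff field_simps)
    finally show ?thesis by simp
  qed
  then have "(\<Sum>R\<in>pinj S. real ?n - real (card R)) \<le> (\<Sum>R\<in>pinj S. ((real ?n - real (card R))\<^sup>2 / sqrt ?n + sqrt ?n) / 2)"
    by (intro sum_mono)
  also have "\<dots> = ((\<Sum>R\<in>pinj S. (real ?n - real (card R))\<^sup>2) / sqrt ?n + ?N * sqrt ?n) / 2"
    by (simp add: sum_divide_distrib[symmetric] sum.distrib)
  also have "\<dots> \<le> (?N * ?n / sqrt ?n + ?N * sqrt ?n) / 2"
    using sq by (intro divide_right_mono add_right_mono) auto
  also have "\<dots> = sqrt ?n * ?N" by (simp add: real_div_sqrt times_divide_eq_right[symmetric] del: times_divide_eq_right)
  finally show ?thesis .
qed

definition isolating :: "'v set \<Rightarrow> 'v \<Rightarrow> ('v \<times> 'v) set set" where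
  "isolating S w = {R \<in> pinj S. w \<notin> Domain R \<and> w \<notin> Range R}"

definition missing :: "'v set \<Rightarrow> 'v \<Rightarrow> ('v \<times> 'v) set set" where
  "missing S w = {R \<in> pinj S. w \<notin> Domain R \<or> w \<notin> Range R}"

text \<open>
  At most one of the four half-edges of a vertex is present exactly if one of the two injections
  misses the vertex on both sides and the other one on at least one side.
\<close>

definition leaf_pairs :: "'v set \<Rightarrow> (('v \<times> 'v) set \<times> ('v \<times> 'v) set) set" where
  "leaf_pairs S = (\<Union>w\<in>S. isolating S w \<times> missing S w \<union> missing S w \<times> isolating S w)"

definition splitting :: "'v set \<Rightarrow> 'v set \<Rightarrow> ('v \<times> 'v) set set" where
  "splitting S T = {R \<in> pinj S. R \<subseteq> T \<times> T \<union> (S - T) \<times> (S - T)}"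

definition split_pairs :: "'v set \<Rightarrow> (('v \<times> 'v) set \<times> ('v \<times> 'v) set) set" where
  "split_pairs S = (\<Union>T\<in>{T. T \<subseteq> S \<and> T \<noteq> {} \<and> 2 * card T \<le> card S}. splitting S T \<times> splitting S T)"

text \<open>
  The first factor of each product is a proportion of at most \<open>1 / n\<close> of all
  partial injections, and the sum of the second factors over all vertices is controlled by
  \<open>sum_deficiency\<close>.
\<close>

lemma card_leaf_pairs:
  assumes "finite S" "S \<noteq> {}"
  shows "real (card (leaf_pairs S)) \<le> 4 / sqrt (card S) * (card (pinj S))\<^sup>2"
proof -
  let ?n = "card S" and ?N = "real (card (pinj S))"
  have n: "?n > 0" using assms by (simp add: card_gt_0_iff)
  have fin: "finite (isolating S w)" "finite (missing S w)" for w
    using finite_pinj[OF assms(1)] by (auto simp: isolating_def missing_def)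
  have iso: "real (card (isolating S w)) \<le> ?N / ?n" if "w \<in> S" for w
  proof -
    have "isolating S w = pinj (S - {w})" by (auto simp: isolating_def pinj_def)
    then show ?thesis using card_pinj_minus[OF assms(1) that] n by (simp add: field_simps)
  qed
  have miss: "(\<Sum>w\<in>S. real (card (missing S w))) \<le> 2 * (sqrt ?n * ?N)"
  proof -
    have "(\<Sum>w\<in>S. real (card (missing S w))) = (\<Sum>w\<in>S. \<Sum>R\<in>pinj S. of_bool (w \<notin> Domain R \<or> w \<notin> Range R))"
      using finite_pinj[OF assms(1)] by (simp add: missing_def sum.If_cases of_bool_def Int_def)
    also have "\<dots> = (\<Sum>R\<in>pinj S. \<Sum>w\<in>S. of_bool (w \<notin> Domain R \<or> w \<notin> Range R))" by (rule sum.swap)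
    also have "\<dots> \<le> (\<Sum>R\<in>pinj S. 2 * (real ?n - real (card R)))"
    proof (rule sum_mono)
      fix R assume R: "R \<in> pinj S"
      have "(\<Sum>w\<in>S. of_bool (w \<notin> Domain R \<or> w \<notin> Range R)) \<le> (\<Sum>w\<in>S. of_bool (w \<notin> Domain R) + (of_bool (w \<notin> Range R) :: real))"
        by (intro sum_mono) auto
      also have "\<dots> = real (card (S - Domain R)) + real (card (S - Range R))"
        using assms(1) by (simp add: sum.distrib sum.If_cases of_bool_def Int_def set_diff_eq)
      also have "\<dots> = 2 * (real ?n - real (card R))"
        using card_Diff_pinj[OF assms(1) R] card_pinj_le[OF assms(1) R] by (simp add: of_nat_diff)
      finally show "(\<Sum>w\<in>S. of_bool (w \<notin> Domain R \<or> w \<notin> Range R)) \<le> 2 * (real ?n - real (card R))" .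
    qed
    also have "\<dots> \<le> 2 * (sqrt ?n * ?N)"
      using sum_deficiency[OF assms] unfolding sum_distrib_left[symmetric] by simp
    finally show ?thesis .
  qed
  have "card (leaf_pairs S) \<le> (\<Sum>w\<in>S. card (isolating S w \<times> missing S w \<union> missing S w \<times> isolating S w))"
    unfolding leaf_pairs_def by (rule card_UN_le[OF assms(1)])
  also have "\<dots> \<le> (\<Sum>w\<in>S. 2 * (card (isolating S w) * card (missing S w)))"
    by (intro sum_mono order_trans[OF card_Un_le]) (simp add: card_cartesian_product mult.commute)
  finally have "real (card (leaf_pairs S)) \<le> (\<Sum>w\<in>S. 2 * (real (card (isolating S w)) * real (card (missing S w))))"
    by (metis (mono_tags, lifting) of_nat_mono of_nat_sum of_nat_mult of_nat_numeral sum.cong)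
  also have "\<dots> \<le> (\<Sum>w\<in>S. 2 * (?N / ?n * real (card (missing S w))))"
    by (intro sum_mono mult_left_mono mult_right_mono iso) auto
  also have "\<dots> = 2 * (?N / ?n) * (\<Sum>w\<in>S. real (card (missing S w)))"
    by (simp add: sum_distrib_left mult.assoc)
  also have "\<dots> \<le> 2 * (?N / ?n) * (2 * (sqrt ?n * ?N))"
    by (intro mult_left_mono miss) auto
  also have "\<dots> = 4 * (sqrt ?n / ?n) * ?N\<^sup>2" by (simp add: power2_eq_square)
  also have "sqrt ?n / ?n = 1 / sqrt ?n" using n by (simp add: field_simps)
  finally show ?thesis by simp
qed

text \<open>
  A partial injection that respects the splitting is a pair of partial injections of the two
  parts. The weight of the larger part is bounded by that of \<open>S\<close>.
\<close>

lemma card_splitting: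
  assumes "finite S" "T \<subseteq> S"
  shows "real (card (splitting S T)) \<le> card (pinj S) * pinj_weight (card T) / (card S choose card T)"
proof -
  let ?n = "card S" and ?s = "card T"
  have fT: "finite T" using assms finite_subset by blast
  have le: "?s \<le> ?n" using assms card_mono by blast
  have f: "fact ?s * fact (?n - ?s) * real (?n choose ?s) = fact ?n"
    using binomial_fact_lemma[OF le] by (metis of_nat_fact of_nat_mult)
  have c0: "real (?n choose ?s) > 0" using le by simp
  have "card (splitting S T) \<le> card (pinj T \<times> pinj (S - T))"
  proof (rule card_inj_on_le)
    let ?f = "\<lambda>R. (R \<inter> T \<times> T, R \<inter> (S - T) \<times> (S - T))"
    show "inj_on ?f (splitting S T)"
      by (rule inj_onI) (auto simp: splitting_def)
    show "?f ` splitting S T \<subseteq> pinj T \<times> pinj (S - T)"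
      by (auto simp: splitting_def pinj_def single_valued_def)
    show "finite (pinj T \<times> pinj (S - T))" using fT assms by (auto intro!: finite_pinj)
  qed
  then have "real (card (splitting S T)) \<le> real (card (pinj T)) * real (card (pinj (S - T)))"
    by (simp add: card_cartesian_product of_nat_mult[symmetric] del: of_nat_mult)
  also have "\<dots> = (fact ?s * fact (?n - ?s)) * (pinj_weight ?s * pinj_weight (?n - ?s))"
    using card_Diff_subset[OF fT assms(2)] fT assms by (simp add: card_pinj)
  also have "\<dots> \<le> (fact ?s * fact (?n - ?s)) * (pinj_weight ?s * pinj_weight ?n)"
    using pinj_weight_pos[of ?s] by (intro mult_left_mono pinj_weight_mono) auto
  also have "fact ?s * fact (?n - ?s) = fact ?n / real (?n choose ?s)"
    using f c0 by (simp add: field_simps)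
  also have "fact ?n / real (?n choose ?s) * (pinj_weight ?s * pinj_weight ?n) = card (pinj S) * pinj_weight ?s / (?n choose ?s)"
    using assms by (simp add: card_pinj)
  finally show ?thesis by (simp add: algebra_simps)
qed

lemma binomial_lower:
  assumes "1 \<le> s" "2 * s \<le> n"
  shows "real n / s * 2 ^ (s - 1) \<le> real (n choose s)"
proof -
  obtain k where k: "s = Suc k" using assms by (cases s) auto
  have "2 ^ k \<le> real (n - 1 choose k)"
  proof (cases "k = 0")
    case False
    have "2 * k \<le> n - 1" using assms k by simp
    then have "real (2 * k) \<le> real (n - 1)" by (simp only: of_nat_le_iff)
    then have "(2::real) \<le> real (n - 1) / real k" using False by (simp add: le_divide_eq)
    then have "2 ^ k \<le> (real (n - 1) / real k) ^ k" by (rule power_mono) simp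
    also have "\<dots> \<le> real (n - 1 choose k)" by (rule binomial_ge_n_over_k_pow_k) (use \<open>2 * k \<le> n - 1\<close> in simp)
    finally show ?thesis .
  qed simp
  then have "real n * 2 ^ k \<le> real n * real (n - 1 choose k)" by (rule mult_left_mono) simp
  also have "\<dots> = real s * real (n choose s)"
    using times_binomial_minus1_eq[of s n] k by (metis diff_Suc_1 of_nat_mult zero_less_Suc)
  finally show ?thesis using k by (simp add: field_simps)
qed

text \<open>
  Each of the \<open>n choose s\<close> subsets of size \<open>s\<close> contributes the square
  of \<open>1 / (n choose s)\<close>, so that one factor remains; it beats the exponential bound
  for the weights because \<open>n choose s\<close> is at least \<open>n / s * 2 ^ (s -
  1)\<close>.
\<close>

lemma card_split_pairs:
  assumes "finite S" "S \<noteq> {}"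
  shows "real (card (split_pairs S)) \<le> 144 * exp 8 / card S * (card (pinj S))\<^sup>2"
proof -
  let ?n = "card S" and ?N = "real (card (pinj S))"
  have n: "?n > 0" using assms by (simp add: card_gt_0_iff)
  let ?I = "{T. T \<subseteq> S \<and> T \<noteq> {} \<and> 2 * card T \<le> ?n}"
  have finI: "finite ?I" using assms(1) by auto
  define h where "h s = pinj_weight s / real (?n choose s)" for s
  have "card (split_pairs S) \<le> (\<Sum>T\<in>?I. card (splitting S T \<times> splitting S T))"
    unfolding split_pairs_def by (rule card_UN_le[OF finI])
  then have "real (card (split_pairs S)) \<le> real (\<Sum>T\<in>?I. card (splitting S T \<times> splitting S T))" by (rule of_nat_mono)
  also have "\<dots> = (\<Sum>T\<in>?I. (real (card (splitting S T)))\<^sup>2)"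
    by (simp add: card_cartesian_product power2_eq_square)
  also have "\<dots> \<le> (\<Sum>T\<in>?I. (?N * h (card T))\<^sup>2)"
  proof (intro sum_mono power_mono)
    fix T assume "T \<in> ?I"
    then show "real (card (splitting S T)) \<le> ?N * h (card T)"
      using card_splitting[OF assms(1), of T] by (simp add: h_def)
  qed simp
  also have "\<dots> = (\<Sum>s\<in>{1..?n div 2}. \<Sum>T | T \<in> ?I \<and> card T = s. (?N * h (card T))\<^sup>2)"
  proof (rule sum.group[symmetric, OF finI])
    show "card ` ?I \<subseteq> {1..?n div 2}"
    proof (rule image_subsetI)
      fix T assume "T \<in> ?I"
      then have T: "T \<subseteq> S" "2 * card T \<le> ?n" "T \<noteq> {}" by auto
      then have "card T > 0" using finite_subset[OF T(1) assms(1)] by (auto simp: card_gt_0_iff)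
      with T(2) show "card T \<in> {1..?n div 2}" by auto
    qed
  qed simp
  also have "\<dots> \<le> (\<Sum>s\<in>{1..?n div 2}. ?N\<^sup>2 * (16 * exp 8 / ?n * (225 / 256) ^ s))"
  proof (rule sum_mono)
    fix s assume "s \<in> {1..?n div 2}"
    then have s: "1 \<le> s" "2 * s \<le> ?n" by auto
    have c0: "real (?n choose s) > 0" using s by simp
    have "card {T \<in> ?I. card T = s} \<le> card {T. T \<subseteq> S \<and> card T = s}"
      by (rule card_mono) (use assms(1) in auto)
    then have c: "card {T \<in> ?I. card T = s} \<le> (?n choose s)" by (simp add: n_subsets[OF assms(1)])
    have "(\<Sum>T | T \<in> ?I \<and> card T = s. (?N * h (card T))\<^sup>2) = real (card {T \<in> ?I. card T = s}) * (?N * h s)\<^sup>2"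
      by simp
    also have "\<dots> \<le> real (?n choose s) * (?N * h s)\<^sup>2" using c by (intro mult_right_mono) auto
    also have "\<dots> = ?N\<^sup>2 * ((pinj_weight s)\<^sup>2 / real (?n choose s))"
      using c0 by (simp add: h_def power2_eq_square)
    also have "\<dots> \<le> ?N\<^sup>2 * (16 * exp 8 / ?n * (225 / 256) ^ s)"
    proof (rule mult_left_mono)
      have "(pinj_weight s)\<^sup>2 \<le> (exp 4 * (5 / 4) ^ s)\<^sup>2"
        using pinj_weight_le[of s] pinj_weight_pos[of s] by (intro power_mono) auto
      also have "\<dots> = exp 8 * (25 / 16) ^ s"
        by (simp add: power_mult_distrib exp_double[symmetric] power_mult[symmetric] mult.commute[of s 2]) (simp add: power_mult power2_eq_square)
      finally have w: "(pinj_weight s)\<^sup>2 \<le> exp 8 * (25 / 16) ^ s" .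
      have b: "real ?n / s * 2 ^ (s - 1) \<le> real (?n choose s)" by (rule binomial_lower[OF s])
      have "0 < real ?n / s * 2 ^ (s - 1)" using n s by simp
      then have "(pinj_weight s)\<^sup>2 / real (?n choose s) \<le> (exp 8 * (25 / 16) ^ s) / (real ?n / s * 2 ^ (s - 1))"
        using w b by (intro frac_le) auto
      also have "\<dots> = 2 * exp 8 / ?n * (real s * (25 / 32) ^ s)"
      proof -
        have "(2::real) ^ s = 2 * 2 ^ (s - 1)" using s by (metis Suc_diff_1 less_eq_Suc_le One_nat_def power_Suc)
        moreover have "(25 / 32 :: real) ^ s = (25 / 16) ^ s / 2 ^ s" by (simp add: power_divide[symmetric])
        ultimately show ?thesis using n s by (simp add: field_simps)
      qed
      also have "\<dots> \<le> 2 * exp 8 / ?n * (8 * (225 / 256) ^ s)"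
      proof (rule mult_left_mono)
        \<comment> \<open>A slightly larger base, still below 1, absorbs the factor \<open>s\<close>.\<close>
        have "1 + real s * (1/8) \<le> (1 + 1/8) ^ s" by (rule Bernoulli_inequality) simp
        then have "real s \<le> 8 * (9/8) ^ s" by simp
        then have "real s * (25 / 32) ^ s \<le> 8 * (9/8) ^ s * (25 / 32) ^ s" by (rule mult_right_mono) simp
        also have "\<dots> = 8 * (225 / 256) ^ s" by (simp add: mult.assoc power_mult_distrib[symmetric])
        finally show "real s * (25 / 32) ^ s \<le> 8 * (225 / 256) ^ s" .
      qed simp
      finally show "(pinj_weight s)\<^sup>2 / real (?n choose s) \<le> 16 * exp 8 / ?n * (225 / 256) ^ s" by simp
    qed simp
    finally show "(\<Sum>T | T \<in> ?I \<and> card T = s. (?N * h (card T))\<^sup>2) \<le> ?N\<^sup>2 * (16 * exp 8 / ?n * (225 / 256) ^ s)" .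
  qed
  also have "\<dots> = ?N\<^sup>2 * (16 * exp 8 / ?n * (\<Sum>s\<in>{1..?n div 2}. (225 / 256) ^ s))"
    by (simp add: sum_distrib_left)
  also have "\<dots> \<le> ?N\<^sup>2 * (16 * exp 8 / ?n * 9)"
  proof (intro mult_left_mono)
    have "(\<Sum>s\<in>{1..?n div 2}. (225 / 256 :: real) ^ s) \<le> (\<Sum>s<Suc (?n div 2). (225 / 256) ^ s)"
      by (rule sum_mono2) auto
    also have "\<dots> = (1 - (225 / 256) ^ Suc (?n div 2)) / (1 - 225 / 256)"
      by (subst sum_gp_strict) auto
    also have "\<dots> \<le> 1 / (1 - 225 / 256)" by (intro divide_right_mono) auto
    finally show "(\<Sum>s\<in>{1..?n div 2}. (225 / 256 :: real) ^ s) \<le> 9" by simp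
  qed auto
  finally show ?thesis by (simp add: mult.commute)
qed

section \<open>The proportion of admissible graphs\<close>

definition edge_rel :: "('v \<times> 'a \<times> 'v) set \<Rightarrow> 'a \<Rightarrow> ('v \<times> 'v) set" where
  "edge_rel E a = {(u, v). (u, a, v) \<in> E}"

definition graphs :: "'a set \<Rightarrow> 'v set \<Rightarrow> ('v \<times> 'a \<times> 'v) set set" where
  "graphs A V = {E. A_graph A (V, E)}"

lemma edge_rel_pinj: "E \<in> graphs A V \<Longrightarrow> edge_rel E a \<in> pinj V"
  unfolding graphs_def A_graph_def edge_rel_def pinj_def single_valued_def mem_Collect_eq prod.case converse_iff
  by (intro conjI allI impI) blast+

lemma graphs_eqI:
  assumes "E \<in> graphs A V" "E' \<in> graphs A V" "\<And>a. a \<in> A \<Longrightarrow> edge_rel E a = edge_rel E' a"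
  shows "E = E'"
proof -
  have "X \<subseteq> Y" if "X \<in> graphs A V" "\<And>a. a \<in> A \<Longrightarrow> edge_rel X a = edge_rel Y a" for X Y
  proof
    fix e assume e: "e \<in> X"
    obtain u a v where uav: "e = (u, a, v)" by (cases e)
    then have "a \<in> A" using e that(1) by (auto simp: graphs_def A_graph_def)
    from that(2)[OF this] e uav show "e \<in> Y" unfolding edge_rel_def by blast
  qed
  from this[OF assms(1,3)] this[OF assms(2) assms(3)[symmetric]] show ?thesis by blast
qed

lemma card_graphs:
  assumes "finite A" "finite V"
  shows "card (graphs A V) = card (pinj V) ^ card A"
proof -
  have "bij_betw (\<lambda>E. restrict (edge_rel E) A) (graphs A V) (PiE A (\<lambda>_. pinj V))"
  proof (rule bij_betw_byWitness[where f' = "\<lambda>F. {(u, a, v). a \<in> A \<and> (u, v) \<in> F a}"])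
    show "\<forall>E\<in>graphs A V. {(u, a, v). a \<in> A \<and> (u, v) \<in> restrict (edge_rel E) A a} = E"
      by (auto simp: graphs_def A_graph_def edge_rel_def)
    show "\<forall>F\<in>PiE A (\<lambda>_. pinj V). restrict (edge_rel {(u, a, v). a \<in> A \<and> (u, v) \<in> F a}) A = F"
      by (auto simp: edge_rel_def fun_eq_iff PiE_def extensional_def)
    show "(\<lambda>E. restrict (edge_rel E) A) ` graphs A V \<subseteq> PiE A (\<lambda>_. pinj V)"
      using edge_rel_pinj by auto
    show "(\<lambda>F. {(u, a, v). a \<in> A \<and> (u, v) \<in> F a}) ` PiE A (\<lambda>_. pinj V) \<subseteq> graphs A V"
    proof (rule image_subsetI)
      fix F assume "F \<in> PiE A (\<lambda>_. pinj V)"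
      then have F: "F a \<in> pinj V" if "a \<in> A" for a using that by auto
      have 1: "u \<in> V \<and> v \<in> V" if "a \<in> A" "(u, v) \<in> F a" for a u v using F[OF that(1)] that(2) by (auto simp: pinj_def)
      have 2: "v = v'" if "a \<in> A" "(u, v) \<in> F a" "(u, v') \<in> F a" for a u v v'
        using F[OF that(1)] that(2,3) unfolding pinj_def single_valued_def by blast
      have 3: "u = u'" if "a \<in> A" "(u, v) \<in> F a" "(u', v) \<in> F a" for a u v u'
        using F[OF that(1)] that(2,3) unfolding pinj_def single_valued_def by blast
      show "{(u, a, v). a \<in> A \<and> (u, v) \<in> F a} \<in> graphs A V"
        unfolding graphs_def A_graph_def using assms(2) 1 2 3 by auto
    qed
  qed
  then have "card (graphs A V) = card (PiE A (\<lambda>_. pinj V))" by (rule bij_betw_same_card)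
  also have "\<dots> = card (pinj V) ^ card A" using assms(1) by (simp add: card_PiE)
  finally show ?thesis .
qed

lemma finite_graphs: "finite A \<Longrightarrow> finite V \<Longrightarrow> finite (graphs A V)"
  by (rule finite_subset[of _ "Pow (V \<times> A \<times> V)"]) (auto simp: graphs_def A_graph_def)

text \<open>
  The other letters are free, so that a property of the injections of two letters is no more
  frequent among all graphs than among pairs of injections.
\<close>

lemma card_graphs_pair:
  assumes "finite A" "finite V" "a1 \<in> A" "a2 \<in> A" "a1 \<noteq> a2" "B \<subseteq> pinj V \<times> pinj V"
  shows "card {E \<in> graphs A V. (edge_rel E a1, edge_rel E a2) \<in> B} \<le> card B * card (pinj V) ^ (card A - 2)"
proof -
  let ?A = "A - {a1, a2}"
  let ?f = "\<lambda>E. ((edge_rel E a1, edge_rel E a2), restrict (edge_rel E) ?A)"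
  have finB: "finite B" by (rule finite_subset[OF assms(6)]) (simp add: finite_pinj assms(2))
  have "card {E \<in> graphs A V. (edge_rel E a1, edge_rel E a2) \<in> B} \<le> card (B \<times> PiE ?A (\<lambda>_. pinj V))"
  proof (rule card_inj_on_le)
    show "inj_on ?f {E \<in> graphs A V. (edge_rel E a1, edge_rel E a2) \<in> B}"
    proof (rule inj_onI)
      fix E E' assume E: "E \<in> {E \<in> graphs A V. (edge_rel E a1, edge_rel E a2) \<in> B}"
        "E' \<in> {E \<in> graphs A V. (edge_rel E a1, edge_rel E a2) \<in> B}" "?f E = ?f E'"
      show "E = E'"
      proof (rule graphs_eqI[of _ A V])
        fix a assume "a \<in> A"
        show "edge_rel E a = edge_rel E' a"
        proof (cases "a \<in> {a1, a2}")
          case False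
          with \<open>a \<in> A\<close> have "restrict (edge_rel E) ?A a = edge_rel E a" "restrict (edge_rel E') ?A a = edge_rel E' a" by auto
          with E(3) show ?thesis by (metis prod.inject)
        qed (use E(3) in auto)
      qed (use E in auto)
    qed
    show "?f ` {E \<in> graphs A V. (edge_rel E a1, edge_rel E a2) \<in> B} \<subseteq> B \<times> PiE ?A (\<lambda>_. pinj V)"
    proof (rule image_subsetI)
      fix E assume E: "E \<in> {E \<in> graphs A V. (edge_rel E a1, edge_rel E a2) \<in> B}"
      then have "restrict (edge_rel E) ?A \<in> PiE ?A (\<lambda>_. pinj V)"
        by (intro restrict_PiE_iff[THEN iffD2] ballI edge_rel_pinj) auto
      with E show "?f E \<in> B \<times> PiE ?A (\<lambda>_. pinj V)" by blast
    qed
    show "finite (B \<times> PiE ?A (\<lambda>_. pinj V))"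
      using assms finB by (intro finite_cartesian_product finite_PiE) (auto intro: finite_pinj)
  qed
  also have "card ?A = card A - 2" using assms by (subst card_Diff_subset) auto
  then have "card (B \<times> PiE ?A (\<lambda>_. pinj V)) = card B * card (pinj V) ^ (card A - 2)"
    using assms(1) by (simp add: card_cartesian_product card_PiE)
  finally show ?thesis .
qed

lemma two_hops_not_leaf:
  fixes \<Gamma> :: "('v, 'a) graph"
  assumes "finite (snd \<Gamma>)" "hop \<Gamma> w y x" "hop \<Gamma> w y' x'" "y \<noteq> y'"
  shows "\<not> is_leaf \<Gamma> w"
proof -
  obtain V E where \<Gamma>: "\<Gamma> = (V, E)" by force
  have fin: "finite E" using assms(1) by (simp add: \<Gamma>)
  let ?O = "{e \<in> E. fst e = w}" and ?I = "{e \<in> E. snd (snd e) = w}"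
  have fO: "finite ?O" "finite ?I" using fin by auto
  define half where "half y x = (if snd y then Inl (w, fst y, x) else Inr (x, fst y, w))" for y :: "'a \<times> bool" and x :: 'v
  have "half y x \<in> ?O <+> ?I" "half y' x' \<in> ?O <+> ?I"
    using assms(2,3) by (auto simp: half_def hop_def \<Gamma>)
  moreover have "half y x \<noteq> half y' x'" using assms(4) by (cases y; cases y') (auto simp: half_def)
  ultimately have sub: "{half y x, half y' x'} \<subseteq> ?O <+> ?I" and two: "card {half y x, half y' x'} = 2" by auto
  have "card {half y x, half y' x'} \<le> card (?O <+> ?I)"
    by (rule card_mono[OF finite_Plus[OF fO] sub])
  then have "2 \<le> card ?O + card ?I" unfolding two card_Plus[OF fO] .
  then show ?thesis unfolding is_leaf_def \<Gamma> by simp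
qed

text \<open>
  Either a connected component or its complement has at most half of the vertices.
\<close>

lemma disconnected_split:
  assumes "finite V" "E \<in> graphs A V" "\<not> connected_graph (V, E)"
  shows "\<exists>T. T \<subseteq> V \<and> T \<noteq> {} \<and> 2 * card T \<le> card V \<and> (\<forall>a. edge_rel E a \<in> splitting V T)"
proof -
  have AG: "A_graph A (V, E)" using assms(2) by (simp add: graphs_def)
  from assms(3) path_connected_graph[of "(V, E)"] obtain u v where
    uv: "u \<in> V" "v \<in> V" "\<nexists>w. labels_path (V, E) u w v" by auto
  define X where "X = {x \<in> V. \<exists>w. labels_path (V, E) u w x}"
  have "u \<in> X" using uv(1) unfolding X_def by (auto intro!: exI[of _ "[]"])
  have "v \<notin> X" using uv by (auto simp: X_def)
  have ext: "hop (V, E) x y z \<Longrightarrow> x \<in> X \<Longrightarrow> z \<in> X" for x y z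
  proof -
    assume h: "hop (V, E) x y z" and "x \<in> X"
    then obtain w where "labels_path (V, E) u w x" by (auto simp: X_def)
    with h have "labels_path (V, E) u (w @ [y]) z" by (auto simp: labels_path_append)
    with hop_vertices[OF AG h] show "z \<in> X" unfolding X_def by auto
  qed
  have edge: "x \<in> X \<longleftrightarrow> z \<in> X" if "(x, a, z) \<in> E" for x a z
    using ext[of x "(a, True)" z] ext[of z "(a, False)" x] that by (auto simp: hop_def)
  have EV: "(x, a, z) \<in> E \<Longrightarrow> x \<in> V \<and> z \<in> V" for x a z using AG by (auto simp: A_graph_def)
  have split: "edge_rel E a \<in> splitting V T" if "T = X \<or> T = V - X" for a T
    using edge_rel_pinj[OF assms(2), of a] that edge EV by (auto simp: splitting_def edge_rel_def)
  have "X \<subseteq> V" by (auto simp: X_def)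
  then have "card X + card (V - X) = card V"
    using assms(1) by (metis card_mono card_Diff_subset finite_subset le_add_diff_inverse)
  then have "2 * card X \<le> card V \<or> 2 * card (V - X) \<le> card V" by linarith
  then show ?thesis
  proof
    assume "2 * card X \<le> card V"
    then show ?thesis using split \<open>u \<in> X\<close> \<open>X \<subseteq> V\<close> by (intro exI[of _ X]) auto
  next
    assume "2 * card (V - X) \<le> card V"
    then show ?thesis using split \<open>v \<notin> X\<close> uv(2) by (intro exI[of _ "V - X"]) auto
  qed
qed

lemma good_pair_admissible:
  assumes "finite V" "E \<in> graphs A V" "a1 \<in> A" "a2 \<in> A" "a1 \<noteq> a2" "v \<in> V" and finA: "finite A"
    and leaf: "(edge_rel E a1, edge_rel E a2) \<notin> leaf_pairs V"
    and split: "(edge_rel E a1, edge_rel E a2) \<notin> split_pairs V"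
  shows "admissible A (V, E) v"
proof -
  have AG: "A_graph A (V, E)" using assms(2) by (simp add: graphs_def)
  have conn: "connected_graph (V, E)"
    using disconnected_split[OF assms(1,2)] split unfolding split_pairs_def by auto
  have P: "edge_rel E a1 \<in> pinj V" "edge_rel E a2 \<in> pinj V" using edge_rel_pinj[OF assms(2)] by auto
  have finE: "finite (snd (V, E))"
    using AG by (auto simp: A_graph_def intro: finite_subset[OF _ finite_SigmaI[OF assms(1) finite_SigmaI[OF finA assms(1)]]])
  have "\<not> is_leaf (V, E) w" if "w \<in> V" for w
  proof -
    have out: "w \<in> Domain (edge_rel E a) \<Longrightarrow> \<exists>x. hop (V, E) w (a, True) x" for a
      by (auto simp: edge_rel_def hop_def)
    have "in": "w \<in> Range (edge_rel E a) \<Longrightarrow> \<exists>x. hop (V, E) w (a, False) x" for a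
      by (auto simp: edge_rel_def hop_def)
    have two: "\<not> is_leaf (V, E) w" if "\<exists>x. hop (V, E) w y x" "\<exists>x. hop (V, E) w y' x" "y \<noteq> y'" for y y'
      using two_hops_not_leaf[OF finE] that by blast
    from leaf P that have
      "\<not> (w \<notin> Domain (edge_rel E a1) \<and> w \<notin> Range (edge_rel E a1) \<and> (w \<notin> Domain (edge_rel E a2) \<or> w \<notin> Range (edge_rel E a2)))"
      "\<not> ((w \<notin> Domain (edge_rel E a1) \<or> w \<notin> Range (edge_rel E a1)) \<and> w \<notin> Domain (edge_rel E a2) \<and> w \<notin> Range (edge_rel E a2))"
      unfolding leaf_pairs_def isolating_def missing_def by blast+
    then consider "w \<in> Domain (edge_rel E a1)" "w \<in> Range (edge_rel E a1)"
      | "w \<in> Domain (edge_rel E a2)" "w \<in> Range (edge_rel E a2)"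
      | b b' where "\<exists>x. hop (V, E) w (a1, b) x" "\<exists>x. hop (V, E) w (a2, b') x"
      using out "in" by metis
    then show ?thesis
    proof cases
      case 1
      with two[OF out "in"] show ?thesis by auto
    next
      case 2
      with two[OF out "in"] show ?thesis by auto
    next
      case 3
      with two assms(5) show ?thesis by auto
    qed
  qed
  then show ?thesis using AG conn assms(6) by (auto simp: admissible_def trim_def)
qed

text \<open>
  For large \<open>n\<close> the two bounds for the bad pairs add up to less than \<open>1 /
  2\<close>; finitely many \<open>n\<close> remain, for which some admissible graph exists.
\<close>

lemma admissible_fraction:
  assumes "finite A" "card A \<ge> 2"
  shows "\<exists>\<delta>>0. \<forall>n\<ge>1. \<delta> * real (card (graphs A {1..int n})) \<le> real (card (labelled A n))"
proof -
  obtain a1 where a1: "a1 \<in> A" using assms by fastforce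
  have "A \<noteq> {a1}" using assms(2) by auto
  with a1 obtain a2 where a2: "a2 \<in> A" "a1 \<noteq> a2" by blast
  let ?V = "\<lambda>n. {1..int n}" and ?r = "card A"
  let ?N = "\<lambda>n. real (card (pinj (?V n)))"
  let ?\<epsilon> = "\<lambda>n::nat. 4 / sqrt (real n) + 144 * exp 8 / real n"
  have big: "(1 - ?\<epsilon> n) * real (card (graphs A (?V n))) \<le> real (card (labelled A n))" if n: "n \<ge> 1" for n
  proof -
    let ?G = "graphs A (?V n)" and ?B = "leaf_pairs (?V n) \<union> split_pairs (?V n)"
    let ?bad = "{E \<in> ?G. (edge_rel E a1, edge_rel E a2) \<in> ?B}"
    have finG: "finite ?G" using assms by (intro finite_graphs) auto
    have V: "finite (?V n)" "?V n \<noteq> {}" "card (?V n) = n" using n by auto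
    have sub: "?B \<subseteq> pinj (?V n) \<times> pinj (?V n)"
      by (auto simp: leaf_pairs_def split_pairs_def isolating_def missing_def splitting_def)
    have "?G - ?bad \<subseteq> labelled A n"
      unfolding labelled_def using good_pair_admissible[OF V(1) _ a1 a2 _ assms(1), of _ 1] n by auto
    then have "card (?G - ?bad) \<le> card (labelled A n)" by (intro card_mono finite_labelled assms)
    moreover have "card (?G - ?bad) = card ?G - card ?bad" using finG by (intro card_Diff_subset) auto
    ultimately have "real (card ?G) - real (card ?bad) \<le> real (card (labelled A n))" by linarith
    moreover have "real (card ?bad) \<le> ?\<epsilon> n * real (card ?G)"
    proof -
      have "card ?bad \<le> card ?B * card (pinj (?V n)) ^ (?r - 2)"
        by (rule card_graphs_pair[OF assms(1) V(1) a1 a2 sub])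
      from of_nat_mono[OF this, where 'a = real]
      have "real (card ?bad) \<le> real (card ?B) * ?N n ^ (?r - 2)" unfolding of_nat_mult of_nat_power .
      also have "\<dots> \<le> (?\<epsilon> n * (?N n)\<^sup>2) * ?N n ^ (?r - 2)"
      proof (rule mult_right_mono)
        have "real (card ?B) \<le> real (card (leaf_pairs (?V n))) + real (card (split_pairs (?V n)))"
          using of_nat_mono[OF card_Un_le[of "leaf_pairs (?V n)" "split_pairs (?V n)"], where 'a = real]
          unfolding of_nat_add .
        also have "\<dots> \<le> ?\<epsilon> n * (?N n)\<^sup>2"
          using card_leaf_pairs[OF V(1,2)] card_split_pairs[OF V(1,2)] unfolding V(3) by (simp add: distrib_right)
        finally show "real (card ?B) \<le> ?\<epsilon> n * (?N n)\<^sup>2" .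
      qed simp
      also have "\<dots> = ?\<epsilon> n * ?N n ^ ?r"
      proof -
        have "?r = 2 + (?r - 2)" using assms(2) by simp
        then have "?N n ^ ?r = (?N n)\<^sup>2 * ?N n ^ (?r - 2)" by (metis power_add)
        then show ?thesis by (simp only: mult.assoc)
      qed
      also have "?N n ^ ?r = real (card ?G)" by (simp add: card_graphs[OF assms(1) V(1)])
      finally show ?thesis .
    qed
    ultimately show ?thesis by (simp add: left_diff_distrib)
  qed
  have "?\<epsilon> \<longlonglongrightarrow> 0" by real_asymp
  then have "eventually (\<lambda>n. ?\<epsilon> n < 1 / 2) sequentially" by (rule order_tendstoD) simp
  then obtain n0 where n0: "\<And>n. n \<ge> n0 \<Longrightarrow> ?\<epsilon> n < 1 / 2" by (auto simp: eventually_sequentially)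
  define \<delta> where "\<delta> = Min (insert (1 / 2) ((\<lambda>n. 1 / (1 + real (card (graphs A (?V n))))) ` {..n0}))"
  have "\<delta> > 0" unfolding \<delta>_def by (subst Min_gr_iff) (auto intro: add_pos_nonneg)
  moreover have "\<delta> * real (card (graphs A (?V n))) \<le> real (card (labelled A n))" if n: "n \<ge> 1" for n
  proof (cases "n \<ge> n0")
    case True
    have "\<delta> \<le> 1 / 2" unfolding \<delta>_def by (rule Min_le) auto
    then have "\<delta> \<le> 1 - ?\<epsilon> n" using n0[OF True] by simp
    then have "\<delta> * real (card (graphs A (?V n))) \<le> (1 - ?\<epsilon> n) * real (card (graphs A (?V n)))"
      by (rule mult_right_mono) simp
    with big[OF n] show ?thesis by simp
  next
    case False
    then have "\<delta> \<le> 1 / (1 + real (card (graphs A (?V n))))" unfolding \<delta>_def by (intro Min_le) auto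
    then have "\<delta> * real (card (graphs A (?V n))) \<le> 1 / (1 + real (card (graphs A (?V n)))) * real (card (graphs A (?V n)))"
      by (rule mult_right_mono) simp
    also have "\<dots> \<le> 1" by (simp add: field_simps)
    also have "1 \<le> real (card (labelled A n))"
      using labelled_nonempty[OF a1 n] finite_labelled[OF assms(1)] by (simp add: Suc_le_eq card_gt_0_iff)
    finally show ?thesis .
  qed
  ultimately show ?thesis by blast
qed

section \<open>Expected cost and outcome of programs\<close>

text \<open>
  Expected cost of \<open>t\<close> steps, plus the expectation of \<open>f\<close> at the end
  for the runs that have halted by then. With \<open>f = 0\<close> this gives the expected cost;
  with zero costs and an indicator it gives the halting probabilities.
\<close>

primrec cost_upto :: "cost_model \<Rightarrow> nat \<Rightarrow> 'a com \<Rightarrow> ('a mem \<Rightarrow> ennreal) \<Rightarrow> 'a mem \<Rightarrow> ennreal" where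
  "cost_upto C 0 c f m = (if c = Skip then f m else 0)"
| "cost_upto C (Suc t) c f m =
     ennreal (step_cost C c m) + (\<integral>\<^sup>+ (c', m'). cost_upto C t c' f m' \<partial>measure_pmf (step c m))"

definition zero_cost :: cost_model where
  "zero_cost =
     \<lparr>c_read = (\<lambda>_ _. 0), c_write = (\<lambda>_ _. 0), c_compare = (\<lambda>_ _. 0), c_add = (\<lambda>_ _. 0),
      c_sub = (\<lambda>_ _. 0), c_mul = (\<lambda>_ _. 0), c_draw = (\<lambda>_. 0)\<rparr>"

lemma run_first: "run c m (Suc t) = bind_pmf (step c m) (\<lambda>(c', m'). run c' m' t)"
proof (induction t)
  case 0
  then show ?case by (simp add: bind_return_pmf bind_return_pmf' case_prod_unfold)
next
  case (Suc t)
  have "run c m (Suc (Suc t)) = bind_pmf (run c m (Suc t)) (\<lambda>(c', m'). step c' m')" by simp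
  also have "\<dots> = bind_pmf (step c m) (\<lambda>(c', m'). run c' m' (Suc t))"
    unfolding Suc by (simp add: bind_assoc_pmf case_prod_unfold)
  finally show ?case .
qed

lemma cost_upto_Skip [simp]: "cost_upto C t Skip f m = f m"
  by (induction t) auto

lemma exp_cost_zero [simp]: "exp_cost zero_cost m e = 0"
  by (induction e) (auto simp: zero_cost_def)

lemma test_cost_zero [simp]: "test_cost zero_cost m b = 0"
proof -
  have "c_compare zero_cost x y = 0" for x y by (simp add: zero_cost_def)
  then show ?thesis by (cases b) auto
qed

lemma step_cost_zero [simp]: "step_cost zero_cost c m = 0"
proof -
  have "c_write zero_cost x y = 0" "c_draw zero_cost x = 0" for x y by (simp_all add: zero_cost_def)
  then show ?thesis by (induction c) auto
qed

lemma cost_upto_run: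
  "cost_upto C t c f m = (\<Sum>i<t. \<integral>\<^sup>+ (c', m'). ennreal (step_cost C c' m') \<partial>measure_pmf (run c m i))
     + (\<integral>\<^sup>+ (c', m'). (if c' = Skip then f m' else 0) \<partial>measure_pmf (run c m t))"
proof (induction t arbitrary: c m)
  case 0
  then show ?case by simp
next
  case (Suc t)
  have "cost_upto C (Suc t) c f m = ennreal (step_cost C c m) +
     (\<integral>\<^sup>+ x. (\<Sum>i<t. \<integral>\<^sup>+ (c', m'). ennreal (step_cost C c' m') \<partial>measure_pmf (run (fst x) (snd x) i)) \<partial>measure_pmf (step c m)) +
     (\<integral>\<^sup>+ x. (\<integral>\<^sup>+ (c', m'). (if c' = Skip then f m' else 0) \<partial>measure_pmf (run (fst x) (snd x) t)) \<partial>measure_pmf (step c m))"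
    by (simp add: Suc case_prod_unfold nn_integral_add add.assoc)
  also have "(\<integral>\<^sup>+ x. (\<Sum>i<t. \<integral>\<^sup>+ (c', m'). ennreal (step_cost C c' m') \<partial>measure_pmf (run (fst x) (snd x) i)) \<partial>measure_pmf (step c m))
     = (\<Sum>i<t. \<integral>\<^sup>+ (c', m'). ennreal (step_cost C c' m') \<partial>measure_pmf (run c m (Suc i)))"
    by (subst nn_integral_sum) (auto simp: run_first case_prod_unfold simp del: run.simps)
  also have "(\<integral>\<^sup>+ x. (\<integral>\<^sup>+ (c', m'). (if c' = Skip then f m' else 0) \<partial>measure_pmf (run (fst x) (snd x) t)) \<partial>measure_pmf (step c m))
    = (\<integral>\<^sup>+ (c', m'). (if c' = Skip then f m' else 0) \<partial>measure_pmf (run c m (Suc t)))"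
    by (simp add: run_first case_prod_unfold del: run.simps)
  finally show ?case
    by (simp add: sum.lessThan_Suc_shift del: sum.lessThan_Suc run.simps(2))
qed

lemma cost_upto_mono: "(\<And>m. f m \<le> g m) \<Longrightarrow> cost_upto C t c f m \<le> cost_upto C t c g m"
  by (induction t arbitrary: c m) (auto intro!: nn_integral_mono add_left_mono simp: case_prod_unfold)

lemma cost_upto_Suc: "cost_upto C t c f m \<le> cost_upto C (Suc t) c f m"
proof (induction t arbitrary: c m)
  case 0
  then show ?case by auto
next
  case (Suc t)
  show ?case
    by (subst (1 2) cost_upto.simps(2)) (auto intro!: add_left_mono nn_integral_mono Suc simp del: cost_upto.simps simp: case_prod_unfold)
qed

lemma cost_upto_mono_time: "s \<le> t \<Longrightarrow> cost_upto C s c f m \<le> cost_upto C t c f m"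
  by (rule lift_Suc_mono_le[where f = "\<lambda>t. cost_upto C t c f m"]) (auto intro: cost_upto_Suc simp del: cost_upto.simps)

text \<open>
  The two parts of a sequence share the time \<open>t\<close> in a random way; granting
  \<open>t\<close> steps to each of them is an upper bound, and granting the sum of two fixed
  times to the whole is a lower bound.
\<close>

lemma cost_upto_Seq_le: "cost_upto C t (Seq c d) f m \<le> cost_upto C t c (cost_upto C t d f) m"
proof (induction t arbitrary: c m)
  case 0
  then show ?case by auto
next
  case (Suc t)
  show ?case
  proof (cases "c = Skip")
    case True
    then show ?thesis using cost_upto_Suc[of C t d f m] by simp
  next
    case False
    have "(\<integral>\<^sup>+ x. cost_upto C t (Seq (fst x) d) f (snd x) \<partial>measure_pmf (step c m))
      \<le> (\<integral>\<^sup>+ x. cost_upto C t (fst x) (cost_upto C t d f) (snd x) \<partial>measure_pmf (step c m))"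
      by (intro nn_integral_mono) (simp add: Suc)
    also have "\<dots> \<le> (\<integral>\<^sup>+ x. cost_upto C t (fst x) (cost_upto C (Suc t) d f) (snd x) \<partial>measure_pmf (step c m))"
      by (intro nn_integral_mono cost_upto_mono cost_upto_Suc)
    finally show ?thesis using False
      by (simp add: case_prod_unfold cost_upto.simps(2)[of C t "Seq c d"] cost_upto.simps(2)[of C t c] add_left_mono del: cost_upto.simps(2))
  qed
qed

lemma cost_upto_Seq_ge: "cost_upto C s c (cost_upto C t d f) m \<le> cost_upto C (Suc (s + t)) (Seq c d) f m"
proof (induction s arbitrary: c m)
  case 0
  then show ?case by auto
next
  case (Suc s)
  show ?case
  proof (cases "c = Skip")
    case True
    then show ?thesis using cost_upto_mono_time[of t "Suc s + t" C d f m]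
      by (simp del: cost_upto.simps(2) add: cost_upto.simps(2)[of C "Suc (s + t)"])
  next
    case False
    have "(\<integral>\<^sup>+ x. cost_upto C s (fst x) (cost_upto C t d f) (snd x) \<partial>measure_pmf (step c m))
      \<le> (\<integral>\<^sup>+ x. cost_upto C (Suc (s + t)) (Seq (fst x) d) f (snd x) \<partial>measure_pmf (step c m))"
      by (intro nn_integral_mono Suc)
    with False show ?thesis
      by (simp del: cost_upto.simps(2) add: cost_upto.simps(2)[of C "Suc (s + t)"] cost_upto.simps(2)[of C s c] case_prod_unfold add_left_mono)
  qed
qed

lemma cost_upto_While:
  "cost_upto C (Suc t) (While b c) f m =
     ennreal (test_cost C m b) + (if eval_test m b then cost_upto C t (Seq c (While b c)) f m else f m)"
  by simp

lemma expected_cost_le: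
  assumes "\<And>t. cost_upto C t c (\<lambda>_. 0) m \<le> X"
  shows "expected_cost C c m \<le> X"
proof -
  have "(\<Sum>i<t. \<integral>\<^sup>+ (c', m'). ennreal (step_cost C c' m') \<partial>measure_pmf (run c m i)) \<le> X" for t
    using assms[of t] unfolding cost_upto_run by (simp add: case_prod_unfold)
  then show ?thesis unfolding expected_cost_def
    by (intro suminf_le_const) auto
qed

lemma halt_measure:
  "ennreal (measure_pmf.prob (run c m t) {(c', m'). c' = Skip \<and> P m'}) = cost_upto zero_cost t c (indicator {m. P m}) m"
proof -
  have "cost_upto zero_cost t c (indicator {m. P m}) m =
     (\<integral>\<^sup>+ x. indicator {(c', m'). c' = Skip \<and> P m'} x \<partial>measure_pmf (run c m t))"
    unfolding cost_upto_run by (auto intro!: nn_integral_cong simp: indicator_def case_prod_unfold of_bool_def)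
  then show ?thesis by (simp add: measure_pmf.emeasure_eq_measure)
qed

lemma bdd_halt: "bdd_above (range (\<lambda>t. measure_pmf.prob (run c m t) {(c', m'). c' = Skip \<and> P m'}))"
  by (intro bdd_aboveI[where M = 1]) auto

lemma halt_prob_ge:
  assumes "ennreal x \<le> cost_upto zero_cost t c (indicator {m. P m}) m"
  shows "x \<le> halt_prob c m P"
proof -
  have "x \<le> measure_pmf.prob (run c m t) {(c', m'). c' = Skip \<and> P m'}"
    using assms unfolding halt_measure[symmetric] by (simp add: ennreal_le_iff)
  also have "\<dots> \<le> halt_prob c m P"
    unfolding halt_prob_def by (rule cSUP_upper[OF UNIV_I bdd_halt])
  finally show ?thesis .
qed

text \<open>
  Together with lower bounds for \<open>P\<close> and for its negation that add up to 1 this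
  yields the exact probability of \<open>P\<close>.
\<close>

lemma halt_prob_compl: "halt_prob c m P + halt_prob c m (\<lambda>m. \<not> P m) \<le> 1"
proof -
  let ?p = "\<lambda>P t. measure_pmf.prob (run c m t) {(c', m'). c' = Skip \<and> P m'}"
  have inc: "incseq (?p P)" for P
  proof (rule incseq_SucI)
    fix t
    show "?p P t \<le> ?p P (Suc t)"
      using cost_upto_Suc[of zero_cost t c "indicator {m. P m}" m]
      unfolding halt_measure[symmetric] by (simp add: ennreal_le_iff del: run.simps)
  qed
  have lim: "?p P \<longlonglongrightarrow> halt_prob c m P" for P
    unfolding halt_prob_def by (rule LIMSEQ_incseq_SUP[OF bdd_halt inc])
  have "(\<lambda>t. ?p P t + ?p (\<lambda>m. \<not> P m) t) \<longlonglongrightarrow> halt_prob c m P + halt_prob c m (\<lambda>m. \<not> P m)"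
    by (intro tendsto_add lim)
  moreover have "?p P t + ?p (\<lambda>m. \<not> P m) t \<le> 1" for t
    by (subst measure_pmf.finite_measure_Union[symmetric]) auto
  ultimately show ?thesis by (intro LIMSEQ_le_const2) auto
qed

definition fits :: "int \<Rightarrow> int \<Rightarrow> bool" where "fits M x \<longleftrightarrow> \<bar>x\<bar> \<le> M"

primrec exp_ok :: "int \<Rightarrow> 'a mem \<Rightarrow> 'a exp \<Rightarrow> bool" where
  "exp_ok M m (Lit k) \<longleftrightarrow> fits M k"
| "exp_ok M m (Cell x i) \<longleftrightarrow> exp_ok M m i \<and> fits M (content m (x, eval_exp m i))"
| "exp_ok M m (Add e f) \<longleftrightarrow> exp_ok M m e \<and> exp_ok M m f \<and> fits M (eval_exp m e + eval_exp m f)"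
| "exp_ok M m (Sub e f) \<longleftrightarrow> exp_ok M m e \<and> exp_ok M m f \<and> fits M (eval_exp m e - eval_exp m f)"
| "exp_ok M m (Mul e f) \<longleftrightarrow> exp_ok M m e \<and> exp_ok M m f \<and> fits M (eval_exp m e * eval_exp m f)"

primrec test_ok :: "int \<Rightarrow> 'a mem \<Rightarrow> 'a test \<Rightarrow> bool" where
  "test_ok M m (Lt e f) \<longleftrightarrow> exp_ok M m e \<and> exp_ok M m f"
| "test_ok M m (Eq e f) \<longleftrightarrow> exp_ok M m e \<and> exp_ok M m f"

primrec ops :: "'a exp \<Rightarrow> nat" where
  "ops (Lit k) = 0"
| "ops (Cell x i) = ops i + 1"
| "ops (Add e f) = ops e + ops f + 1"
| "ops (Sub e f) = ops e + ops f + 1"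
| "ops (Mul e f) = ops e + ops f + 1"

primrec test_ops :: "'a test \<Rightarrow> nat" where
  "test_ops (Lt e f) = ops e + ops f + 1"
| "test_ops (Eq e f) = ops e + ops f + 1"

text \<open>
  For code without loops this bounds the number of operations; a loop is bounded by a multiple
  of it, the multiplier being a bound for the number of iterations.
\<close>

primrec sz :: "'a com \<Rightarrow> nat" where
  "sz Skip = 0"
| "sz (Assign x i e) = ops i + ops e + 1"
| "sz (Draw x i e) = ops i + ops e + 2"
| "sz (Seq c d) = sz c + sz d"
| "sz (If b c d) = test_ops b + sz c + sz d"
| "sz (While b c) = test_ops b + sz c"

text \<open>
  One bound for all operations on integers of size at most \<open>M\<close>. It decouples the
  analysis of programs, which only counts operations, from the cost models.
\<close>

definition ops_bounded :: "cost_model \<Rightarrow> int \<Rightarrow> real \<Rightarrow> bool" where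
  "ops_bounded C M w \<longleftrightarrow> 0 \<le> w \<and>
     (\<forall>x y. fits M x \<longrightarrow> fits M y \<longrightarrow> c_read C x y \<le> w \<and> c_write C x y \<le> w \<and> c_compare C x y \<le> w \<and>
        c_add C x y \<le> w \<and> c_sub C x y \<le> w \<and> c_mul C x y \<le> w) \<and>
     (\<forall>N. 1 \<le> N \<and> N \<le> M \<longrightarrow> c_draw C N \<le> w)"

lemma exp_ok_fits: "exp_ok M m e \<Longrightarrow> fits M (eval_exp m e)"
  by (induction e) auto

lemma ops_boundedD:
  assumes "ops_bounded C M w" "fits M x" "fits M y"
  shows "c_read C x y \<le> w" "c_write C x y \<le> w" "c_compare C x y \<le> w"
    "c_add C x y \<le> w" "c_sub C x y \<le> w" "c_mul C x y \<le> w"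
  using assms by (auto simp: ops_bounded_def)

lemma exp_cost_le:
  assumes "ops_bounded C M w" "exp_ok M m e"
  shows "exp_cost C m e \<le> real (ops e) * w"
  using assms(2)
proof (induction e)
  case (Cell x i)
  then have "c_read C (eval_exp m i) (content m (x, eval_exp m i)) \<le> w"
    using exp_ok_fits by (auto intro!: ops_boundedD[OF assms(1)])
  with Cell show ?case by (simp add: algebra_simps)
next
  case (Add e f)
  then have "c_add C (eval_exp m e) (eval_exp m f) \<le> w"
    using exp_ok_fits by (auto intro!: ops_boundedD[OF assms(1)])
  with Add show ?case by (simp add: algebra_simps)
next
  case (Sub e f)
  then have "c_sub C (eval_exp m e) (eval_exp m f) \<le> w"
    using exp_ok_fits by (auto intro!: ops_boundedD[OF assms(1)])
  with Sub show ?case by (simp add: algebra_simps)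
next
  case (Mul e f)
  then have "c_mul C (eval_exp m e) (eval_exp m f) \<le> w"
    using exp_ok_fits by (auto intro!: ops_boundedD[OF assms(1)])
  with Mul show ?case by (simp add: algebra_simps)
qed auto

lemma test_cost_le:
  assumes "ops_bounded C M w" "test_ok M m b"
  shows "test_cost C m b \<le> real (test_ops b) * w"
proof -
  have *: "c_compare C (eval_exp m e) (eval_exp m f) \<le> w" if "exp_ok M m e" "exp_ok M m f" for e f
    using that exp_ok_fits by (auto intro!: ops_boundedD[OF assms(1)])
  show ?thesis using assms(2)
  proof (cases b)
    case (Lt e f)
    with assms *[of e f] exp_cost_le[OF assms(1), of m e] exp_cost_le[OF assms(1), of m f]
    show ?thesis by (auto simp: algebra_simps)
  next
    case (Eq e f)
    with assms *[of e f] exp_cost_le[OF assms(1), of m e] exp_cost_le[OF assms(1), of m f]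
    show ?thesis by (auto simp: algebra_simps)
  qed
qed

text \<open>
  All runs of \<open>c\<close> from \<open>m\<close> halt, after at most \<open>k\<close>
  operations on integers of size at most \<open>M\<close>, and \<open>p\<close> is the
  distribution of the final memory. The number of runs is finite, which is why a common time
  bound for all of them exists (\<open>sure_lower\<close>).
\<close>

inductive sure :: "int \<Rightarrow> 'a com \<Rightarrow> 'a mem \<Rightarrow> nat \<Rightarrow> 'a mem pmf \<Rightarrow> bool" for M where
  Skip: "sure M Skip m 0 (return_pmf m)"
| Assign: "exp_ok M m i \<Longrightarrow> exp_ok M m e \<Longrightarrow>
    sure M (Assign x i e) m (sz (Assign x i e)) (return_pmf (m((x, eval_exp m i) \<mapsto> eval_exp m e)))"
| Draw: "exp_ok M m i \<Longrightarrow> exp_ok M m e \<Longrightarrow> 1 \<le> eval_exp m e \<Longrightarrow>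
    sure M (Draw x i e) m (sz (Draw x i e))
      (map_pmf (\<lambda>v. m((x, eval_exp m i) \<mapsto> v)) (random_int (eval_exp m e)))"
| Seq: "sure M c m k1 p \<Longrightarrow> (\<And>m'. m' \<in> set_pmf p \<Longrightarrow> sure M d m' k2 (q m')) \<Longrightarrow>
    sure M (Seq c d) m (k1 + k2) (bind_pmf p q)"
| If: "test_ok M m b \<Longrightarrow> sure M (if eval_test m b then c else d) m k p \<Longrightarrow>
    sure M (If b c d) m (test_ops b + k) p"
| WhileFalse: "test_ok M m b \<Longrightarrow> \<not> eval_test m b \<Longrightarrow> sure M (While b c) m (test_ops b) (return_pmf m)"
| WhileTrue: "test_ok M m b \<Longrightarrow> eval_test m b \<Longrightarrow> sure M (Seq c (While b c)) m k p \<Longrightarrow>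
    sure M (While b c) m (test_ops b + k) p"
| more: "sure M c m k p \<Longrightarrow> k \<le> k' \<Longrightarrow> sure M c m k' p"

lemma set_random_int: "1 \<le> N \<Longrightarrow> set_pmf (random_int N) = {0..<N}"
  by (simp add: random_int_def)

lemma sure_finite: "sure M c m k p \<Longrightarrow> finite (set_pmf p)"
  by (induction rule: sure.induct) (auto simp: set_random_int)

lemma sure_upper:
  assumes "sure M c m k p" "ops_bounded C M w"
  shows "cost_upto C t c f m \<le> ennreal (k * w) + (\<integral>\<^sup>+ m'. f m' \<partial>measure_pmf p)"
  using assms(1)
proof (induction arbitrary: t f rule: sure.induct)
  case (Skip m)
  then show ?case by simp
next
  case (Assign m i e x)
  have "c_write C (eval_exp m i) (eval_exp m e) \<le> w"
    using Assign exp_ok_fits by (auto intro!: ops_boundedD[OF assms(2)])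
  with Assign exp_cost_le[OF assms(2), of m i] exp_cost_le[OF assms(2), of m e]
  have "step_cost C (Assign x i e) m \<le> sz (Assign x i e) * w" by (simp add: algebra_simps)
  then show ?case
    by (cases t) (auto simp del: sz.simps step_cost.simps intro!: add_right_mono ennreal_leI)
next
  case (Draw m i e x)
  have "c_write C (eval_exp m i) (eval_exp m e) \<le> w" "c_draw C (eval_exp m e) \<le> w"
    using ops_boundedD[OF assms(2)] exp_ok_fits[OF Draw(1)] exp_ok_fits[OF Draw(2)] assms(2) Draw(3)
    by (auto simp: ops_bounded_def fits_def)
  with Draw exp_cost_le[OF assms(2), of m i] exp_cost_le[OF assms(2), of m e]
  have "step_cost C (Draw x i e) m \<le> sz (Draw x i e) * w" by (simp add: algebra_simps)
  then show ?case
    by (cases t) (auto simp del: sz.simps step_cost.simps intro!: add_right_mono ennreal_leI)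
next
  case (Seq c m k1 p d k2 q)
  have w: "0 \<le> w" using assms(2) by (auto simp: ops_bounded_def)
  have "cost_upto C t (Seq c d) f m \<le> cost_upto C t c (cost_upto C t d f) m" by (rule cost_upto_Seq_le)
  also have "\<dots> \<le> ennreal (k1 * w) + (\<integral>\<^sup>+ m'. cost_upto C t d f m' \<partial>measure_pmf p)" by (rule Seq.IH)
  also have "\<dots> \<le> ennreal (k1 * w) + (\<integral>\<^sup>+ m'. (ennreal (k2 * w) + (\<integral>\<^sup>+ m''. f m'' \<partial>measure_pmf (q m'))) \<partial>measure_pmf p)"
    by (intro add_left_mono nn_integral_mono_AE) (auto simp: AE_measure_pmf_iff intro!: Seq.IH)
  also have "\<dots> = ennreal (k1 * w) + ennreal (k2 * w) + (\<integral>\<^sup>+ m''. f m'' \<partial>measure_pmf (bind_pmf p q))"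
    by (simp add: nn_integral_add add.assoc)
  also have "ennreal (k1 * w) + ennreal (k2 * w) = ennreal ((k1 + k2) * w)"
    using w by (simp add: ennreal_plus[symmetric] algebra_simps del: ennreal_plus)
  finally show ?case by simp
next
  case (If m b c d k p)
  have w: "0 \<le> w" using assms(2) by (auto simp: ops_bounded_def)
  show ?case
  proof (cases t)
    case (Suc s)
    have "cost_upto C t (If b c d) f m = ennreal (test_cost C m b) + cost_upto C s (if eval_test m b then c else d) f m"
      using Suc by simp
    also have "\<dots> \<le> ennreal (test_ops b * w) + (ennreal (k * w) + (\<integral>\<^sup>+ m'. f m' \<partial>measure_pmf p))"
      by (intro add_mono ennreal_leI test_cost_le[OF assms(2)] If)
    also have "\<dots> = ennreal ((test_ops b + k) * w) + (\<integral>\<^sup>+ m'. f m' \<partial>measure_pmf p)"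
      using w by (simp add: algebra_simps)
    finally show ?thesis by simp
  qed simp
next
  case (WhileFalse m b c)
  show ?case
    using WhileFalse test_cost_le[OF assms(2), of m b]
    by (cases t) (auto intro!: add_right_mono ennreal_leI)
next
  case (WhileTrue m b c k p)
  have w: "0 \<le> w" using assms(2) by (auto simp: ops_bounded_def)
  show ?case
  proof (cases t)
    case (Suc s)
    have "cost_upto C t (While b c) f m = ennreal (test_cost C m b) + cost_upto C s (Seq c (While b c)) f m"
      using Suc WhileTrue(2) by simp
    also have "\<dots> \<le> ennreal (test_ops b * w) + (ennreal (k * w) + (\<integral>\<^sup>+ m'. f m' \<partial>measure_pmf p))"
      by (intro add_mono ennreal_leI test_cost_le[OF assms(2)] WhileTrue)
    also have "\<dots> = ennreal ((test_ops b + k) * w) + (\<integral>\<^sup>+ m'. f m' \<partial>measure_pmf p)"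
      using w by (simp add: algebra_simps)
    finally show ?thesis by simp
  qed simp
next
  case (more c m k p k')
  have w: "0 \<le> w" using assms(2) by (auto simp: ops_bounded_def)
  have "ennreal (k * w) \<le> ennreal (k' * w)" using more(2) w by (intro ennreal_leI mult_right_mono) auto
  with more.IH show ?case by (meson add_right_mono order_trans)
qed

lemma sure_lower:
  assumes "sure M c m k p"
  shows "\<exists>t. \<forall>f. (\<integral>\<^sup>+ m'. f m' \<partial>measure_pmf p) \<le> cost_upto C t c f m"
  using assms
proof (induction rule: sure.induct)
  case (Skip m)
  then show ?case by simp
next
  case (Assign m i e x)
  then show ?case by (intro exI[of _ "Suc 0"]) auto
next
  case (Draw m i e x)
  then show ?case by (intro exI[of _ "Suc 0"]) auto
next
  case (Seq c m k1 p d k2 q)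
  then obtain s where s: "\<And>f. (\<integral>\<^sup>+ m'. f m' \<partial>measure_pmf p) \<le> cost_upto C s c f m" by auto
  from Seq.IH have "\<forall>m'\<in>set_pmf p. \<exists>t. \<forall>f. (\<integral>\<^sup>+ m''. f m'' \<partial>measure_pmf (q m')) \<le> cost_upto C t d f m'" by blast
  then obtain T where T: "\<And>m' f. m' \<in> set_pmf p \<Longrightarrow> (\<integral>\<^sup>+ m''. f m'' \<partial>measure_pmf (q m')) \<le> cost_upto C (T m') d f m'"
    by metis
  have fin: "finite (set_pmf p)" using Seq sure_finite by blast
  define t where "t = Max (T ` set_pmf p)"
  have "(\<integral>\<^sup>+ m'. f m' \<partial>measure_pmf (bind_pmf p q)) \<le> cost_upto C (Suc (s + t)) (Seq c d) f m" for f
  proof -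
    have "(\<integral>\<^sup>+ m'. f m' \<partial>measure_pmf (bind_pmf p q)) = (\<integral>\<^sup>+ m'. (\<integral>\<^sup>+ m''. f m'' \<partial>measure_pmf (q m')) \<partial>measure_pmf p)"
      by simp
    also have "\<dots> \<le> (\<integral>\<^sup>+ m'. cost_upto C t d f m' \<partial>measure_pmf p)"
      using fin by (intro nn_integral_mono_AE) (auto simp: AE_measure_pmf_iff t_def intro!: order_trans[OF T] cost_upto_mono_time)
    also have "\<dots> \<le> cost_upto C s c (cost_upto C t d f) m" by (rule s)
    also have "\<dots> \<le> cost_upto C (Suc (s + t)) (Seq c d) f m" by (rule cost_upto_Seq_ge)
    finally show ?thesis .
  qed
  then show ?case by blast
next
  case (If m b c d k p)
  then obtain t where t: "\<And>f. (\<integral>\<^sup>+ m'. f m' \<partial>measure_pmf p) \<le> cost_upto C t (if eval_test m b then c else d) f m" by blast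
  have "(\<integral>\<^sup>+ m'. f m' \<partial>measure_pmf p) \<le> cost_upto C (Suc t) (If b c d) f m" for f
    using t[of f] by (auto intro: order_trans add_increasing)
  then show ?case by blast
next
  case (WhileFalse m b c)
  then show ?case by (intro exI[of _ "Suc 0"]) auto
next
  case (WhileTrue m b c k p)
  then obtain t where t: "\<And>f. (\<integral>\<^sup>+ m'. f m' \<partial>measure_pmf p) \<le> cost_upto C t (Seq c (While b c)) f m" by blast
  have "(\<integral>\<^sup>+ m'. f m' \<partial>measure_pmf p) \<le> cost_upto C (Suc t) (While b c) f m" for f
    using t[of f] WhileTrue(2) by (auto intro: order_trans add_increasing)
  then show ?case by blast
qed

text \<open>
  The final distribution is determined by the program, so that triples proved for different
  expectations speak of the same distribution.
\<close>

lemma sure_unique: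
  assumes "sure M c m k p" "sure M' c m k' p'"
  shows "p = p'"
proof -
  have le: "pmf p x \<le> pmf p' x" if s: "sure M c m k p" "sure M' c m k' p'" for p p' x M k M' k'
  proof -
    obtain t where t: "\<And>f. (\<integral>\<^sup>+ m'. f m' \<partial>measure_pmf p) \<le> cost_upto zero_cost t c f m"
      using sure_lower[OF s(1), where C = zero_cost] by blast
    have "(\<integral>\<^sup>+ m'. indicator {x} m' \<partial>measure_pmf p) \<le> ennreal (real k' * 0) + (\<integral>\<^sup>+ m'. indicator {x} m' \<partial>measure_pmf p')"
      by (rule order_trans[OF t sure_upper[OF s(2)]]) (auto simp: ops_bounded_def zero_cost_def)
    then show ?thesis by (simp add: emeasure_pmf_single)
  qed
  show ?thesis by (intro pmf_eqI antisym le[OF assms] le[OF assms(2,1)])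
qed

section \<open>Triples for randomized programs\<close>

text \<open>
  The triple combines a postcondition \<open>Q\<close> for all runs with a lower bound
  \<open>q\<close> for the expectation of \<open>\<phi>\<close> in the final memory. The cost is
  stated as a multiple of \<open>sz c\<close>, so that it need not be tracked: the rules below
  keep the multiplier \<open>f\<close>, which only loops require to be large.
\<close>

definition ptriple :: "int \<Rightarrow> nat \<Rightarrow> 'a com \<Rightarrow> 'a mem \<Rightarrow> ('a mem \<Rightarrow> bool) \<Rightarrow> ('a mem \<Rightarrow> real) \<Rightarrow> real \<Rightarrow> bool" where
  "ptriple M f c m Q \<phi> q \<longleftrightarrow>
     (\<exists>p. sure M c m (f * sz c) p \<and> (\<forall>m'\<in>set_pmf p. Q m') \<and> q \<le> measure_pmf.expectation p \<phi>)"

lemma expectation_mono_finite: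
  assumes "finite (set_pmf p)" "\<And>m. m \<in> set_pmf p \<Longrightarrow> \<phi> m \<le> (\<psi> m :: real)"
  shows "measure_pmf.expectation p \<phi> \<le> measure_pmf.expectation p \<psi>"
  using assms by (intro integral_mono_AE integrable_measure_pmf_finite) (auto simp: AE_measure_pmf_iff)

lemma ptriple_mono:
  assumes "ptriple M f c m Q \<phi> q" "f \<le> f'" "\<And>m'. Q m' \<Longrightarrow> Q' m'" "\<And>m'. Q m' \<Longrightarrow> \<phi> m' \<le> \<phi>' m'" "q' \<le> q"
  shows "ptriple M f' c m Q' \<phi>' q'"
proof -
  from assms(1) obtain p where p: "sure M c m (f * sz c) p" "\<forall>m'\<in>set_pmf p. Q m'" "q \<le> measure_pmf.expectation p \<phi>"
    unfolding ptriple_def by blast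
  have "measure_pmf.expectation p \<phi> \<le> measure_pmf.expectation p \<phi>'"
    using p(2) assms(4) sure_finite[OF p(1)] by (intro expectation_mono_finite) auto
  moreover have "sure M c m (f' * sz c) p" by (rule sure.more[OF p(1)]) (use assms(2) in auto)
  ultimately show ?thesis unfolding ptriple_def using p assms(3,5) by (intro exI[of _ p]) auto
qed

text \<open>
  A postcondition alone bounds any expectation. In this way code without random choices enters
  into triples with an expectation.
\<close>

lemma ptriple_const:
  assumes "ptriple M f c m Q \<phi> q" "\<And>m'. Q m' \<Longrightarrow> x \<le> \<psi> m'"
  shows "ptriple M f c m Q \<psi> x"
proof -
  from assms(1) obtain p where p: "sure M c m (f * sz c) p" "\<forall>m'\<in>set_pmf p. Q m'"
    unfolding ptriple_def by blast
  have "measure_pmf.expectation p (\<lambda>_. x) \<le> measure_pmf.expectation p \<psi>"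
    using p(2) assms(2) sure_finite[OF p(1)] by (intro expectation_mono_finite) auto
  with p show ?thesis unfolding ptriple_def by auto
qed

lemma expectation_bind_finite:
  assumes "finite (set_pmf p)" "\<And>x. x \<in> set_pmf p \<Longrightarrow> finite (set_pmf (q x))"
  shows "measure_pmf.expectation (bind_pmf p q) (\<phi> :: _ \<Rightarrow> real) =
    measure_pmf.expectation p (\<lambda>x. measure_pmf.expectation (q x) \<phi>)"
proof -
  have "measure_pmf.expectation (bind_pmf p q) \<phi> = (\<Sum>a\<in>set_pmf p. pmf p a *\<^sub>R measure_pmf.expectation (q a) \<phi>)"
    by (rule pmf_expectation_bind) (use assms in auto)
  also have "\<dots> = measure_pmf.expectation p (\<lambda>x. measure_pmf.expectation (q x) \<phi>)"
    by (subst integral_measure_pmf[OF assms(1)]) auto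
  finally show ?thesis .
qed

lemma ptriple_Skip: "Q m \<Longrightarrow> q \<le> \<phi> m \<Longrightarrow> ptriple M f Skip m Q \<phi> q"
  unfolding ptriple_def by (intro exI[of _ "return_pmf m"]) (auto intro: sure.intros)

lemma ptriple_Seq:
  assumes "ptriple M f c m Q1 \<phi>1 q" "\<And>m'. Q1 m' \<Longrightarrow> ptriple M f d m' Q \<phi> (\<phi>1 m')"
  shows "ptriple M f (Seq c d) m Q \<phi> q"
proof -
  from assms(1) obtain p where p: "sure M c m (f * sz c) p" "\<forall>m'\<in>set_pmf p. Q1 m'" "q \<le> measure_pmf.expectation p \<phi>1"
    unfolding ptriple_def by blast
  with assms(2) have "\<forall>m'\<in>set_pmf p. \<exists>p'. sure M d m' (f * sz d) p' \<and> (\<forall>m'\<in>set_pmf p'. Q m') \<and> \<phi>1 m' \<le> measure_pmf.expectation p' \<phi>"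
    unfolding ptriple_def by blast
  then obtain r where r: "\<And>m'. m' \<in> set_pmf p \<Longrightarrow> sure M d m' (f * sz d) (r m')"
    "\<And>m' m''. m' \<in> set_pmf p \<Longrightarrow> m'' \<in> set_pmf (r m') \<Longrightarrow> Q m''"
    "\<And>m'. m' \<in> set_pmf p \<Longrightarrow> \<phi>1 m' \<le> measure_pmf.expectation (r m') \<phi>"
    by metis
  have "sure M (Seq c d) m (f * sz c + f * sz d) (bind_pmf p r)"
    by (intro sure.Seq p r)
  moreover have "q \<le> measure_pmf.expectation (bind_pmf p r) \<phi>"
    by (subst expectation_bind_finite)
       (auto intro!: order_trans[OF p(3)] expectation_mono_finite sure_finite[OF p(1)] r sure_finite[OF r(1)])
  ultimately show ?thesis unfolding ptriple_def using r by (intro exI[of _ "bind_pmf p r"]) (auto simp: algebra_simps)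
qed

text \<open>
  Weakest preconditions of loop-free code; loops are excluded by the value \<open>False\<close>.
\<close>

primrec safe :: "int \<Rightarrow> 'a com \<Rightarrow> ('a mem \<Rightarrow> bool) \<Rightarrow> 'a mem \<Rightarrow> bool" where
  "safe M Skip Q m \<longleftrightarrow> Q m"
| "safe M (Assign x i e) Q m \<longleftrightarrow> exp_ok M m i \<and> exp_ok M m e \<and> Q (m((x, eval_exp m i) \<mapsto> eval_exp m e))"
| "safe M (Draw x i e) Q m \<longleftrightarrow> exp_ok M m i \<and> exp_ok M m e \<and> 1 \<le> eval_exp m e \<and>
     (\<forall>v. 0 \<le> v \<longrightarrow> v < eval_exp m e \<longrightarrow> Q (m((x, eval_exp m i) \<mapsto> v)))"
| "safe M (Seq c d) Q m \<longleftrightarrow> safe M c (safe M d Q) m"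
| "safe M (If b c d) Q m \<longleftrightarrow> test_ok M m b \<and> (if eval_test m b then safe M c Q m else safe M d Q m)"
| "safe M (While b c) Q m \<longleftrightarrow> False"

text \<open>
  The expectation of \<open>\<phi>\<close> after loop-free code; the value 0 for loops is
  arbitrary, in view of \<open>safe\<close>.
\<close>

primrec expect :: "'a com \<Rightarrow> ('a mem \<Rightarrow> real) \<Rightarrow> 'a mem \<Rightarrow> real" where
  "expect Skip \<phi> m = \<phi> m"
| "expect (Assign x i e) \<phi> m = \<phi> (m((x, eval_exp m i) \<mapsto> eval_exp m e))"
| "expect (Draw x i e) \<phi> m = (\<Sum>v\<in>{0..<eval_exp m e}. \<phi> (m((x, eval_exp m i) \<mapsto> v))) / real_of_int (eval_exp m e)"
| "expect (Seq c d) \<phi> m = expect c (expect d \<phi>) m"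
| "expect (If b c d) \<phi> m = (if eval_test m b then expect c \<phi> m else expect d \<phi> m)"
| "expect (While b c) \<phi> m = 0"

lemma safe_ptriple: "1 \<le> f \<Longrightarrow> safe M c Q m \<Longrightarrow> ptriple M f c m Q \<phi> (expect c \<phi> m)"
proof (induction c arbitrary: Q \<phi> m)
  case (Assign x i e)
  then have "sure M (Assign x i e) m (f * sz (Assign x i e)) (return_pmf (m((x, eval_exp m i) \<mapsto> eval_exp m e)))"
    by (intro sure.more[OF sure.Assign]) (simp_all del: sz.simps)
  with Assign show ?case unfolding ptriple_def by (intro exI[of _ "return_pmf (m((x, eval_exp m i) \<mapsto> eval_exp m e))"]) auto
next
  case (Draw x i e)
  let ?p = "map_pmf (\<lambda>v. m((x, eval_exp m i) \<mapsto> v)) (random_int (eval_exp m e))"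
  from Draw have "sure M (Draw x i e) m (f * sz (Draw x i e)) ?p"
    by (intro sure.more[OF sure.Draw]) (simp_all del: sz.simps)
  moreover have "measure_pmf.expectation ?p \<phi> = expect (Draw x i e) \<phi> m"
    using Draw by (simp add: random_int_def integral_pmf_of_set)
  moreover have "\<forall>m'\<in>set_pmf ?p. Q m'" using Draw by (auto simp: set_random_int)
  ultimately show ?case unfolding ptriple_def by (metis order_refl)
next
  case (Seq c d)
  then show ?case by (auto intro!: ptriple_Seq)
next
  case (If b c d)
  let ?c = "if eval_test m b then c else d"
  have "ptriple M f ?c m Q \<phi> (expect ?c \<phi> m)" using If by auto
  then obtain p where p: "sure M ?c m (f * sz ?c) p" "\<forall>m'\<in>set_pmf p. Q m'" "expect ?c \<phi> m \<le> measure_pmf.expectation p \<phi>"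
    unfolding ptriple_def by blast
  have "sure M (If b c d) m (f * sz (If b c d)) p"
  proof (rule sure.more[OF sure.If[OF _ p(1)]])
    have "test_ops b \<le> f * test_ops b" "sz ?c \<le> sz c + sz d" using If.prems by auto
    then show "test_ops b + f * sz ?c \<le> f * sz (If b c d)"
      using mult_le_mono2[of "sz ?c" "sz c + sz d" f] unfolding sz.simps distrib_left by linarith
  qed (use If in auto)
  with p show ?case unfolding ptriple_def by (intro exI[of _ p]) auto
qed (auto intro: ptriple_Skip)

lemma safe_ptriple': "1 \<le> f \<Longrightarrow> safe M c Q m \<Longrightarrow> q \<le> expect c \<phi> m \<Longrightarrow> ptriple M f c m Q \<phi> q"
  by (rule ptriple_mono[OF safe_ptriple]) auto

text \<open>
  The function \<open>\<psi>\<close> is a submartingale along the iterations, and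
  \<open>\<mu>\<close> bounds their number.
\<close>

lemma ptriple_While:
  fixes I :: "'a mem \<Rightarrow> bool" and \<psi> :: "'a mem \<Rightarrow> real" and \<mu> :: "'a mem \<Rightarrow> nat"
  assumes ok: "\<And>m. I m \<Longrightarrow> test_ok M m b"
    and body: "\<And>m. I m \<Longrightarrow> eval_test m b \<Longrightarrow> ptriple M 1 c m (\<lambda>m'. I m' \<and> \<mu> m' < \<mu> m) \<psi> (\<psi> m)"
    and m: "I m" "\<mu> m < f"
  shows "ptriple M f (While b c) m (\<lambda>m'. I m' \<and> \<not> eval_test m' b) \<psi> (\<psi> m)"
proof -
  have "I m \<Longrightarrow> ptriple M (Suc (\<mu> m)) (While b c) m (\<lambda>m'. I m' \<and> \<not> eval_test m' b) \<psi> (\<psi> m)" for m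
  proof (induction "\<mu> m" arbitrary: m rule: less_induct)
    case less
    show ?case
    proof (cases "eval_test m b")
      case True
      from body[OF less.prems True] obtain p where p: "sure M c m (sz c) p"
        "\<forall>m'\<in>set_pmf p. I m' \<and> \<mu> m' < \<mu> m" "\<psi> m \<le> measure_pmf.expectation p \<psi>"
        unfolding ptriple_def by auto
      have "\<exists>r. sure M (While b c) m' (\<mu> m * sz (While b c)) r \<and> (\<forall>m''\<in>set_pmf r. I m'' \<and> \<not> eval_test m'' b) \<and>
          \<psi> m' \<le> measure_pmf.expectation r \<psi>" if "m' \<in> set_pmf p" for m'
      proof -
        have "ptriple M (\<mu> m) (While b c) m' (\<lambda>m'. I m' \<and> \<not> eval_test m' b) \<psi> (\<psi> m')"
          by (rule ptriple_mono[OF less.hyps[of m']]) (use p(2) that in auto)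
        then show ?thesis unfolding ptriple_def .
      qed
      then obtain r where r: "\<And>m'. m' \<in> set_pmf p \<Longrightarrow> sure M (While b c) m' (\<mu> m * sz (While b c)) (r m')"
        "\<And>m' m''. m' \<in> set_pmf p \<Longrightarrow> m'' \<in> set_pmf (r m') \<Longrightarrow> I m'' \<and> \<not> eval_test m'' b"
        "\<And>m'. m' \<in> set_pmf p \<Longrightarrow> \<psi> m' \<le> measure_pmf.expectation (r m') \<psi>"
        by metis
      have "sure M (Seq c (While b c)) m (sz c + \<mu> m * sz (While b c)) (bind_pmf p r)"
        by (intro sure.Seq p r)
      from sure.WhileTrue[OF ok[OF less.prems] True this]
      have "sure M (While b c) m (Suc (\<mu> m) * sz (While b c)) (bind_pmf p r)"
        by (rule sure.more) auto
      moreover have "\<psi> m \<le> measure_pmf.expectation (bind_pmf p r) \<psi>"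
        by (subst expectation_bind_finite)
           (auto intro!: order_trans[OF p(3)] expectation_mono_finite sure_finite[OF p(1)] r sure_finite[OF r(1)])
      ultimately show ?thesis unfolding ptriple_def using r by (intro exI[of _ "bind_pmf p r"]) auto
    next
      case False
      have "sure M (While b c) m (Suc (\<mu> m) * sz (While b c)) (return_pmf m)"
        by (rule sure.more[OF sure.WhileFalse[OF ok[OF less.prems] False]]) auto
      then show ?thesis using False less.prems unfolding ptriple_def by (intro exI[of _ "return_pmf m"]) auto
    qed
  qed
  from ptriple_mono[OF this[OF m(1)]] m(2) show ?thesis by auto
qed

primrec writes :: "'a com \<Rightarrow> 'a name set" where
  "writes Skip = {}"
| "writes (Assign x i e) = {x}"
| "writes (Draw x i e) = {x}"
| "writes (Seq c d) = writes c \<union> writes d"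
| "writes (If b c d) = writes c \<union> writes d"
| "writes (While b c) = writes c"

lemma content_upd [simp]: "content (m(c \<mapsto> v)) c' = (if c' = c then v else content m c')"
  by (simp add: content_def)

lemma sure_frame:
  assumes "sure M c m k p" "m' \<in> set_pmf p" "x \<notin> writes c"
  shows "content m' (x, i) = content m (x, i)"
  using assms
proof (induction arbitrary: m' rule: sure.induct)
  case (Seq c m k1 p d k2 q)
  then show ?case by fastforce
next
  case (If m b c d k p)
  then show ?case by (simp split: if_splits)
qed auto

lemma ptriple_frame:
  assumes "ptriple M f c m Q \<phi> q"
  shows "ptriple M f c m (\<lambda>m'. Q m' \<and> (\<forall>x i. x \<notin> writes c \<longrightarrow> content m' (x, i) = content m (x, i))) \<phi> q"
proof -
  from assms obtain p where p: "sure M c m (f * sz c) p" "\<forall>m'\<in>set_pmf p. Q m'" "q \<le> measure_pmf.expectation p \<phi>"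
    unfolding ptriple_def by blast
  then show ?thesis unfolding ptriple_def using sure_frame[OF p(1)] by blast
qed

abbreviation triple where "triple M f c m Q \<equiv> ptriple M f c m Q (\<lambda>_. 0) 0"

lemma triple_Seq: "triple M f c m Q1 \<Longrightarrow> (\<And>m'. Q1 m' \<Longrightarrow> triple M f d m' Q) \<Longrightarrow> triple M f (Seq c d) m Q"
  by (rule ptriple_Seq)

lemma triple_mono: "triple M f c m Q \<Longrightarrow> (\<And>m'. Q m' \<Longrightarrow> Q' m') \<Longrightarrow> triple M f c m Q'"
  by (erule ptriple_mono) auto

lemma safe_triple: "1 \<le> f \<Longrightarrow> safe M c Q m \<Longrightarrow> triple M f c m Q"
  by (rule ptriple_const[OF safe_ptriple]) auto

lemma triple_While:
  assumes "\<And>m. I m \<Longrightarrow> test_ok M m b"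
    and "\<And>m. I m \<Longrightarrow> eval_test m b \<Longrightarrow> triple M 1 c m (\<lambda>m'. I m' \<and> \<mu> m' < \<mu> m)"
    and "I m" "\<mu> m < f"
  shows "triple M f (While b c) m (\<lambda>m'. I m' \<and> \<not> eval_test m' b)"
  by (rule ptriple_While) (use assms in auto)

section \<open>Drawing a partial injection\<close>

text \<open>
  The integers \<open>(n! / (n - k)!)\<^sup>2\<close>, that is, \<open>k!\<close> times the
  number of partial injections of rank \<open>k\<close>.
\<close>

primrec rank_weight :: "nat \<Rightarrow> nat \<Rightarrow> int" where
  "rank_weight n 0 = 1"
| "rank_weight n (Suc k) = (int n - int k) * ((int n - int k) * rank_weight n k)"

text \<open>
  Scaled like \<open>rank_weight\<close>: the quotient \<open>rank_weight n k / tail_weight n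
  k\<close> is the proportion of the rank \<open>k\<close> among the partial injections of rank
  at most \<open>k\<close>.
\<close>

primrec tail_weight :: "nat \<Rightarrow> nat \<Rightarrow> int" where
  "tail_weight n 0 = 1"
| "tail_weight n (Suc k) = rank_weight n (Suc k) + (int k + 1) * tail_weight n k"

lemma rank_weight_pos: "k \<le> n \<Longrightarrow> rank_weight n k > 0"
  by (induction k) auto

lemma tail_weight_ge: "k \<le> n \<Longrightarrow> rank_weight n k \<le> tail_weight n k"
proof (induction k)
  case (Suc k)
  then have "0 < tail_weight n k" using rank_weight_pos[of k n] by simp
  then show ?case by (simp del: rank_weight.simps)
qed simp

lemma tail_weight_pos: "k \<le> n \<Longrightarrow> tail_weight n k > 0"
  using rank_weight_pos[of k n] tail_weight_ge[of k n] by simp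

lemma rank_weight_le: "k \<le> n \<Longrightarrow> rank_weight n k \<le> (int n + 1) ^ (2 * k)"
proof (induction k)
  case (Suc k)
  have "rank_weight n (Suc k) \<le> (int n + 1) * ((int n + 1) * (int n + 1) ^ (2 * k))"
    unfolding rank_weight.simps
    using Suc rank_weight_pos[of k n] by (intro mult_mono) auto
  then show ?case by (simp add: power_add)
qed simp

lemma tail_weight_le: "k \<le> n \<Longrightarrow> tail_weight n k \<le> (int n + 1) ^ (2 * k + 1)"
proof (induction k)
  case (Suc k)
  have "(int k + 1) * tail_weight n k \<le> int n * (int n + 1) ^ (2 * k + 1)"
    using Suc tail_weight_pos[of k n] by (intro mult_mono) auto
  moreover have "rank_weight n (Suc k) \<le> (int n + 1) ^ (2 * k + 2)"
    using rank_weight_le[OF Suc.prems] by simp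
  moreover have "(int n + 1) ^ (2 * k + 2) + int n * (int n + 1) ^ (2 * k + 1) \<le> (int n + 1) ^ (2 * k + 3)"
  proof -
    have "(int n + 1) ^ (2 * k + 2) + int n * (int n + 1) ^ (2 * k + 1) = (int n + 1) ^ (2 * k + 1) * (2 * int n + 1)"
      by (simp add: algebra_simps)
    also have "\<dots> \<le> (int n + 1) ^ (2 * k + 1) * (int n + 1)\<^sup>2"
      by (intro mult_left_mono) (auto simp: power2_eq_square algebra_simps)
    also have "\<dots> = (int n + 1) ^ (2 * k + 3)" by (simp add: power_add[symmetric] power2_eq_square algebra_simps power3_eq_cube power_add)
    finally show ?thesis .
  qed
  ultimately show ?case by (simp add: eval_nat_numeral del: rank_weight.simps)
qed simp

lemma rank_weight_fact: "k \<le> n \<Longrightarrow> real_of_int (rank_weight n k) = (fact n / fact (n - k))\<^sup>2"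
proof (induction k)
  case (Suc k)
  then have "n - k = Suc (n - Suc k)" by simp
  then have "fact (n - k) = real (n - k) * (fact (n - Suc k) :: real)" by (metis fact_Suc of_nat_fact of_nat_mult)
  moreover have "real (n - k) > 0" using Suc.prems by simp
  ultimately have "fact n / fact (n - Suc k) = real (n - k) * (fact n / fact (n - k))" by simp
  moreover have "real_of_int (rank_weight n (Suc k)) = (real (n - k))\<^sup>2 * real_of_int (rank_weight n k)"
    using Suc.prems by (simp add: power2_eq_square of_nat_diff)
  moreover have "real_of_int (rank_weight n k) = (fact n / fact (n - k))\<^sup>2" using Suc by simp
  ultimately show ?case by (simp only: power_mult_distrib)
qed simp

lemma tail_weight_sum: "real_of_int (tail_weight n k) = (\<Sum>i\<le>k. real_of_int (rank_weight n i) * (fact k / fact i))"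
proof (induction k)
  case (Suc k)
  have "real_of_int (tail_weight n (Suc k)) = real_of_int (rank_weight n (Suc k)) + (real k + 1) * real_of_int (tail_weight n k)"
    by (simp del: rank_weight.simps)
  also have "(real k + 1) * real_of_int (tail_weight n k) = (\<Sum>i\<le>k. real_of_int (rank_weight n i) * (fact (Suc k) / fact i))"
    unfolding Suc sum_distrib_left by (intro sum.cong refl) (simp add: algebra_simps)
  finally show ?case by (simp del: rank_weight.simps fact_Suc)
qed simp

lemma tail_weight_card:
  assumes "finite S" "card S = n"
  shows "real_of_int (tail_weight n n) = fact n * real (card (pinj S))"
proof -
  have "real (card (pinj S)) = (\<Sum>k\<le>n. real (rank_count S k) * 1)"
    using sum_by_rank[OF assms(1), of "\<lambda>_. 1 :: real"] assms(2) by simp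
  then have "fact n * real (card (pinj S)) = (\<Sum>k\<le>n. fact n * real (rank_count S k))"
    by (simp add: sum_distrib_left)
  also have "\<dots> = (\<Sum>i\<le>n. real_of_int (rank_weight n i) * (fact n / fact i))"
  proof (intro sum.cong refl)
    fix k assume "k \<in> {..n}"
    then have k: "k \<le> n" by simp
    have f: "real (n choose k) = fact n / (fact k * fact (n - k))" by (rule binomial_fact[OF k])
    show "fact n * real (rank_count S k) = real_of_int (rank_weight n k) * (fact n / fact k)"
      by (simp add: rank_count[OF assms(1)] assms(2) rank_weight_fact[OF k] f power2_eq_square field_simps)
  qed
  also have "\<dots> = real_of_int (tail_weight n n)" by (rule tail_weight_sum[symmetric])
  finally show ?thesis ..
qed

abbreviation var :: "nat \<Rightarrow> 'a exp" where "var k \<equiv> Cell (Work k) (Lit 0)"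
abbreviation size_exp :: "'a exp" where "size_exp \<equiv> Cell Input (Lit 0)"
abbreviation set_var :: "nat \<Rightarrow> 'a exp \<Rightarrow> 'a com" where "set_var k e \<equiv> Assign (Work k) (Lit 0) e"
abbreviation incr :: "nat \<Rightarrow> 'a com" where "incr k \<equiv> set_var k (Add (var k) (Lit 1))"
abbreviation decr :: "nat \<Rightarrow> 'a com" where "decr k \<equiv> set_var k (Sub (var k) (Lit 1))"
abbreviation val :: "'a mem \<Rightarrow> nat \<Rightarrow> int" where "val m k \<equiv> content m (Work k, 0)"

text \<open>
  The scalar variables are the cells of index 0. While a partial injection is drawn, variable 2
  is first the table index, then the candidate for the rank, and then the number of images still
  to be assigned; 3 tells that the rank is accepted; 6 is the current vertex and 7 the size of
  the pool; 4, 8 and 9 receive the random integers. The arrays 11 and 12 contain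
  \<open>rank_weight\<close> and \<open>tail_weight\<close>, and the array 5 is the pool of
  unused images. Variable 10 tells that an attempt has succeeded.
\<close>

definition table_loop :: "'a com" where
  "table_loop = While (Lt (var 2) size_exp)
     (Seq (Assign (Work 11) (Add (var 2) (Lit 1))
            (Mul (Sub size_exp (var 2)) (Mul (Sub size_exp (var 2)) (Cell (Work 11) (var 2)))))
     (Seq (Assign (Work 12) (Add (var 2) (Lit 1))
            (Add (Cell (Work 11) (Add (var 2) (Lit 1))) (Mul (Add (var 2) (Lit 1)) (Cell (Work 12) (var 2)))))
       (incr 2)))"

definition rank_loop :: "'a com" where
  "rank_loop = While (Eq (var 3) (Lit 0))
     (Seq (Draw (Work 4) (Lit 0) (Cell (Work 12) (var 2)))
       (If (Lt (var 4) (Cell (Work 11) (var 2))) (set_var 3 (Lit 1)) (decr 2)))"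

definition pool_loop :: "'a com" where
  "pool_loop = While (Lt (var 6) size_exp)
     (Seq (Assign (Work 5) (var 6) (Add (var 6) (Lit 1))) (incr 6))"

definition edge_loop :: "'a \<Rightarrow> 'a com" where
  "edge_loop a = While (Lt (var 6) (Add size_exp (Lit 1)))
     (Seq (Draw (Work 8) (Lit 0) (Sub (Add size_exp (Lit 1)) (var 6)))
     (Seq (If (Lt (var 8) (var 2))
            (Seq (Draw (Work 9) (Lit 0) (var 7))
            (Seq (Assign (Edge a) (var 6) (Cell (Work 5) (var 9)))
            (Seq (decr 7)
            (Seq (Assign (Work 5) (var 9) (Cell (Work 5) (var 7)))
              (decr 2)))))
            (Assign (Edge a) (var 6) (Lit 0)))
       (incr 6)))"

definition sample :: "'a \<Rightarrow> 'a com" where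
  "sample a =
     Seq (set_var 2 (Lit 0)) (Seq (Assign (Work 12) (Lit 0) (Lit 1)) (Seq (Assign (Work 11) (Lit 0) (Lit 1))
    (Seq table_loop
    (Seq (set_var 3 (Lit 0)) (Seq rank_loop
    (Seq (set_var 6 (Lit 0)) (Seq pool_loop
    (Seq (set_var 7 size_exp) (Seq (set_var 6 (Lit 1)) (edge_loop a))))))))))"

text \<open>
  Only a lower bound is required of \<open>M\<close>, as the number of arrays, which is
  independent of \<open>n\<close>, has to stay below it as well.
\<close>

locale machine =
  fixes n :: nat and M :: int
  assumes n: "1 \<le> n" and M: "(int n + 1) ^ (4 * n + 4) \<le> M"
begin

lemma fits_small: "\<bar>x\<bar> \<le> int n + 10 \<Longrightarrow> fits M x"
proof -
  assume x: "\<bar>x\<bar> \<le> int n + 10"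
  have "(int n + 1) ^ 4 \<le> (int n + 1) ^ (4 * n + 4)" by (rule power_increasing) auto
  moreover have "(int n + 1) * 2 ^ 3 \<le> (int n + 1) * (int n + 1) ^ 3"
    using n by (intro mult_left_mono power_mono) auto
  moreover have "(int n + 1) * (int n + 1) ^ 3 = (int n + 1) ^ 4" by (simp add: eval_nat_numeral)
  ultimately have "(int n + 1) * 8 \<le> M" using M by simp
  moreover have "int n + 10 \<le> (int n + 1) * 8" using n by simp
  ultimately show ?thesis using x unfolding fits_def by (meson order_trans)
qed

lemma fits_power: "0 \<le> x \<Longrightarrow> x \<le> (int n + 1) ^ k \<Longrightarrow> k \<le> 4 * n + 4 \<Longrightarrow> fits M x"
  unfolding fits_def using power_increasing[of k "4 * n + 4" "int n + 1"] M by simp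

lemma fits_rank_weight: "k \<le> n \<Longrightarrow> fits M (rank_weight n k)"
  using rank_weight_pos[of k n] rank_weight_le[of k n] by (intro fits_power[of _ "2 * k"]) auto

lemma fits_tail_weight: "k \<le> n \<Longrightarrow> fits M (tail_weight n k)"
  using tail_weight_pos[of k n] tail_weight_le[of k n] by (intro fits_power[of _ "2 * k + 1"]) auto

definition tables :: "'a mem \<Rightarrow> int \<Rightarrow> bool" where
  "tables m k \<longleftrightarrow> content m (Input, 0) = int n \<and>
     (\<forall>i. 0 \<le> i \<longrightarrow> i \<le> k \<longrightarrow> content m (Work 11, i) = rank_weight n (nat i) \<and> content m (Work 12, i) = tail_weight n (nat i))"

lemma table_loop:
  assumes "tables m 0" "val m 2 = 0"
  shows "triple M (n + 2) table_loop m (\<lambda>m. tables m (int n) \<and> val m 2 = int n)"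
proof -
  let ?I = "\<lambda>m. 0 \<le> val m 2 \<and> val m 2 \<le> int n \<and> tables m (val m 2)"
  let ?b = "Lt (var 2) size_exp" and ?\<mu> = "\<lambda>m. nat (int n - val m 2)"
  have "triple M (n + 2) table_loop m (\<lambda>m'. ?I m' \<and> \<not> eval_test m' ?b)"
    unfolding table_loop_def
  proof (rule triple_While[where \<mu> = ?\<mu>])
    fix m :: "'a mem" assume I: "?I m"
    then have inp: "content m (Input, 0) = int n" by (simp add: tables_def)
    show "test_ok M m ?b" using I by (auto simp: inp intro!: fits_small)
    assume "eval_test m ?b"
    then obtain k where k: "val m 2 = int k" "k < n" using I by (metis eval_exp.simps eval_test.simps(1) inp of_nat_less_iff zero_le_imp_eq_int)
    have w: "content m (Work 11, int k) = rank_weight n k" "content m (Work 12, int k) = tail_weight n k"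
      using I k(1) by (auto simp: tables_def)
    have f1: "fits M ((int n - int k) * rank_weight n k)"
    proof (rule fits_power[of _ "2 * k + 1"])
      have "(int n - int k) * rank_weight n k \<le> (int n + 1) * (int n + 1) ^ (2 * k)"
        using k rank_weight_pos[of k n] rank_weight_le[of k n] by (intro mult_mono) auto
      then show "(int n - int k) * rank_weight n k \<le> (int n + 1) ^ (2 * k + 1)" by simp
    qed (use k rank_weight_pos[of k n] in auto)
    have f2: "fits M ((int k + 1) * tail_weight n k)"
    proof (rule fits_power[of _ "2 * k + 2"])
      have "(int k + 1) * tail_weight n k \<le> (int n + 1) * (int n + 1) ^ (2 * k + 1)"
        using k tail_weight_pos[of k n] tail_weight_le[of k n] by (intro mult_mono) auto
      then show "(int k + 1) * tail_weight n k \<le> (int n + 1) ^ (2 * k + 2)" by simp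
    qed (use k tail_weight_pos[of k n] in auto)
    have f3: "fits M (rank_weight n (Suc k))" "fits M (tail_weight n (Suc k))"
      using k by (auto intro: fits_rank_weight fits_tail_weight simp del: rank_weight.simps tail_weight.simps)
    have f4: "fits M (rank_weight n k)" "fits M (tail_weight n k)"
      using k by (auto intro: fits_rank_weight fits_tail_weight)
    have sm: "fits M 0" "fits M 1" "fits M (int k)" "fits M (int n)" "fits M (int k + 1)" "fits M (int n - int k)"
      using k by (auto intro!: fits_small)
    have tab: "content m (Work 11, i) = rank_weight n (nat i)" "content m (Work 12, i) = tail_weight n (nat i)" if "0 \<le> i" "i \<le> int k" for i
      using I k(1) that by (auto simp: tables_def)
    have nk: "nat (int k + 1) = Suc k" by simp
    show "triple M 1 (Seq (Assign (Work 11) (Add (var 2) (Lit 1))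
            (Mul (Sub size_exp (var 2)) (Mul (Sub size_exp (var 2)) (Cell (Work 11) (var 2)))))
     (Seq (Assign (Work 12) (Add (var 2) (Lit 1))
            (Add (Cell (Work 11) (Add (var 2) (Lit 1))) (Mul (Add (var 2) (Lit 1)) (Cell (Work 12) (var 2)))))
       (incr 2))) m (\<lambda>m'. ?I m' \<and> ?\<mu> m' < ?\<mu> m)"
    proof (rule safe_triple)
      let ?m = "m((Work 11, int k + 1) \<mapsto> rank_weight n (Suc k), (Work 12, int k + 1) \<mapsto> tail_weight n (Suc k), (Work 2, 0) \<mapsto> int k + 1)"
      have "?I ?m \<and> ?\<mu> ?m < ?\<mu> m"
        using k inp by (auto simp: tables_def tab nk le_less[of _ "int k + 1"] zless_add1_eq simp del: rank_weight.simps tail_weight.simps)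
      then show "safe M (Seq (Assign (Work 11) (Add (var 2) (Lit 1))
            (Mul (Sub size_exp (var 2)) (Mul (Sub size_exp (var 2)) (Cell (Work 11) (var 2)))))
     (Seq (Assign (Work 12) (Add (var 2) (Lit 1))
            (Add (Cell (Work 11) (Add (var 2) (Lit 1))) (Mul (Add (var 2) (Lit 1)) (Cell (Work 12) (var 2)))))
       (incr 2))) (\<lambda>m'. ?I m' \<and> ?\<mu> m' < ?\<mu> m) m"
        using f1 f2 f3 f4 sm by (simp add: k(1) inp w)
    qed simp
  qed (use assms n in auto)
  then show ?thesis by (rule triple_mono) (auto simp: tables_def)
qed

end

lemma expect_nonneg: "(\<And>m. 0 \<le> \<phi> m) \<Longrightarrow> 0 \<le> expect c \<phi> m"
proof (induction c arbitrary: \<phi> m)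
  case (Draw x i e)
  then show ?case
    by (cases "eval_exp m e \<le> 0") (auto intro!: sum_nonneg divide_nonneg_nonneg)
qed auto

text \<open>
  A lower bound that only accounts for a set \<open>X\<close> of favourable outcomes.
\<close>

lemma expect_Draw_ge:
  assumes "1 \<le> eval_exp m e" "X \<subseteq> {0..<eval_exp m e}" "\<And>m. 0 \<le> \<phi> m"
    and "\<And>v. v \<in> X \<Longrightarrow> q \<le> \<phi> (m((x, eval_exp m i) \<mapsto> v))"
  shows "real (card X) / real_of_int (eval_exp m e) * q \<le> expect (Draw x i e) \<phi> m"
proof -
  have "real (card X) * q \<le> (\<Sum>v\<in>X. \<phi> (m((x, eval_exp m i) \<mapsto> v)))"
    using assms(4) by (rule sum_bounded_below)
  also have "\<dots> \<le> (\<Sum>v\<in>{0..<eval_exp m e}. \<phi> (m((x, eval_exp m i) \<mapsto> v)))"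
    using assms(2,3) by (intro sum_mono2) auto
  finally show ?thesis using assms(1) by (simp add: divide_right_mono)
qed

lemma swap_remove:
  fixes P :: "int \<Rightarrow> int"
  assumes "inj_on P {0..<c}" "0 \<le> y" "y < c"
  shows "inj_on (P(y := P (c - 1))) {0..<c - 1}"
    and "P(y := P (c - 1)) ` {0..<c - 1} = P ` {0..<c} - {P y}"
proof -
  have eq: "P i = P j \<longleftrightarrow> i = j" if "0 \<le> i" "i < c" "0 \<le> j" "j < c" for i j
    using assms(1) that by (auto simp: inj_on_eq_iff)
  show "inj_on (P(y := P (c - 1))) {0..<c - 1}"
    by (rule inj_onI) (use assms(2,3) eq in \<open>auto split: if_splits\<close>)
  show "P(y := P (c - 1)) ` {0..<c - 1} = P ` {0..<c} - {P y}" (is "?L = ?R")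
  proof
    show "?L \<subseteq> ?R"
    proof (rule image_subsetI)
      fix i assume "i \<in> {0..<c - 1}"
      then show "(P(y := P (c - 1))) i \<in> ?R"
        using assms(2,3) eq[of i y] eq[of "c - 1" y] by auto
    qed
    show "?R \<subseteq> ?L"
    proof
      fix z assume "z \<in> ?R"
      then obtain i where "i \<in> {0..<c}" "z = P i" by blast
      moreover from this \<open>z \<in> ?R\<close> have "i \<noteq> y" by blast
      ultimately have i: "z = P i" "0 \<le> i" "i < c" "i \<noteq> y" by auto
      then show "z \<in> ?L"
        using assms(2,3) by (cases "i = c - 1") (auto intro!: image_eqI[where x = y] image_eqI[where x = i])
    qed
  qed
qed

context machine
begin

text \<open>
  The probability that the rank \<open>K\<close> is finally accepted if the ranks above
  \<open>k\<close> have been rejected.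
\<close>

definition rank_prob :: "nat \<Rightarrow> nat \<Rightarrow> real" where
  "rank_prob K k = (if K \<le> k then fact k / fact K * real_of_int (rank_weight n K) / real_of_int (tail_weight n k) else 0)"

lemma rank_prob_nonneg: "k \<le> n \<Longrightarrow> 0 \<le> rank_prob K k"
  using rank_weight_pos[of K n] tail_weight_pos[of k n] by (auto simp: rank_prob_def)

lemma rank_prob_self: "rank_prob k k = real_of_int (rank_weight n k) / real_of_int (tail_weight n k)"
  by (simp add: rank_prob_def)

lemma rank_prob_Suc:
  assumes "K \<le> k" "Suc k \<le> n"
  shows "rank_prob K (Suc k) = real_of_int (tail_weight n (Suc k) - rank_weight n (Suc k)) / real_of_int (tail_weight n (Suc k)) * rank_prob K k"
proof -
  have "tail_weight n k > 0" using tail_weight_pos[of k n] assms by simp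
  moreover have "real_of_int (tail_weight n (Suc k) - rank_weight n (Suc k)) = (real k + 1) * real_of_int (tail_weight n k)"
    by (simp del: rank_weight.simps)
  moreover have "(fact (Suc k) :: real) = (real k + 1) * fact k" by simp
  ultimately show ?thesis using assms(1) unfolding rank_prob_def
    by (simp add: mult_ac del: rank_weight.simps tail_weight.simps fact_Suc)
qed

definition rank_inv :: "'a mem \<Rightarrow> bool" where
  "rank_inv m \<longleftrightarrow> tables m (int n) \<and> 0 \<le> val m 2 \<and> val m 2 \<le> int n \<and> val m 3 \<in> {0, 1}"

text \<open>
  For \<open>k = 0\<close> both table entries are 1, so that the rank 0 is always accepted.
\<close>

lemma rank_loop:
  assumes "K \<le> n" "tables m (int n)" "val m 2 = int n" "val m 3 = 0"
  shows "ptriple M (n + 2) rank_loop m (\<lambda>m. content m (Input, 0) = int n \<and> 0 \<le> val m 2 \<and> val m 2 \<le> int n)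
    (\<lambda>m. of_bool (val m 2 = int K)) (rank_prob K n)"
proof -
  let ?b = "Eq (var 3) (Lit 0)" and ?\<mu> = "\<lambda>m. nat (val m 2) + (if val m 3 = 0 then 1 else 0)"
  let ?\<psi> = "\<lambda>m. if val m 3 = 0 then (if nat (val m 2) \<le> n then rank_prob K (nat (val m 2)) else 0) else of_bool (val m 2 = int K)"
  have \<psi>0: "0 \<le> ?\<psi> m" for m :: "'a mem" by (auto simp: rank_prob_nonneg)
  have "ptriple M (n + 2) rank_loop m (\<lambda>m'. rank_inv m' \<and> \<not> eval_test m' ?b) ?\<psi> (?\<psi> m)"
    unfolding rank_loop_def
  proof (rule ptriple_While[where \<mu> = ?\<mu>])
    fix m :: "'a mem" assume I: "rank_inv m"
    show "test_ok M m ?b" using I by (auto simp: rank_inv_def intro!: fits_small)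
    assume "eval_test m ?b"
    then have v3: "val m 3 = 0" by simp
    obtain k where k: "val m 2 = int k" "k \<le> n" using I unfolding rank_inv_def by (metis of_nat_le_iff zero_le_imp_eq_int)
    have w: "content m (Work 11, int k) = rank_weight n k" "content m (Work 12, int k) = tail_weight n k"
      using I k by (auto simp: rank_inv_def tables_def)
    have fit: "fits M 0" "fits M 1" "fits M (int k)" "fits M (int k - 1)" "fits M (rank_weight n k)" "fits M (tail_weight n k)"
      using k by (auto intro!: fits_small fits_rank_weight fits_tail_weight)
    have fitx: "fits M x" if "0 \<le> x" "x < tail_weight n k" for x
      using fit(6) that by (auto simp: fits_def)
    have k0: "k \<noteq> 0" if "x < tail_weight n k" "\<not> x < rank_weight n k" for x
      using that by (cases k) auto
    let ?body = "If (Lt (var 4) (Cell (Work 11) (var 2))) (set_var 3 (Lit 1)) (decr 2) :: 'a com"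
    let ?m = "\<lambda>x. m((Work 4, 0) \<mapsto> x)"
    show "ptriple M 1 (Seq (Draw (Work 4) (Lit 0) (Cell (Work 12) (var 2))) ?body) m (\<lambda>m'. rank_inv m' \<and> ?\<mu> m' < ?\<mu> m) ?\<psi> (?\<psi> m)"
    proof (rule safe_ptriple')
      have stop: "rank_inv ((?m x)((Work 3, 0) \<mapsto> 1)) \<and> ?\<mu> ((?m x)((Work 3, 0) \<mapsto> 1)) < ?\<mu> m" for x
        using I v3 k by (auto simp: rank_inv_def tables_def)
      have go: "rank_inv ((?m x)((Work 2, 0) \<mapsto> int k - 1)) \<and> ?\<mu> ((?m x)((Work 2, 0) \<mapsto> int k - 1)) < ?\<mu> m"
        if "x < tail_weight n k" "\<not> x < rank_weight n k" for x
        using I v3 k k0[OF that] by (auto simp: rank_inv_def tables_def)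
      show "safe M (Seq (Draw (Work 4) (Lit 0) (Cell (Work 12) (var 2))) ?body) (\<lambda>m'. rank_inv m' \<and> ?\<mu> m' < ?\<mu> m) m"
        using tail_weight_pos[OF k(2)] fit fitx stop go by (simp add: k(1) w v3)
    next
      let ?N = "real_of_int (tail_weight n k)" and ?W = "real_of_int (rank_weight n k)"
      have E0: "0 \<le> expect ?body ?\<psi> m'" for m' by (rule expect_nonneg) (rule \<psi>0)
      have \<psi>m: "?\<psi> m = rank_prob K k" using v3 k by simp
      have N: "1 \<le> tail_weight n k" using tail_weight_pos[OF k(2)] by simp
      have W: "0 < rank_weight n k" "rank_weight n k \<le> tail_weight n k" using rank_weight_pos[OF k(2)] tail_weight_ge[OF k(2)] by auto
      have draw: "real (card X) / ?N * q \<le> expect (Draw (Work 4) (Lit 0) (Cell (Work 12) (var 2))) (expect ?body ?\<psi>) m"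
        if "X \<subseteq> {0..<tail_weight n k}" "\<And>x. x \<in> X \<Longrightarrow> q \<le> expect ?body ?\<psi> (?m x)" for X q
        using expect_Draw_ge[of m "Cell (Work 12) (var 2)" X "expect ?body ?\<psi>" q "Work 4" "Lit 0"] that E0 N
        by (simp add: k(1) w)
      show "?\<psi> m \<le> expect (Seq (Draw (Work 4) (Lit 0) (Cell (Work 12) (var 2))) ?body) ?\<psi> m"
      proof -
        consider "k < K" | "k = K" | k' where "k = Suc k'" "K \<le> k'" by (metis Suc_le_D Suc_le_mono linorder_neqE_nat not_less_eq_eq nat_less_le)
        then have "rank_prob K k \<le> expect (Draw (Work 4) (Lit 0) (Cell (Work 12) (var 2))) (expect ?body ?\<psi>) m"
        proof cases
          case 1
          then have r0: "rank_prob K k = 0" by (simp add: rank_prob_def)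
          show ?thesis unfolding r0 by (rule expect_nonneg, rule E0)
        next
          case 2
          have "real (card {0..<rank_weight n k}) / ?N * 1 \<le> expect (Draw (Work 4) (Lit 0) (Cell (Work 12) (var 2))) (expect ?body ?\<psi>) m"
            by (rule draw) (use W v3 k 2 w in auto)
          then show ?thesis using W 2 by (simp add: rank_prob_self)
        next
          case 3
          have "real (card {rank_weight n k..<tail_weight n k}) / ?N * rank_prob K k' \<le> expect (Draw (Work 4) (Lit 0) (Cell (Work 12) (var 2))) (expect ?body ?\<psi>) m"
            by (rule draw) (use W v3 k 3 w in \<open>auto simp del: rank_weight.simps tail_weight.simps\<close>)
          moreover have "rank_prob K k = real (card {rank_weight n k..<tail_weight n k}) / ?N * rank_prob K k'"
            using W 3 k rank_prob_Suc[of K k'] by (simp add: of_nat_nat del: rank_weight.simps tail_weight.simps)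
          ultimately show ?thesis by simp
        qed
        then show ?thesis by (simp only: \<psi>m expect.simps(4))
      qed
    qed simp
  qed (use assms n in \<open>auto simp: rank_inv_def\<close>)
  then show ?thesis
    by (rule ptriple_mono) (use assms in \<open>auto simp: rank_inv_def tables_def\<close>)
qed

lemma pool_loop:
  assumes "content m (Input, 0) = int n" "val m 2 = r" "val m 6 = 0"
  shows "triple M (n + 2) pool_loop m (\<lambda>m. content m (Input, 0) = int n \<and> val m 2 = r \<and> (\<forall>i. 0 \<le> i \<longrightarrow> i < int n \<longrightarrow> content m (Work 5, i) = i + 1))"
proof -
  let ?I = "\<lambda>m. content m (Input, 0) = int n \<and> val m 2 = r \<and> 0 \<le> val m 6 \<and> val m 6 \<le> int n \<and>
    (\<forall>i. 0 \<le> i \<longrightarrow> i < val m 6 \<longrightarrow> content m (Work 5, i) = i + 1)"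
  let ?b = "Lt (var 6) size_exp"
  have "triple M (n + 2) pool_loop m (\<lambda>m'. ?I m' \<and> \<not> eval_test m' ?b)"
    unfolding pool_loop_def
  proof (rule triple_While[where \<mu> = "\<lambda>m. nat (int n - val m 6)"])
    fix m :: "'a mem" assume I: "?I m"
    show "test_ok M m ?b" using I by (auto intro!: fits_small)
    assume "eval_test m ?b"
    with I show "triple M 1 (Seq (Assign (Work 5) (var 6) (Add (var 6) (Lit 1))) (incr 6)) m
       (\<lambda>m'. ?I m' \<and> nat (int n - val m' 6) < nat (int n - val m 6))"
      by (intro safe_triple) (auto intro!: fits_small)
  qed (use assms in auto)
  then show ?thesis by (rule triple_mono) auto
qed

end

definition out_rel :: "nat \<Rightarrow> 'a \<Rightarrow> 'a mem \<Rightarrow> (int \<times> int) set" where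
  "out_rel n a m = {(u, v). u \<in> {1..int n} \<and> v \<in> {1..int n} \<and> content m (Edge a, u) = v}"

text \<open>
  Partial injections are stored as arrays, with 0 for a missing image.
\<close>

definition image_of :: "(int \<times> int) set \<Rightarrow> int \<Rightarrow> int" where
  "image_of R u = (if u \<in> Domain R then THE v. (u, v) \<in> R else 0)"

lemma image_of_eq:
  assumes "R \<in> pinj S" "(u, v) \<in> R" shows "image_of R u = v"
proof -
  have "(THE v. (u, v) \<in> R) = v"
    using assms by (intro the_equality) (auto simp: pinj_def single_valued_def)
  then show ?thesis using assms(2) by (auto simp: image_of_def)
qed

lemma image_of_mem:
  assumes "R \<in> pinj S" "0 \<notin> S" "image_of R u \<noteq> 0"
  shows "(u, image_of R u) \<in> R"
proof -
  have "u \<in> Domain R" using assms(3) by (auto simp: image_of_def split: if_splits)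
  then obtain v where "(u, v) \<in> R" by auto
  with image_of_eq[OF assms(1)] show ?thesis by metis
qed

lemma image_of_nonzero:
  assumes "R \<in> pinj S" "0 \<notin> S"
  shows "image_of R u \<noteq> 0 \<longleftrightarrow> u \<in> Domain R"
proof
  assume "u \<in> Domain R"
  then obtain v where v: "(u, v) \<in> R" by blast
  then have "v \<in> S" using assms(1) by (auto simp: pinj_def)
  with image_of_eq[OF assms(1) v] assms(2) show "image_of R u \<noteq> 0" by auto
next
  assume "image_of R u \<noteq> 0"
  with image_of_mem[OF assms] show "u \<in> Domain R" by blast
qed

lemma out_rel_eqI:
  assumes "R \<in> pinj {1..int n}" "\<And>u. u \<in> {1..int n} \<Longrightarrow> content m (Edge a, u) = image_of R u"
  shows "out_rel n a m = R"
proof -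
  have R: "(u, v) \<in> R \<Longrightarrow> u \<in> {1..int n} \<and> v \<in> {1..int n}" for u v using assms(1) by (auto simp: pinj_def)
  have "(u, v) \<in> out_rel n a m \<longleftrightarrow> (u, v) \<in> R" for u v
  proof
    assume "(u, v) \<in> out_rel n a m"
    then have uv: "u \<in> {1..int n}" "v \<in> {1..int n}" "image_of R u = v" using assms(2)[of u] by (auto simp: out_rel_def)
    then have "image_of R u \<noteq> 0" by auto
    with image_of_mem[OF assms(1) _ this] uv(3) show "(u, v) \<in> R" by auto
  next
    assume uv: "(u, v) \<in> R"
    with R have "u \<in> {1..int n}" "v \<in> {1..int n}" by blast+
    then show "(u, v) \<in> out_rel n a m" using assms(2)[of u] image_of_eq[OF assms(1) uv] by (auto simp: out_rel_def)
  qed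
  then show ?thesis by auto
qed

context machine
begin

text \<open>
  The pool contains exactly the vertices that are not yet images. The bound \<open>val m 2 \<le>
  val m 7\<close> keeps the pool from being exhausted while images remain to be assigned.
\<close>

definition edge_inv :: "'a \<Rightarrow> 'a mem \<Rightarrow> bool" where
  "edge_inv a m \<longleftrightarrow> content m (Input, 0) = int n \<and> 1 \<le> val m 6 \<and> val m 6 \<le> int n + 1 \<and>
     0 \<le> val m 2 \<and> val m 2 \<le> int n + 1 - val m 6 \<and> val m 2 \<le> val m 7 \<and> val m 7 \<le> int n \<and>
     inj_on (\<lambda>i. content m (Work 5, i)) {0..<val m 7} \<and>
     (\<lambda>i. content m (Work 5, i)) ` {0..<val m 7} = {1..int n} - (\<lambda>w. content m (Edge a, w)) ` {1..<val m 6} \<and>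
     (\<forall>w\<in>{1..<val m 6}. 0 \<le> content m (Edge a, w) \<and> content m (Edge a, w) \<le> int n) \<and>
     (\<forall>w\<in>{1..<val m 6}. \<forall>w'\<in>{1..<val m 6}. content m (Edge a, w) = content m (Edge a, w') \<longrightarrow>
        content m (Edge a, w) \<noteq> 0 \<longrightarrow> w = w')"

definition agrees :: "'a \<Rightarrow> (int \<times> int) set \<Rightarrow> 'a mem \<Rightarrow> bool" where
  "agrees a R m \<longleftrightarrow> (\<forall>w\<in>{1..<val m 6}. content m (Edge a, w) = image_of R w) \<and>
     val m 2 = int (card {w \<in> {val m 6..int n}. image_of R w \<noteq> 0})"

text \<open>
  The probability of one fixed completion, if \<open>e\<close> of the \<open>d\<close> remaining
  vertices get an image from a pool of size \<open>c\<close>: the reciprocal of the number of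
  choices of these vertices, times that of the number of sequences of \<open>e\<close> different
  elements of the pool.
\<close>

definition completion_prob :: "nat \<Rightarrow> nat \<Rightarrow> nat \<Rightarrow> real" where
  "completion_prob d e c = fact e * fact (d - e) / fact d * (fact (c - e) / fact c)"

lemma completion_prob_nonneg: "0 \<le> completion_prob d e c"
  by (simp add: completion_prob_def)

lemma completion_prob_skip:
  "e \<le> d \<Longrightarrow> completion_prob (Suc d) e c = real (Suc d - e) / real (Suc d) * completion_prob d e c"
  unfolding completion_prob_def by (simp add: Suc_diff_le field_simps)

lemma completion_prob_use:
  "e \<le> d \<Longrightarrow> e \<le> c \<Longrightarrow>
     completion_prob (Suc d) (Suc e) (Suc c) = real (Suc e) / real (Suc d) * (1 / real (Suc c) * completion_prob d e c)"
  unfolding completion_prob_def by (simp add: field_simps)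

text \<open>
  The probability to end with the target \<open>R\<close>. It is 0 as soon as the array deviates
  from \<open>R\<close> or the rank makes \<open>R\<close> impossible.
\<close>

definition edge_value :: "'a \<Rightarrow> (int \<times> int) set \<Rightarrow> 'a mem \<Rightarrow> real" where
  "edge_value a R m = (if agrees a R m then completion_prob (nat (int n + 1 - val m 6)) (nat (val m 2)) (nat (val m 7)) else 0)"

lemma edge_value_nonneg: "0 \<le> edge_value a R m"
  by (simp add: edge_value_def completion_prob_nonneg)

definition use_mem :: "'a \<Rightarrow> 'a mem \<Rightarrow> int \<Rightarrow> int \<Rightarrow> 'a mem" where
  "use_mem a m x y = m((Work 8, 0) \<mapsto> x, (Work 9, 0) \<mapsto> y, (Edge a, val m 6) \<mapsto> content m (Work 5, y),
     (Work 7, 0) \<mapsto> val m 7 - 1, (Work 5, y) \<mapsto> content m (Work 5, val m 7 - 1), (Work 2, 0) \<mapsto> val m 2 - 1,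
     (Work 6, 0) \<mapsto> val m 6 + 1)"

definition skip_mem :: "'a \<Rightarrow> 'a mem \<Rightarrow> int \<Rightarrow> 'a mem" where
  "skip_mem a m x = m((Work 8, 0) \<mapsto> x, (Edge a, val m 6) \<mapsto> 0, (Work 6, 0) \<mapsto> val m 6 + 1)"

lemma use_mem_inv:
  assumes I: "edge_inv a m" and x: "0 \<le> x" "x < val m 2" and y: "0 \<le> y" "y < val m 7" and u: "val m 6 \<le> int n"
  shows "edge_inv a (use_mem a m x y)"
proof -
  let ?P = "\<lambda>i. content m (Work 5, i)" and ?E = "\<lambda>w. content m (Edge a, w)" and ?u = "val m 6" and ?c = "val m 7"
  let ?m = "use_mem a m x y"
  have P': "(\<lambda>i. content ?m (Work 5, i)) = ?P(y := ?P (?c - 1))" by (auto simp: use_mem_def fun_eq_iff)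
  have E': "(\<lambda>w. content ?m (Edge a, w)) = ?E(?u := ?P y)" by (auto simp: use_mem_def fun_eq_iff)
  have E'': "content ?m (Edge a, w) = (if w = ?u then ?P y else ?E w)" for w by (simp add: use_mem_def)
  have inj: "inj_on ?P {0..<?c}" and img: "?P ` {0..<?c} = {1..int n} - ?E ` {1..<?u}" using I by (auto simp: edge_inv_def)
  have u1: "1 \<le> ?u" using I by (simp add: edge_inv_def)
  have Py: "?P y \<in> {1..int n} - ?E ` {1..<?u}" using img y by force
  have ne: "?E w \<noteq> ?P y" if "1 \<le> w" "w < ?u" for w
  proof -
    have "?E w \<in> ?E ` {1..<?u}" using that by simp
    with Py show ?thesis by (metis DiffD2)
  qed
  have rng: "{1..<?u + 1} = insert ?u {1..<?u}" using u1 by auto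
  have "(?E(?u := ?P y)) ` {1..<?u + 1} = insert (?P y) (?E ` {1..<?u})"
    unfolding rng by (simp add: image_def) auto
  then have "(?P(y := ?P (?c - 1))) ` {0..<?c - 1} = {1..int n} - (?E(?u := ?P y)) ` {1..<?u + 1}"
    using swap_remove(2)[OF inj y] img by auto
  moreover have "inj_on (?P(y := ?P (?c - 1))) {0..<?c - 1}" by (rule swap_remove(1)[OF inj y])
  moreover have "\<forall>w\<in>{1..<?u + 1}. 0 \<le> content ?m (Edge a, w) \<and> content ?m (Edge a, w) \<le> int n"
    using I Py unfolding E'' rng by (auto simp: edge_inv_def)
  moreover have "\<forall>w\<in>{1..<?u + 1}. \<forall>w'\<in>{1..<?u + 1}. content ?m (Edge a, w) = content ?m (Edge a, w') \<longrightarrow>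
        content ?m (Edge a, w) \<noteq> 0 \<longrightarrow> w = w'"
    using I ne ne[symmetric] unfolding E'' rng by (auto simp: edge_inv_def)
  moreover have "val ?m 6 = ?u + 1" "val ?m 7 = ?c - 1" "val ?m 2 = val m 2 - 1" "content ?m (Input, 0) = content m (Input, 0)"
    by (auto simp: use_mem_def)
  ultimately show ?thesis using I x u unfolding edge_inv_def P' E' by auto
qed

lemma skip_mem_inv:
  assumes I: "edge_inv a m" and x: "val m 2 \<le> x" "x < int n + 1 - val m 6"
  shows "edge_inv a (skip_mem a m x)"
proof -
  let ?P = "\<lambda>i. content m (Work 5, i)" and ?E = "\<lambda>w. content m (Edge a, w)" and ?u = "val m 6"
  let ?m = "skip_mem a m x"
  have E': "(\<lambda>w. content ?m (Edge a, w)) = ?E(?u := 0)" by (auto simp: skip_mem_def fun_eq_iff)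
  have E'': "content ?m (Edge a, w) = (if w = ?u then 0 else ?E w)" for w by (simp add: skip_mem_def)
  have img: "?P ` {0..<val m 7} = {1..int n} - ?E ` {1..<?u}" using I by (auto simp: edge_inv_def)
  have u1: "1 \<le> ?u" using I by (simp add: edge_inv_def)
  have rng: "{1..<?u + 1} = insert ?u {1..<?u}" using u1 by auto
  have "(?E(?u := 0)) ` {1..<?u + 1} = insert 0 (?E ` {1..<?u})"
    unfolding rng by (simp add: image_def) auto
  then have "?P ` {0..<val m 7} = {1..int n} - (?E(?u := 0)) ` {1..<?u + 1}" using img by auto
  moreover have "\<forall>w\<in>{1..<?u + 1}. 0 \<le> content ?m (Edge a, w) \<and> content ?m (Edge a, w) \<le> int n"
    using I unfolding E'' rng by (auto simp: edge_inv_def)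
  moreover have "\<forall>w\<in>{1..<?u + 1}. \<forall>w'\<in>{1..<?u + 1}. content ?m (Edge a, w) = content ?m (Edge a, w') \<longrightarrow>
        content ?m (Edge a, w) \<noteq> 0 \<longrightarrow> w = w'"
    using I unfolding E'' rng by (auto simp: edge_inv_def)
  moreover have "val ?m 6 = ?u + 1" "val ?m 7 = val m 7" "val ?m 2 = val m 2" "content ?m (Input, 0) = content m (Input, 0)"
    by (auto simp: skip_mem_def)
  moreover have P': "(\<lambda>i. content ?m (Work 5, i)) = ?P" by (simp add: skip_mem_def)
  ultimately show ?thesis using I x unfolding edge_inv_def E' P' by auto
qed

lemma edge_inv_pinj:
  assumes "edge_inv a m" "val m 6 = int n + 1"
  shows "out_rel n a m \<in> pinj {1..int n}"
proof -
  have "w = w'" if "w \<in> {1..int n}" "w' \<in> {1..int n}" "content m (Edge a, w) = content m (Edge a, w')" "content m (Edge a, w) \<in> {1..int n}" for w w'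
  proof -
    have "w \<in> {1..<val m 6}" "w' \<in> {1..<val m 6}" using that assms(2) by auto
    then show ?thesis using assms(1) that(3,4) unfolding edge_inv_def by force
  qed
  then show ?thesis unfolding pinj_def single_valued_def out_rel_def by auto
qed

lemma agrees_card:
  assumes "val m 6 \<le> int n"
  shows "card {w \<in> {val m 6..int n}. image_of R w \<noteq> 0} =
    (if image_of R (val m 6) = 0 then 0 else 1) + card {w \<in> {val m 6 + 1..int n}. image_of R w \<noteq> 0}"
proof -
  have "{w \<in> {val m 6..int n}. image_of R w \<noteq> 0} =
    (if image_of R (val m 6) = 0 then {} else {val m 6}) \<union> {w \<in> {val m 6 + 1..int n}. image_of R w \<noteq> 0}"
    using assms by (auto split: if_splits) (metis zless_add1_eq add1_zle_eq order_le_less)+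
  also have "card \<dots> = (if image_of R (val m 6) = 0 then 0 else 1) + card {w \<in> {val m 6 + 1..int n}. image_of R w \<noteq> 0}"
    by (subst card_Un_disjoint) (auto intro: finite_subset[of _ "{val m 6 + 1..int n}"])
  finally show ?thesis .
qed

end

lemma ptriple_Seq_det:
  assumes "triple M f c m Q1" "\<And>m'. Q1 m' \<Longrightarrow> ptriple M f d m' Q \<phi> q"
  shows "ptriple M f (Seq c d) m Q \<phi> q"
proof (rule ptriple_Seq)
  show "ptriple M f c m Q1 (\<lambda>_. q) q" by (rule ptriple_const[OF assms(1)]) simp
qed (rule assms(2))

lemma ptriple_scale:
  assumes "ptriple M f c m Q \<phi> q" "0 \<le> s"
  shows "ptriple M f c m Q (\<lambda>m. s * \<phi> m) (s * q)"
proof -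
  from assms(1) obtain p where p: "sure M c m (f * sz c) p" "\<forall>m'\<in>set_pmf p. Q m'" "q \<le> measure_pmf.expectation p \<phi>"
    unfolding ptriple_def by blast
  then have "s * q \<le> measure_pmf.expectation p (\<lambda>m. s * \<phi> m)" using assms(2) by (simp add: mult_left_mono)
  with p show ?thesis unfolding ptriple_def by blast
qed

context machine
begin

definition sampled :: "'a \<Rightarrow> 'a mem \<Rightarrow> bool" where
  "sampled a m \<longleftrightarrow> content m (Input, 0) = int n \<and> out_rel n a m \<in> pinj {1..int n} \<and>
     (\<forall>u\<in>{1..int n}. 0 \<le> content m (Edge a, u) \<and> content m (Edge a, u) \<le> int n)"

text \<open>
  If the current vertex has no image under \<open>R\<close>, the favourable draws are those that
  skip it; otherwise they are those that give it an image, combined with the position of this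
  image in the pool. In both cases the factor lost in \<open>edge_value\<close> is the
  probability of the favourable draws.
\<close>

lemma edge_body:
  assumes R: "R \<in> pinj {1..int n}" and I: "edge_inv a m" and u: "val m 6 \<le> int n"
  shows "ptriple M 1 (Seq (Draw (Work 8) (Lit 0) (Sub (Add size_exp (Lit 1)) (var 6)))
     (Seq (If (Lt (var 8) (var 2))
            (Seq (Draw (Work 9) (Lit 0) (var 7))
            (Seq (Assign (Edge a) (var 6) (Cell (Work 5) (var 9)))
            (Seq (decr 7)
            (Seq (Assign (Work 5) (var 9) (Cell (Work 5) (var 7)))
              (decr 2)))))
            (Assign (Edge a) (var 6) (Lit 0)))
       (incr 6))) m (\<lambda>m'. edge_inv a m' \<and> nat (int n + 1 - val m' 6) < nat (int n + 1 - val m 6))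
       (edge_value a R) (edge_value a R m)"
    (is "ptriple M 1 (Seq ?draw ?rest) m ?Q _ _")
proof (rule safe_ptriple')
  let ?e = "val m 2" and ?d = "int n + 1 - val m 6" and ?c = "val m 7"
  have b: "content m (Input, 0) = int n" "1 \<le> val m 6" "0 \<le> ?e" "?e \<le> ?d" "?e \<le> ?c" "?c \<le> int n"
    using I by (auto simp: edge_inv_def)
  have d: "1 \<le> ?d" "?d \<le> int n" using u b by auto
  have P: "1 \<le> content m (Work 5, y) \<and> content m (Work 5, y) \<le> int n" if "0 \<le> y" "y < ?c" for y
  proof -
    have "content m (Work 5, y) \<in> (\<lambda>i. content m (Work 5, i)) ` {0..<?c}" using that by simp
    then show ?thesis using I unfolding edge_inv_def by auto
  qed
  have dec: "nat (int n + 1 - (val m 6 + 1)) < nat (int n + 1 - val m 6)" using u by simp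
  have use: "?Q (use_mem a m x y)" if "0 \<le> x" "x < ?e" "0 \<le> y" "y < ?c" for x y
    using use_mem_inv[OF I that u] dec by (simp add: use_mem_def)
  have skip: "?Q (skip_mem a m x)" if "?e \<le> x" "x < ?d" for x
    using skip_mem_inv[OF I that] dec by (simp add: skip_mem_def)
  have fits: "fits M x" if "-1 \<le> x" "x \<le> int n + 1" for x using that by (intro fits_small) auto
  have fitP: "fits M (content m (Work 5, y))" if "0 \<le> y" "y < ?c" for y using P[OF that] by (intro fits) auto
  show "safe M (Seq ?draw ?rest) ?Q m"
    using use[unfolded use_mem_def] skip[unfolded skip_mem_def] b d by (auto simp: fitP intro!: fits)
  have nn: "0 \<le> expect c (edge_value a R) m" for c and m :: "'a mem" by (rule expect_nonneg) (rule edge_value_nonneg)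
  have Eskip: "expect ?rest (edge_value a R) (m((Work 8, 0) \<mapsto> x)) = edge_value a R (skip_mem a m x)" if "?e \<le> x" for x
    using that by (simp add: skip_mem_def)
  have Euse: "expect ?rest (edge_value a R) (m((Work 8, 0) \<mapsto> x)) =
     (\<Sum>y\<in>{0..<?c}. edge_value a R (use_mem a m x y)) / real_of_int ?c" if "x < ?e" for x
    using that by (simp add: use_mem_def)
  have draw: "real (card X) / real_of_int ?d * q \<le> expect ?draw (expect ?rest (edge_value a R)) m"
    if "X \<subseteq> {0..<?d}" "\<And>x. x \<in> X \<Longrightarrow> q \<le> expect ?rest (edge_value a R) (m((Work 8, 0) \<mapsto> x))" for X q
  proof -
    have e: "eval_exp m (Sub (Add size_exp (Lit 1)) (var 6)) = ?d" and i: "eval_exp m (Lit 0) = 0" by (simp_all add: b)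
    show ?thesis
      by (rule expect_Draw_ge[of m "Sub (Add size_exp (Lit 1)) (var 6)" X "expect ?rest (edge_value a R)" q "Work 8" "Lit 0", unfolded e i,
            OF d(1) that(1) nn that(2)])
  qed
  obtain d' where d': "?d = int (Suc d')" by (rule that[of "nat (?d - 1)"]) (use d in simp)
  show "edge_value a R m \<le> expect (Seq ?draw ?rest) (edge_value a R) m"
  proof (cases "agrees a R m")
    case False
    then have "edge_value a R m = 0" by (simp add: edge_value_def)
    with nn[of "Seq ?draw ?rest" m] show ?thesis by simp
  next
    case agr: True
    let ?u = "val m 6"
    have "card {w \<in> {?u + 1..int n}. image_of R w \<noteq> 0} \<le> card {?u + 1..int n}" by (intro card_mono) auto
    then have cle: "card {w \<in> {?u + 1..int n}. image_of R w \<noteq> 0} \<le> d'" using d' by simp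
    have rng: "{1..<?u + 1} = insert ?u {1..<?u}" using b by auto
    have val: "edge_value a R m = completion_prob (Suc d') (nat ?e) (nat ?c)"
    proof -
      have "nat ?d = Suc d'" using d' by linarith
      then show ?thesis using agr unfolding edge_value_def by simp
    qed
    show ?thesis
    proof (cases "image_of R ?u = 0")
      case True
      then have e: "?e = int (card {w \<in> {?u + 1..int n}. image_of R w \<noteq> 0})"
        using agr agrees_card[OF u, of R] unfolding agrees_def by simp
      then have e': "nat ?e \<le> d'" using cle by simp
      have "agrees a R (skip_mem a m x)" for x
        using agr True e unfolding agrees_def skip_mem_def by (auto simp: rng)
      then have v: "edge_value a R (skip_mem a m x) = completion_prob d' (nat ?e) (nat ?c)" for x
        using d' by (simp add: edge_value_def) (simp add: skip_mem_def)
      have "real (card {?e..<?d}) / real_of_int ?d * completion_prob d' (nat ?e) (nat ?c) \<le> expect ?draw (expect ?rest (edge_value a R)) m"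
        by (rule draw) (use b Eskip v in auto)
      moreover have "card {?e..<?d} = Suc d' - nat ?e" using d' b e' by simp
      ultimately show ?thesis unfolding val completion_prob_skip[OF e'] by (simp add: d')
    next
      case False
      then have e: "?e = 1 + int (card {w \<in> {?u + 1..int n}. image_of R w \<noteq> 0})"
        using agr agrees_card[OF u, of R] unfolding agrees_def by simp
      obtain e' where e': "nat ?e = Suc e'" "?e = int (Suc e')" "e' \<le> d'" using e cle by auto
      define c' where "c' = nat (?c - 1)"
      have c': "?c = int (Suc c')" "e' \<le> c'" using e'(2) b(5) unfolding c'_def by simp_all
      have mem: "(?u, image_of R ?u) \<in> R" by (rule image_of_mem[OF R _ False]) simp
      then have tV: "image_of R ?u \<in> {1..int n}" using R by (auto simp: pinj_def)
      have "image_of R ?u \<notin> (\<lambda>w. content m (Edge a, w)) ` {1..<?u}"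
      proof
        assume "image_of R ?u \<in> (\<lambda>w. content m (Edge a, w)) ` {1..<?u}"
        then obtain w where w: "w \<in> {1..<?u}" "image_of R ?u = content m (Edge a, w)" by blast
        then have iw: "image_of R w = image_of R ?u" using agr by (simp add: agrees_def)
        then have "(w, image_of R ?u) \<in> R" using image_of_mem[OF R, of w] False by auto
        with mem R have "w = ?u" unfolding pinj_def single_valued_def by blast
        with w show False by auto
      qed
      with tV have "image_of R ?u \<in> (\<lambda>i. content m (Work 5, i)) ` {0..<?c}" using I unfolding edge_inv_def by auto
      then obtain y where y: "0 \<le> y" "y < ?c" "content m (Work 5, y) = image_of R ?u" by auto
      have "agrees a R (use_mem a m x y)" for x
        using agr y e unfolding agrees_def use_mem_def by (auto simp: rng)
      then have v: "edge_value a R (use_mem a m x y) = completion_prob d' e' c'" for x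
        using d' e' c' by (simp add: edge_value_def) (simp add: use_mem_def)
      have v': "1 / real (Suc c') * completion_prob d' e' c' \<le> expect ?rest (edge_value a R) (m((Work 8, 0) \<mapsto> x))" if "x < ?e" for x
      proof -
        have "completion_prob d' e' c' \<le> (\<Sum>y\<in>{0..<?c}. edge_value a R (use_mem a m x y))"
          unfolding v[of x, symmetric] by (rule member_le_sum) (use y edge_value_nonneg in auto)
        then show ?thesis unfolding Euse[OF that] by (simp add: c' divide_right_mono)
      qed
      have "real (card {0..<?e}) / real_of_int ?d * (1 / real (Suc c') * completion_prob d' e' c') \<le> expect ?draw (expect ?rest (edge_value a R)) m"
        by (rule draw) (use b v' in auto)
      then show ?thesis
        unfolding val e'(1) c'(1) nat_int completion_prob_use[OF e'(3) c'(2)] by (simp add: d' e'(2))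
    qed
  qed
qed simp

lemma edge_loop:
  assumes R: "R \<in> pinj {1..int n}" and I: "edge_inv a m"
  shows "ptriple M (n + 2) (edge_loop a) m (sampled a) (\<lambda>m. of_bool (out_rel n a m = R)) (edge_value a R m)"
proof -
  let ?b = "Lt (var 6) (Add size_exp (Lit 1))"
  have "ptriple M (n + 2) (edge_loop a) m (\<lambda>m'. edge_inv a m' \<and> \<not> eval_test m' ?b) (edge_value a R) (edge_value a R m)"
    unfolding edge_loop_def
  proof (rule ptriple_While[where \<mu> = "\<lambda>m. nat (int n + 1 - val m 6)"])
    fix m :: "'a mem" assume I: "edge_inv a m"
    show "test_ok M m ?b" using I by (auto simp: edge_inv_def intro!: fits_small)
    assume b: "eval_test m ?b"
    show "ptriple M 1 (Seq (Draw (Work 8) (Lit 0) (Sub (Add size_exp (Lit 1)) (var 6)))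
     (Seq (If (Lt (var 8) (var 2))
            (Seq (Draw (Work 9) (Lit 0) (var 7))
            (Seq (Assign (Edge a) (var 6) (Cell (Work 5) (var 9)))
            (Seq (decr 7)
            (Seq (Assign (Work 5) (var 9) (Cell (Work 5) (var 7)))
              (decr 2)))))
            (Assign (Edge a) (var 6) (Lit 0)))
       (incr 6))) m (\<lambda>m'. edge_inv a m' \<and> nat (int n + 1 - val m' 6) < nat (int n + 1 - val m 6))
       (edge_value a R) (edge_value a R m)"
      by (rule edge_body[OF R I]) (use b I in \<open>auto simp: edge_inv_def\<close>)
  qed (use I in \<open>auto simp: edge_inv_def\<close>)
  then show ?thesis
  proof (rule ptriple_mono)
    fix m' assume m': "edge_inv a m' \<and> \<not> eval_test m' ?b"
    then have u: "val m' 6 = int n + 1" by (auto simp: edge_inv_def)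
    have "out_rel n a m' \<in> pinj {1..int n}" using edge_inv_pinj[OF _ u] m' by blast
    with m' u show "sampled a m'" by (auto simp: sampled_def edge_inv_def)
    show "edge_value a R m' \<le> of_bool (out_rel n a m' = R)"
    proof (cases "agrees a R m'")
      case True
      then have "out_rel n a m' = R" using u by (intro out_rel_eqI[OF R]) (auto simp: agrees_def)
      moreover have "val m' 2 = 0" using True u by (simp add: agrees_def)
      ultimately show ?thesis using True u by (simp add: edge_value_def completion_prob_def)
    qed (simp add: edge_value_def)
  qed simp_all
qed

text \<open>
  The probability of the rank of \<open>R\<close> times the probability of \<open>R\<close>
  given its rank does not depend on \<open>R\<close>.
\<close>

lemma sample_prob:
  assumes "R \<in> pinj {1..int n}"
  shows "rank_prob (card R) n * completion_prob n (card R) n = 1 / real (card (pinj {1..int n}))"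
proof -
  have k: "card R \<le> n" using card_pinj_le[OF _ assms] by simp
  have t: "real_of_int (tail_weight n n) = fact n * real (card (pinj {1..int n}))"
    by (rule tail_weight_card) auto
  show ?thesis
    unfolding rank_prob_def completion_prob_def t rank_weight_fact[OF k] using k
    by (simp add: power2_eq_square field_simps)
qed

lemma sample:
  assumes R: "R \<in> pinj {1..int n}" and m: "content m (Input, 0) = int n"
  shows "ptriple M (n + 2) (sample a) m (sampled a) (\<lambda>m. of_bool (out_rel n a m = R)) (1 / real (card (pinj {1..int n})))"
proof -
  let ?K = "card R"
  have K: "?K \<le> n" using card_pinj_le[OF _ R] by simp
  have K': "card {w \<in> {1..int n}. image_of R w \<noteq> 0} = ?K"
  proof -
    have "{w \<in> {1..int n}. image_of R w \<noteq> 0} = Domain R"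
      using image_of_nonzero[OF R] Field_pinj(1)[OF R] by auto
    then show ?thesis using card_Domain[OF R] by simp
  qed
  have f: "1 \<le> n + 2" by simp
  have fits: "fits M 0" "fits M 1" "fits M (int n)" by (auto intro!: fits_small)
  let ?\<phi> = "\<lambda>m. of_bool (out_rel n a m = R) :: real"
  have last: "ptriple M (n + 2) (Seq (set_var 6 (Lit 0)) (Seq pool_loop (Seq (set_var 7 size_exp) (Seq (set_var 6 (Lit 1)) (edge_loop a)))))
      m (sampled a) ?\<phi> (completion_prob n ?K n * of_bool (val m 2 = int ?K))"
    if m: "content m (Input, 0) = int n \<and> 0 \<le> val m 2 \<and> val m 2 \<le> int n" for m :: "'a mem"
  proof -
    let ?Q1 = "\<lambda>m'. content m' (Input, 0) = int n \<and> val m' 2 = val m 2 \<and> val m' 6 = 0"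
    let ?Q2 = "\<lambda>m'. content m' (Input, 0) = int n \<and> val m' 2 = val m 2 \<and> (\<forall>i. 0 \<le> i \<longrightarrow> i < int n \<longrightarrow> content m' (Work 5, i) = i + 1)"
    let ?Q3 = "\<lambda>m'. ?Q2 m' \<and> val m' 7 = int n"
    let ?Q4 = "\<lambda>m'. ?Q3 m' \<and> val m' 6 = 1"
    have 1: "triple M (n + 2) (set_var 6 (Lit 0)) m ?Q1" by (rule safe_triple[OF f]) (use m fits in auto)
    have 2: "triple M (n + 2) pool_loop m' ?Q2" if "?Q1 m'" for m' :: "'a mem" by (rule pool_loop) (use that in auto)
    have 3: "triple M (n + 2) (set_var 7 size_exp) m' ?Q3" if "?Q2 m'" for m' :: "'a mem" by (rule safe_triple[OF f]) (use that fits in auto)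
    have 4: "triple M (n + 2) (set_var 6 (Lit 1)) m' ?Q4" if "?Q3 m'" for m' :: "'a mem" by (rule safe_triple[OF f]) (use that fits in auto)
    have 5: "ptriple M (n + 2) (edge_loop a) m' (sampled a) ?\<phi> (completion_prob n ?K n * of_bool (val m 2 = int ?K))" if q: "?Q4 m'" for m' :: "'a mem"
    proof -
      have img: "(\<lambda>i. content m' (Work 5, i)) ` {0..<int n} = {1..int n}"
      proof -
        have "(\<lambda>i. content m' (Work 5, i)) ` {0..<int n} = (\<lambda>i. i + 1) ` {0..<int n}"
          using q by (intro image_cong) auto
        also have "\<dots> = {0 + 1..<int n + 1}" by (rule image_add_atLeastLessThan')
        finally show ?thesis by auto
      qed
      have "inj_on (\<lambda>i. content m' (Work 5, i)) {0..<int n}" using q by (auto simp: inj_on_def)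
      then have inv: "edge_inv a m'" using q m img unfolding edge_inv_def by auto
      have "completion_prob n ?K n * of_bool (val m 2 = int ?K) \<le> edge_value a R m'"
        using q K' by (auto simp: edge_value_def agrees_def completion_prob_nonneg)
      then show ?thesis by (intro ptriple_mono[OF edge_loop[OF R inv]]) auto
    qed
    show ?thesis by (intro ptriple_Seq_det[OF 1] ptriple_Seq_det[OF 2] ptriple_Seq_det[OF 3] ptriple_Seq_det[OF 4] 5)
  qed
  let ?P1 = "\<lambda>m. content m (Input, 0) = int n \<and> val m 2 = 0"
  let ?P2 = "\<lambda>m. ?P1 m \<and> content m (Work 12, 0) = 1"
  let ?P3 = "\<lambda>m. tables m 0 \<and> val m 2 = 0"
  let ?P4 = "\<lambda>m. tables m (int n) \<and> val m 2 = int n"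
  let ?P5 = "\<lambda>m. ?P4 m \<and> val m 3 = 0"
  have 1: "triple M (n + 2) (set_var 2 (Lit 0)) m ?P1" by (rule safe_triple[OF f]) (use m fits in auto)
  have 2: "triple M (n + 2) (Assign (Work 12) (Lit 0) (Lit 1)) m' ?P2" if "?P1 m'" for m' :: "'a mem"
    by (rule safe_triple[OF f]) (use that fits in auto)
  have 3: "triple M (n + 2) (Assign (Work 11) (Lit 0) (Lit 1)) m' ?P3" if "?P2 m'" for m' :: "'a mem"
    by (rule safe_triple[OF f]) (use that fits in \<open>auto simp: tables_def\<close>)
  have 4: "triple M (n + 2) table_loop m' ?P4" if "?P3 m'" for m' :: "'a mem" by (rule table_loop) (use that in auto)
  have 5: "triple M (n + 2) (set_var 3 (Lit 0)) m' ?P5" if "?P4 m'" for m' :: "'a mem"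
    by (rule safe_triple[OF f]) (use that fits in \<open>auto simp: tables_def\<close>)
  have 6: "ptriple M (n + 2) rank_loop m' (\<lambda>m. content m (Input, 0) = int n \<and> 0 \<le> val m 2 \<and> val m 2 \<le> int n)
      (\<lambda>m. completion_prob n ?K n * of_bool (val m 2 = int ?K)) (1 / real (card (pinj {1..int n})))" if "?P5 m'" for m' :: "'a mem"
  proof -
    have "ptriple M (n + 2) rank_loop m' (\<lambda>m. content m (Input, 0) = int n \<and> 0 \<le> val m 2 \<and> val m 2 \<le> int n)
      (\<lambda>m. of_bool (val m 2 = int ?K)) (rank_prob ?K n)" by (rule rank_loop[OF K]) (use that in auto)
    from ptriple_scale[OF this completion_prob_nonneg[of n ?K n]] show ?thesis
      by (rule ptriple_mono) (simp_all add: sample_prob[OF R, symmetric] mult.commute)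
  qed
  show ?thesis unfolding sample_def
    by (intro ptriple_Seq_det[OF 1] ptriple_Seq_det[OF 2] ptriple_Seq_det[OF 3] ptriple_Seq_det[OF 4] ptriple_Seq_det[OF 5] ptriple_Seq[OF 6] last)
qed

end

section \<open>Testing admissibility\<close>

primrec seqs :: "'a com list \<Rightarrow> 'a com" where
  "seqs [] = Skip"
| "seqs (c # cs) = Seq c (seqs cs)"

lemma writes_seqs: "writes (seqs cs) = (\<Union>c\<in>set cs. writes c)"
  by (induction cs) auto

lemma triple_seqs:
  assumes step: "\<And>x X m. x \<in> set xs \<Longrightarrow> J X m \<Longrightarrow> triple M f (c x) m (J (insert x X))"
    and "J X m"
  shows "triple M f (seqs (map c xs)) m (J (X \<union> set xs))"
  using assms
proof (induction xs arbitrary: X m)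
  case Nil
  then show ?case by (auto intro: ptriple_Skip)
next
  case (Cons x xs)
  have "triple M f (seqs (map c xs)) m' (J (insert x X \<union> set xs))" if "J (insert x X) m'" for m'
    by (rule Cons.IH[OF Cons.prems(1) that]) auto
  with Cons.prems show ?case by (auto intro!: triple_Seq[where ?Q1.0 = "J (insert x X)"])
qed

text \<open>
  In the test of admissibility variable 6 runs over the vertices, 13 flags a leaf, and 14 counts
  half-edges. The search uses the array 15 for visited vertices and the array 16 as a queue
  between the positions 17 (head) and 18 (tail); 19 is the current vertex.
\<close>

definition vertex_loop :: "'a com \<Rightarrow> 'a com" where
  "vertex_loop c = While (Lt (var 6) (Add size_exp (Lit 1))) (Seq c (incr 6))"

definition clear_array :: "'a name \<Rightarrow> 'a com" where
  "clear_array y = Seq (set_var 6 (Lit 1)) (vertex_loop (Assign y (var 6) (Lit 0)))"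

definition invert_array :: "'a name \<Rightarrow> 'a name \<Rightarrow> 'a com" where
  "invert_array x y = Seq (clear_array y) (Seq (set_var 6 (Lit 1))
     (vertex_loop (If (Eq (Cell x (var 6)) (Lit 0)) Skip (Assign y (Cell x (var 6)) (var 6)))))"

definition trim_check :: "'a name list \<Rightarrow> 'a com" where
  "trim_check L = Seq (set_var 13 (Lit 0)) (Seq (set_var 6 (Lit 2)) (vertex_loop
     (Seq (set_var 14 (Lit 0)) (Seq (seqs (map (\<lambda>x. If (Eq (Cell x (var 6)) (Lit 0)) Skip (incr 14)) L))
       (If (Lt (var 14) (Lit 2)) (set_var 13 (Lit 1)) Skip)))))"

definition visit :: "'a name \<Rightarrow> 'a com" where
  "visit x = If (Eq (Cell x (var 19)) (Lit 0)) Skip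
     (If (Eq (Cell (Work 15) (Cell x (var 19))) (Lit 0))
       (Seq (Assign (Work 15) (Cell x (var 19)) (Lit 1))
       (Seq (Assign (Work 16) (var 18) (Cell x (var 19))) (incr 18)))
       Skip)"

definition search_loop :: "'a name list \<Rightarrow> 'a com" where
  "search_loop L = While (Lt (var 17) (var 18))
     (Seq (set_var 19 (Cell (Work 16) (var 17))) (Seq (seqs (map visit L)) (incr 17)))"

definition search :: "'a name list \<Rightarrow> 'a com" where
  "search L = Seq (clear_array (Work 15)) (Seq (Assign (Work 15) (Lit 1) (Lit 1)) (Seq (Assign (Work 16) (Lit 0) (Lit 1))
     (Seq (set_var 17 (Lit 0)) (Seq (set_var 18 (Lit 1)) (search_loop L)))))"

context machine
begin

lemma vertex_loop:
  assumes start: "content m (Input, 0) = int n" "1 \<le> val m 6" "val m 6 \<le> int n + 1" "I m"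
    and body: "\<And>m. I m \<Longrightarrow> content m (Input, 0) = int n \<Longrightarrow> 1 \<le> val m 6 \<Longrightarrow> val m 6 \<le> int n \<Longrightarrow>
       triple M 1 c m (\<lambda>m'. content m' (Input, 0) = int n \<and> val m' 6 = val m 6 \<and> I (m'((Work 6, 0) \<mapsto> val m 6 + 1)))"
  shows "triple M (n + 2) (vertex_loop c) m (\<lambda>m'. I m' \<and> val m' 6 = int n + 1 \<and> content m' (Input, 0) = int n)"
proof -
  let ?I = "\<lambda>m. content m (Input, 0) = int n \<and> 1 \<le> val m 6 \<and> val m 6 \<le> int n + 1 \<and> I m"
  let ?b = "Lt (var 6) (Add size_exp (Lit 1))"
  have "triple M (n + 2) (vertex_loop c) m (\<lambda>m'. ?I m' \<and> \<not> eval_test m' ?b)"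
    unfolding vertex_loop_def
  proof (rule triple_While[where \<mu> = "\<lambda>m. nat (int n + 1 - val m 6)"])
    fix m :: "'a mem" assume I: "?I m"
    show "test_ok M m ?b" using I by (auto intro!: fits_small)
    assume "eval_test m ?b"
    with I have u: "val m 6 \<le> int n" by simp
    show "triple M 1 (Seq c (incr 6)) m (\<lambda>m'. ?I m' \<and> nat (int n + 1 - val m' 6) < nat (int n + 1 - val m 6))"
    proof (rule triple_Seq)
      show "triple M 1 c m (\<lambda>m'. content m' (Input, 0) = int n \<and> val m' 6 = val m 6 \<and> I (m'((Work 6, 0) \<mapsto> val m 6 + 1)))"
        by (rule body) (use I u in auto)
      fix m' :: "'a mem" assume m': "content m' (Input, 0) = int n \<and> val m' 6 = val m 6 \<and> I (m'((Work 6, 0) \<mapsto> val m 6 + 1))"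
      show "triple M 1 (incr 6) m' (\<lambda>m'. ?I m' \<and> nat (int n + 1 - val m' 6) < nat (int n + 1 - val m 6))"
        by (rule safe_triple) (use m' I u in \<open>auto intro!: fits_small\<close>)
    qed
  qed (use start in auto)
  then show ?thesis by (rule triple_mono) auto
qed

lemma fits_vertex: "0 \<le> x \<Longrightarrow> x \<le> int n + 2 \<Longrightarrow> fits M x"
  by (intro fits_small) auto

lemma fits01: "fits M 0" "fits M 1" "fits M 2"
  using n by (auto intro!: fits_vertex)

lemma clear_array:
  assumes "content m (Input, 0) = int n" "y \<noteq> Input" "y \<noteq> Work 6"
  shows "triple M (n + 2) (clear_array y) m (\<lambda>m. content m (Input, 0) = int n \<and> (\<forall>u\<in>{1..int n}. content m (y, u) = 0))"
  unfolding clear_array_def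
proof (rule triple_Seq)
  show "triple M (n + 2) (set_var 6 (Lit 1)) m (\<lambda>m. content m (Input, 0) = int n \<and> val m 6 = 1)"
    by (rule safe_triple) (use assms in \<open>auto simp: fits01\<close>)
  fix m' :: "'a mem" assume m': "content m' (Input, 0) = int n \<and> val m' 6 = 1"
  have "triple M (n + 2) (vertex_loop (Assign y (var 6) (Lit 0))) m'
    (\<lambda>m. (\<forall>u\<in>{1..<val m 6}. content m (y, u) = 0) \<and> val m 6 = int n + 1 \<and> content m (Input, 0) = int n)"
    by (rule vertex_loop, insert m', (auto)[4], rule safe_triple) (use assms in \<open>auto intro!: fits_vertex\<close>)
  then show "triple M (n + 2) (vertex_loop (Assign y (var 6) (Lit 0))) m'
     (\<lambda>m. content m (Input, 0) = int n \<and> (\<forall>u\<in>{1..int n}. content m (y, u) = 0))"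
    by (rule triple_mono) auto
qed

lemma invert_array:
  assumes m: "content m (Input, 0) = int n" "\<And>u. u \<in> {1..int n} \<Longrightarrow> content m (x, u) = g u"
    and g: "\<And>u. u \<in> {1..int n} \<Longrightarrow> 0 \<le> g u \<and> g u \<le> int n"
      "\<And>u u'. u \<in> {1..int n} \<Longrightarrow> u' \<in> {1..int n} \<Longrightarrow> g u = g u' \<Longrightarrow> g u \<noteq> 0 \<Longrightarrow> u = u'"
    and names: "y \<noteq> Input" "y \<noteq> Work 6" "x \<noteq> y" "x \<noteq> Work 6"
  shows "triple M (n + 2) (invert_array x y) m (\<lambda>m. content m (Input, 0) = int n \<and>
     (\<forall>v\<in>{1..int n}. 0 \<le> content m (y, v) \<and> content m (y, v) \<le> int n \<and> (\<forall>u\<in>{1..int n}. content m (y, v) = u \<longleftrightarrow> g u = v)))"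
  unfolding invert_array_def
proof (intro triple_Seq)
  let ?Q = "\<lambda>m. content m (Input, 0) = int n \<and> (\<forall>u\<in>{1..int n}. content m (y, u) = 0) \<and> (\<forall>u\<in>{1..int n}. content m (x, u) = g u)"
  have "writes (clear_array y) = {Work 6, y}" by (auto simp: clear_array_def vertex_loop_def)
  with ptriple_frame[OF clear_array[OF m(1) names(1,2)]] show "triple M (n + 2) (clear_array y) m ?Q"
    by (elim triple_mono) (use m(2) names in auto)
  fix m1 :: "'a mem" assume m1: "?Q m1"
  show "triple M (n + 2) (set_var 6 (Lit 1)) m1 (\<lambda>m. ?Q m \<and> val m 6 = 1)"
    by (rule safe_triple) (use m1 names in \<open>auto simp: fits01\<close>)
  fix m2 :: "'a mem" assume m2: "?Q m2 \<and> val m2 6 = 1"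
  let ?I = "\<lambda>m. (\<forall>u\<in>{1..int n}. content m (x, u) = g u) \<and>
    (\<forall>v\<in>{1..int n}. (content m (y, v) = 0 \<or> content m (y, v) \<in> {1..<val m 6}) \<and> (\<forall>u\<in>{1..<val m 6}. content m (y, v) = u \<longleftrightarrow> g u = v))"
  have "triple M (n + 2) (vertex_loop (If (Eq (Cell x (var 6)) (Lit 0)) Skip (Assign y (Cell x (var 6)) (var 6)))) m2
    (\<lambda>m. ?I m \<and> val m 6 = int n + 1 \<and> content m (Input, 0) = int n)"
  proof (rule vertex_loop)
    fix m :: "'a mem" assume I: "?I m" and b: "content m (Input, 0) = int n" "1 \<le> val m 6" "val m 6 \<le> int n"
    let ?u = "val m 6"
    have x: "content m (x, ?u) = g ?u" using I b by auto
    have rng: "{1..<?u + 1} = insert ?u {1..<?u}" using b by auto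
    have ne: "g u \<noteq> g ?u" if "u \<in> {1..<?u}" "g ?u \<noteq> 0" for u
    proof
      assume eq: "g u = g ?u"
      have u: "u \<in> {1..int n}" "?u \<in> {1..int n}" using that(1) b by simp_all
      have "g u \<noteq> 0" using that(2) unfolding eq .
      from g(2)[OF u eq this] that(1) show False by simp
    qed
    have lt: "u \<noteq> ?u" if "u \<in> {1..<?u}" for u using that by simp
    show "triple M 1 (If (Eq (Cell x (var 6)) (Lit 0)) Skip (Assign y (Cell x (var 6)) (var 6))) m
      (\<lambda>m'. content m' (Input, 0) = int n \<and> val m' 6 = val m 6 \<and> ?I (m'((Work 6, 0) \<mapsto> val m 6 + 1)))"
    proof (rule safe_triple)
      have fits: "fits M ?u" "fits M (g ?u)" "fits M 0" using b g(1)[of ?u] by (auto intro!: fits_vertex)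
      show "safe M (If (Eq (Cell x (var 6)) (Lit 0)) Skip (Assign y (Cell x (var 6)) (var 6)))
        (\<lambda>m'. content m' (Input, 0) = int n \<and> val m' 6 = val m 6 \<and> ?I (m'((Work 6, 0) \<mapsto> val m 6 + 1))) m"
      proof (cases "g ?u = 0")
        case True
        have "?I (m((Work 6, 0) \<mapsto> ?u + 1))"
        proof (intro conjI ballI)
          fix v assume v: "v \<in> {1..int n}"
          have y: "content m (y, v) = 0 \<or> content m (y, v) \<in> {1..<?u}" using I v by blast
          then show "content (m((Work 6, 0) \<mapsto> ?u + 1)) (y, v) = 0 \<or> content (m((Work 6, 0) \<mapsto> ?u + 1)) (y, v) \<in> {1..<val (m((Work 6, 0) \<mapsto> ?u + 1)) 6}"
            using names by auto
          fix u assume "u \<in> {1..<val (m((Work 6, 0) \<mapsto> ?u + 1)) 6}"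
          then have "u = ?u \<or> u \<in> {1..<?u}" by auto
          then show "(content (m((Work 6, 0) \<mapsto> ?u + 1)) (y, v) = u) = (g u = v)"
          proof
            assume u: "u = ?u"
            have "content m (y, v) \<noteq> ?u" using y b by auto
            moreover have "g ?u \<noteq> v" using True v by auto
            ultimately show ?thesis using u names by simp
          next
            assume "u \<in> {1..<?u}"
            then show ?thesis using I v names by auto
          qed
        qed (use I names in auto)
        then show ?thesis using b True fits x by simp
      next
        case False
        let ?m = "m((y, g ?u) \<mapsto> ?u, (Work 6, 0) \<mapsto> ?u + 1)"
        have "?I ?m"
        proof (intro conjI ballI)
          fix v assume v: "v \<in> {1..int n}"
          have y: "content m (y, v) = 0 \<or> content m (y, v) \<in> {1..<?u}" using I v by blast
          then show "content ?m (y, v) = 0 \<or> content ?m (y, v) \<in> {1..<val ?m 6}" using names b by auto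
          fix u assume "u \<in> {1..<val ?m 6}"
          then have "u = ?u \<or> u \<in> {1..<?u}" by auto
          then show "(content ?m (y, v) = u) = (g u = v)"
          proof
            assume u: "u = ?u"
            have "content m (y, v) \<noteq> ?u" using y b by auto
            then show ?thesis using u names by auto
          next
            assume u: "u \<in> {1..<?u}"
            have "(content m (y, v) = u) = (g u = v)" using I v u by blast
            then show ?thesis using ne[OF u False] lt[OF u] names by auto
          qed
        qed (use I names in auto)
        then show ?thesis using b False fits x names by simp
      qed
    qed simp
  qed (use m2 in auto)
  then show "triple M (n + 2) (vertex_loop (If (Eq (Cell x (var 6)) (Lit 0)) Skip (Assign y (Cell x (var 6)) (var 6)))) m2
    (\<lambda>m. content m (Input, 0) = int n \<and>
     (\<forall>v\<in>{1..int n}. 0 \<le> content m (y, v) \<and> content m (y, v) \<le> int n \<and> (\<forall>u\<in>{1..int n}. content m (y, v) = u \<longleftrightarrow> g u = v)))"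
  proof (rule triple_mono)
    fix m :: "'a mem" assume I: "?I m \<and> val m 6 = int n + 1 \<and> content m (Input, 0) = int n"
    then have eq: "{1..<val m 6} = {1..int n}" by auto
    show "content m (Input, 0) = int n \<and>
     (\<forall>v\<in>{1..int n}. 0 \<le> content m (y, v) \<and> content m (y, v) \<le> int n \<and> (\<forall>u\<in>{1..int n}. content m (y, v) = u \<longleftrightarrow> g u = v))"
    proof (intro conjI ballI)
      fix v assume v: "v \<in> {1..int n}"
      have "content m (y, v) = 0 \<or> content m (y, v) \<in> {1..int n}" using I v unfolding eq by blast
      then show "0 \<le> content m (y, v)" "content m (y, v) \<le> int n" by auto
      show "(content m (y, v) = u) = (g u = v)" if "u \<in> {1..int n}" for u using I v that unfolding eq by blast
    qed (use I in blast)
  qed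
qed

end

text \<open>
  The arrays in \<open>L\<close> list, for each letter and direction, the neighbours of the
  vertices. Their content \<open>nb\<close> does not change during the test; 0 stands for a
  missing neighbour.
\<close>

locale neighbours = machine +
  fixes L :: "'a name list" and nb :: "'a name \<Rightarrow> int \<Rightarrow> int"
  assumes L: "Input \<notin> set L" "\<And>k. k < 20 \<Longrightarrow> Work k \<notin> set L" "distinct L"
    and nb: "\<And>x u. x \<in> set L \<Longrightarrow> u \<in> {1..int n} \<Longrightarrow> 0 \<le> nb x u \<and> nb x u \<le> int n"
begin

definition loaded :: "'a mem \<Rightarrow> bool" where
  "loaded m \<longleftrightarrow> content m (Input, 0) = int n \<and> (\<forall>x\<in>set L. \<forall>u\<in>{1..int n}. content m (x, u) = nb x u)"

lemma L_neq: "x \<in> set L \<Longrightarrow> x \<noteq> Input \<and> (\<forall>k<20. x \<noteq> Work k)"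
  using L by metis

lemma loaded_upd: "loaded m \<Longrightarrow> k < 20 \<Longrightarrow> loaded (m((Work k, i) \<mapsto> v))"
  using L_neq by (auto simp: loaded_def)

definition degree :: "int \<Rightarrow> nat" where
  "degree u = card {x \<in> set L. nb x u \<noteq> 0}"

lemma trim_check:
  assumes m: "loaded m" and long: "int (length L) \<le> K" "fits M K"
  shows "triple M (n + 2) (trim_check L) m (\<lambda>m. loaded m \<and> (val m 13 = 0 \<longleftrightarrow> (\<forall>w\<in>{2..int n}. 2 \<le> degree w)) \<and> val m 13 \<in> {0, 1})"
  unfolding trim_check_def
proof (intro triple_Seq)
  let ?Q1 = "\<lambda>m. loaded m \<and> val m 13 = 0"
  show "triple M (n + 2) (set_var 13 (Lit 0)) m ?Q1"
    by (rule safe_triple) (use m in \<open>auto simp: fits01 loaded_upd\<close>)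
  fix m1 :: "'a mem" assume m1: "?Q1 m1"
  show "triple M (n + 2) (set_var 6 (Lit 2)) m1 (\<lambda>m. ?Q1 m \<and> val m 6 = 2)"
    by (rule safe_triple) (use m1 in \<open>auto simp: fits01 loaded_upd\<close>)
  fix m2 :: "'a mem" assume m2: "?Q1 m2 \<and> val m2 6 = 2"
  let ?I = "\<lambda>m. loaded m \<and> 2 \<le> val m 6 \<and> (val m 13 = 0 \<longleftrightarrow> (\<forall>w\<in>{2..<val m 6}. 2 \<le> degree w)) \<and> val m 13 \<in> {0, 1}"
  let ?inc = "\<lambda>x. If (Eq (Cell x (var 6)) (Lit 0)) Skip (incr 14)"
  have "triple M (n + 2) (vertex_loop (Seq (set_var 14 (Lit 0)) (Seq (seqs (map ?inc L)) (If (Lt (var 14) (Lit 2)) (set_var 13 (Lit 1)) Skip)))) m2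
    (\<lambda>m. ?I m \<and> val m 6 = int n + 1 \<and> content m (Input, 0) = int n)"
  proof (rule vertex_loop)
    show "val m2 6 \<le> int n + 1" using m2 n by simp
    show "?I m2" using m2 by auto
    fix m :: "'a mem" assume I: "?I m" and b: "1 \<le> val m 6" "val m 6 \<le> int n"
    let ?u = "val m 6" and ?v = "val m 13"
    define J where "J X m' \<longleftrightarrow> loaded m' \<and> val m' 6 = ?u \<and> val m' 13 = ?v \<and> X \<subseteq> set L \<and> val m' 14 = int (card {x \<in> X. nb x ?u \<noteq> 0})" for X and m' :: "'a mem"
    have fits: "fits M ?u" using b by (intro fits_vertex) auto
    have inc: "triple M 1 (seqs (map ?inc L)) m' (J (set L))" if J: "J {} m'" for m'
    proof -
      have "triple M 1 (seqs (map ?inc xs)) m' (J (X \<union> set xs))" if "distinct xs" "set xs \<subseteq> set L" "X \<inter> set xs = {}" "J X m'" for xs X m'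
        using that
      proof (induction xs arbitrary: X m')
        case Nil
        then show ?case by (auto intro: ptriple_Skip)
      next
        case (Cons x xs)
        have x: "x \<in> set L" "x \<notin> X" using Cons.prems by auto
        have fX: "finite X" using Cons.prems(4) finite_subset unfolding J_def by blast
        have c: "content m' (x, ?u) = nb x ?u" using Cons.prems(4) x(1) b unfolding J_def loaded_def by auto
        have cd: "card {z \<in> insert x X. nb z ?u \<noteq> 0} = (if nb x ?u = 0 then 0 else 1) + card {z \<in> X. nb z ?u \<noteq> 0}"
        proof (cases "nb x ?u = 0")
          case True
          then have "{z \<in> insert x X. nb z ?u \<noteq> 0} = {z \<in> X. nb z ?u \<noteq> 0}" by auto
          then show ?thesis using True by simp
        next
          case False
          then have "{z \<in> insert x X. nb z ?u \<noteq> 0} = insert x {z \<in> X. nb z ?u \<noteq> 0}" by auto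
          then show ?thesis using False fX x(2) by simp
        qed
        have "card {z \<in> insert x X. nb z ?u \<noteq> 0} \<le> card (set L)"
          using Cons.prems(4) x(1) by (intro card_mono) (auto simp: J_def)
        then have "card {z \<in> insert x X. nb z ?u \<noteq> 0} \<le> length L" using card_length[of L] by linarith
        then have f14: "fits M (int (card {z \<in> insert x X. nb z ?u \<noteq> 0}))" "fits M (int (card {z \<in> X. nb z ?u \<noteq> 0}))"
          using long cd unfolding fits_def by (auto split: if_splits)
        have fx: "fits M (nb x ?u)" using nb[OF x(1), of ?u] b by (intro fits_vertex) auto
        have 1: "triple M 1 (?inc x) m' (J (insert x X))"
        proof (rule safe_triple)
          show "safe M (?inc x) (J (insert x X)) m'"
          proof (cases "nb x ?u = 0")
            case True
            then show ?thesis using Cons.prems(4) c cd fits fits01 x(1) by (auto simp: J_def)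
          next
            case False
            then show ?thesis using Cons.prems(4) c cd fits fits01 fx f14 x(1) by (auto simp: J_def loaded_upd add.commute)
          qed
        qed simp
        have "triple M 1 (seqs (map ?inc xs)) m'' (J (insert x X \<union> set xs))" if "J (insert x X) m''" for m''
          by (rule Cons.IH) (use Cons.prems that in auto)
        with 1 show ?case by (auto intro!: triple_Seq[where ?Q1.0 = "J (insert x X)"])
      qed
      from this[of L "{}"] J L(3) show ?thesis by simp
    qed
    show "triple M 1 (Seq (set_var 14 (Lit 0)) (Seq (seqs (map ?inc L)) (If (Lt (var 14) (Lit 2)) (set_var 13 (Lit 1)) Skip))) m
      (\<lambda>m'. content m' (Input, 0) = int n \<and> val m' 6 = val m 6 \<and> ?I (m'((Work 6, 0) \<mapsto> val m 6 + 1)))"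
    proof (intro triple_Seq)
      show "triple M 1 (set_var 14 (Lit 0)) m (J {})"
        by (rule safe_triple) (use I in \<open>auto simp: J_def fits01 loaded_upd\<close>)
      show "triple M 1 (seqs (map ?inc L)) m' (J (set L))" if "J {} m'" for m' by (rule inc[OF that])
      fix m' assume J: "J (set L) m'"
      have d: "val m' 14 = int (degree ?u)" using J by (simp add: J_def degree_def)
      have "fits M (val m' 14)"
        using J long card_length[of L] card_mono[of "set L" "{x \<in> set L. nb x ?u \<noteq> 0}"]
        unfolding J_def fits_def by auto
      moreover have rng: "{2..<?u + 1} = insert ?u {2..<?u}" using I by auto
      ultimately show "triple M 1 (If (Lt (var 14) (Lit 2)) (set_var 13 (Lit 1)) Skip) m'
        (\<lambda>m'. content m' (Input, 0) = int n \<and> val m' 6 = val m 6 \<and> ?I (m'((Work 6, 0) \<mapsto> val m 6 + 1)))"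
        using J I d by (intro safe_triple) (auto simp: J_def fits01 loaded_upd rng, auto simp: loaded_def)
    qed
  qed (use m2 in \<open>auto simp: loaded_def\<close>)
  then show "triple M (n + 2) (vertex_loop (Seq (set_var 14 (Lit 0)) (Seq (seqs (map ?inc L)) (If (Lt (var 14) (Lit 2)) (set_var 13 (Lit 1)) Skip)))) m2
    (\<lambda>m. loaded m \<and> (val m 13 = 0 \<longleftrightarrow> (\<forall>w\<in>{2..int n}. 2 \<le> degree w)) \<and> val m 13 \<in> {0, 1})"
  proof (rule triple_mono)
    fix m :: "'a mem" assume I: "?I m \<and> val m 6 = int n + 1 \<and> content m (Input, 0) = int n"
    then have "{2..<val m 6} = {2..int n}" by auto
    with I show "loaded m \<and> (val m 13 = 0 \<longleftrightarrow> (\<forall>w\<in>{2..int n}. 2 \<le> degree w)) \<and> val m 13 \<in> {0, 1}" by auto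
  qed
qed

end

context neighbours
begin

definition adj :: "(int \<times> int) set" where
  "adj = {(u, v). u \<in> {1..int n} \<and> v \<noteq> 0 \<and> (\<exists>x\<in>set L. nb x u = v)}"

abbreviation queue :: "'a mem \<Rightarrow> int set" where
  "queue m \<equiv> (\<lambda>i. content m (Work 16, i)) ` {0..<val m 18}"

text \<open>
  Position by position the queue never changes once filled, so it also serves as the list of
  visited vertices; those before the head have all their neighbours in it.
\<close>

definition search_inv :: "'a mem \<Rightarrow> bool" where
  "search_inv m \<longleftrightarrow> loaded m \<and> 0 \<le> val m 17 \<and> val m 17 \<le> val m 18 \<and>
     inj_on (\<lambda>i. content m (Work 16, i)) {0..<val m 18} \<and> queue m \<subseteq> {1..int n} \<and> 1 \<in> queue m \<and>
     (\<forall>v\<in>{1..int n}. content m (Work 15, v) = of_bool (v \<in> queue m)) \<and> queue m \<subseteq> adj\<^sup>* `` {1} \<and>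
     (\<forall>i\<in>{0..<val m 17}. \<forall>x\<in>set L. nb x (content m (Work 16, i)) \<noteq> 0 \<longrightarrow> nb x (content m (Work 16, i)) \<in> queue m)"

lemma search_inv_card: "search_inv m \<Longrightarrow> int (card (queue m)) = val m 18 \<and> val m 18 \<le> int n"
proof -
  assume I: "search_inv m"
  then have "card (queue m) = card {0..<val m 18}" by (intro card_image) (simp add: search_inv_def)
  moreover have "card (queue m) \<le> card {1..int n}" using I by (intro card_mono) (auto simp: search_inv_def)
  ultimately show ?thesis using I by (simp add: search_inv_def)
qed

definition visit_inv :: "int \<Rightarrow> 'a name set \<Rightarrow> 'a mem \<Rightarrow> bool" where
  "visit_inv h X m \<longleftrightarrow> search_inv m \<and> val m 17 = h \<and> h < val m 18 \<and> val m 19 = content m (Work 16, h) \<and>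
     (\<forall>x\<in>X. nb x (val m 19) \<noteq> 0 \<longrightarrow> nb x (val m 19) \<in> queue m)"

lemma visit_push:
  assumes J: "visit_inv h X m" and x: "x \<in> set L" and v: "v = nb x (val m 19)" "v \<noteq> 0" "v \<notin> queue m"
  shows "visit_inv h (insert x X) (m((Work 15, v) \<mapsto> 1, (Work 16, val m 18) \<mapsto> v, (Work 18, 0) \<mapsto> val m 18 + 1))"
    (is "visit_inv h _ ?m")
proof -
  let ?t = "val m 18" and ?Q = "\<lambda>i. content m (Work 16, i)"
  have I: "search_inv m" and h: "val m 17 = h" "h < ?t" "val m 19 = ?Q h" using J by (auto simp: visit_inv_def)
  have h0: "0 \<le> h" using I h by (auto simp: search_inv_def)
  have V: "val ?m 18 = ?t + 1" "val ?m 17 = h" "val ?m 19 = val m 19" using h by auto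
  have Q': "(\<lambda>i. content ?m (Work 16, i)) = ?Q(?t := v)" by (auto simp: fun_eq_iff)
  have Qi: "content ?m (Work 16, i) = (if i = ?t then v else ?Q i)" for i by simp
  have rng: "{0..<?t + 1} = insert ?t {0..<?t}" using h h0 by auto
  have q: "(\<lambda>i. content ?m (Work 16, i)) ` {0..<?t + 1} = insert v (queue m)" unfolding Q' rng by auto
  have uq: "val m 19 \<in> queue m" using h h0 by auto
  then have uV: "val m 19 \<in> {1..int n}" using I by (auto simp: search_inv_def)
  have vV: "v \<in> {1..int n}" using nb[OF x uV] v by auto
  have "(val m 19, v) \<in> adj" using uV v x by (auto simp: adj_def)
  moreover have "val m 19 \<in> adj\<^sup>* `` {1}" using uq I by (auto simp: search_inv_def)
  ultimately have vR: "v \<in> adj\<^sup>* `` {1}" by (auto intro: rtrancl_into_rtrancl)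
  have "inj_on (?Q(?t := v)) {0..<?t + 1}"
  proof -
    have "inj_on ?Q {0..<?t}" using I by (simp add: search_inv_def)
    then have "inj_on (?Q(?t := v)) {0..<?t}" by (rule inj_on_cong[THEN iffD1, rotated]) auto
    moreover have "(?Q(?t := v)) ` ({0..<?t} - {?t}) = queue m" by (intro image_cong) auto
    ultimately show ?thesis unfolding rng using v(3) by simp
  qed
  then have inj: "inj_on (\<lambda>i. content ?m (Work 16, i)) {0..<?t + 1}" unfolding Q' .
  have "search_inv ?m"
    unfolding search_inv_def V q
  proof (intro conjI ballI impI)
    show "loaded ?m" using I by (simp add: loaded_upd search_inv_def)
    show "insert v (queue m) \<subseteq> {1..int n}" using I vV by (simp add: search_inv_def)
    show "insert v (queue m) \<subseteq> adj\<^sup>* `` {1}" using I vR by (simp add: search_inv_def)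
    show "1 \<in> insert v (queue m)" using I by (simp add: search_inv_def)
    show "content ?m (Work 15, w) = of_bool (w \<in> insert v (queue m))" if "w \<in> {1..int n}" for w
      using I that by (simp add: search_inv_def)
    show "nb z (content ?m (Work 16, i)) \<in> insert v (queue m)"
      if "i \<in> {0..<h}" "z \<in> set L" "nb z (content ?m (Work 16, i)) \<noteq> 0" for i z
    proof -
      have "i \<noteq> ?t" using that h by auto
      then have "content ?m (Work 16, i) = ?Q i" by simp
      then show ?thesis using I that h(1) by (simp add: search_inv_def)
    qed
  qed (use inj h h0 in auto)
  moreover have "\<forall>z\<in>insert x X. nb z (val m 19) \<noteq> 0 \<longrightarrow> nb z (val m 19) \<in> insert v (queue m)"
    using J v by (auto simp: visit_inv_def)
  moreover have "val m 19 = content ?m (Work 16, h)" using h by simp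
  ultimately show ?thesis unfolding visit_inv_def V q using h by simp
qed

lemma visit_step:
  assumes J: "visit_inv h X m" and x: "x \<in> set L"
  shows "triple M 1 (visit x) m (visit_inv h (insert x X))"
proof -
  let ?u = "val m 19"
  have I: "search_inv m" and h: "val m 17 = h" "h < val m 18" "?u = content m (Work 16, h)" "0 \<le> h"
    using J by (auto simp: visit_inv_def search_inv_def)
  have "?u \<in> queue m" using h by auto
  then have u: "?u \<in> {1..int n}" using I by (auto simp: search_inv_def)
  have c: "content m (x, ?u) = nb x ?u" using I x u by (auto simp: search_inv_def loaded_def)
  have neq: "x \<noteq> Work 15" "x \<noteq> Work 16" "x \<noteq> Work 18" using L_neq[OF x] by auto
  have t: "0 \<le> val m 18" "val m 18 \<le> int n" using search_inv_card[OF I] by auto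
  have nbx: "0 \<le> nb x ?u" "nb x ?u \<le> int n" using nb[OF x u] by auto
  have vis: "content m (Work 15, nb x ?u) = of_bool (nb x ?u \<in> queue m)" if "nb x ?u \<noteq> 0"
    using I nbx that by (auto simp: search_inv_def)
  have same: "visit_inv h (insert x X) m" if "nb x ?u = 0 \<or> nb x ?u \<in> queue m"
    using J that by (auto simp: visit_inv_def)
  have fits: "fits M ?u" "fits M (nb x ?u)" "fits M (val m 18)" "fits M (val m 18 + 1)" "fits M (of_bool b)" for b
    using u t nbx by (auto intro!: fits_vertex)
  show ?thesis
  proof (rule safe_triple)
    show "safe M (visit x) (visit_inv h (insert x X)) m"
    proof (cases "nb x ?u = 0")
      case True
      then show ?thesis using same c fits fits01 by (simp add: visit_def)
    next
      case nz: False
      show ?thesis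
      proof (cases "nb x ?u \<in> queue m")
        case True
        then show ?thesis using same c fits fits01 vis[OF nz] nz by (simp add: visit_def)
      next
        case False
        from visit_push[OF J x refl nz False]
        show ?thesis using c fits fits01 vis[OF nz] nz False neq by (simp add: visit_def)
      qed
    qed
  qed simp
qed

lemma search_loop:
  assumes I: "search_inv m"
  shows "triple M (n + 2) (search_loop L) m (\<lambda>m. loaded m \<and> val m 18 = int (card (adj\<^sup>* `` {1})))"
proof -
  let ?b = "Lt (var 17) (var 18)"
  have "triple M (n + 2) (search_loop L) m (\<lambda>m'. search_inv m' \<and> \<not> eval_test m' ?b)"
    unfolding search_loop_def
  proof (rule triple_While[where \<mu> = "\<lambda>m. nat (int n - val m 17)"])
    fix m :: "'a mem" assume I: "search_inv m"
    then have h: "0 \<le> val m 17" "val m 17 \<le> val m 18" "val m 18 \<le> int n" using search_inv_card[OF I] by (auto simp: search_inv_def)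
    show "test_ok M m ?b" using h by (auto intro!: fits_vertex)
    assume b: "eval_test m ?b"
    let ?h = "val m 17"
    have hq: "content m (Work 16, ?h) \<in> queue m" using b h by auto
    then have hV: "content m (Work 16, ?h) \<in> {1..int n}" using I by (auto simp: search_inv_def)
    show "triple M 1 (Seq (set_var 19 (Cell (Work 16) (var 17))) (Seq (seqs (map visit L)) (incr 17))) m
      (\<lambda>m'. search_inv m' \<and> nat (int n - val m' 17) < nat (int n - val m 17))"
    proof (intro triple_Seq)
      show "triple M 1 (set_var 19 (Cell (Work 16) (var 17))) m (visit_inv ?h {})"
      proof (rule safe_triple)
        let ?m = "m((Work 19, 0) \<mapsto> content m (Work 16, ?h))"
        have "search_inv ?m" using I by (simp add: search_inv_def loaded_upd)
        then have "visit_inv ?h {} ?m" using b by (simp add: visit_inv_def)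
        then show "safe M (set_var 19 (Cell (Work 16) (var 17))) (visit_inv ?h {}) m"
          using h hV by (auto intro!: fits_vertex)
      qed simp
      fix m1 :: "'a mem" assume m1: "visit_inv ?h {} m1"
      have "triple M 1 (seqs (map visit L)) m1 (visit_inv ?h ({} \<union> set L))"
        by (rule triple_seqs[where J = "visit_inv ?h"]) (use m1 visit_step in auto)
      then show "triple M 1 (seqs (map visit L)) m1 (visit_inv ?h (set L))" by simp
      fix m2 :: "'a mem" assume m2: "visit_inv ?h (set L) m2"
      then have I2: "search_inv m2" and v: "val m2 17 = ?h" "?h < val m2 18" "val m2 19 = content m2 (Work 16, ?h)"
        and all: "\<forall>x\<in>set L. nb x (val m2 19) \<noteq> 0 \<longrightarrow> nb x (val m2 19) \<in> queue m2"
        by (auto simp: visit_inv_def)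
      have t: "val m2 18 \<le> int n" using search_inv_card[OF I2] by simp
      let ?m = "m2((Work 17, 0) \<mapsto> ?h + 1)"
      have rng: "{0..<?h + 1} = insert ?h {0..<?h}" using h by auto
      have "search_inv ?m"
        using I2 v all unfolding search_inv_def by (simp add: rng loaded_upd)
      then show "triple M 1 (incr 17) m2 (\<lambda>m'. search_inv m' \<and> nat (int n - val m' 17) < nat (int n - val m 17))"
        using v t h by (intro safe_triple) (auto intro!: fits_vertex simp: fits01)
    qed
  qed (use I in \<open>auto simp: search_inv_def\<close>)
  then show ?thesis
  proof (rule triple_mono)
    fix m' :: "'a mem" assume m': "search_inv m' \<and> \<not> eval_test m' ?b"
    then have I: "search_inv m'" and ht: "val m' 17 = val m' 18" by (auto simp: search_inv_def)
    have closed: "v \<in> queue m'" if uv: "u \<in> queue m'" "(u, v) \<in> adj" for u v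
    proof -
      from uv(1) obtain i where i: "u = content m' (Work 16, i)" "i \<in> {0..<val m' 18}" by (rule imageE)
      obtain x where "x \<in> set L" "nb x u = v" "v \<noteq> 0" using uv(2) by (auto simp: adj_def)
      then show ?thesis using I i ht unfolding search_inv_def by auto
    qed
    have "v \<in> queue m'" if "(1, v) \<in> adj\<^sup>*" for v
      using that by (induction rule: rtrancl_induct) (use I closed in \<open>auto simp: search_inv_def\<close>)
    then have "queue m' = adj\<^sup>* `` {1}" using I unfolding search_inv_def by blast
    with search_inv_card[OF I] I show "loaded m' \<and> val m' 18 = int (card (adj\<^sup>* `` {1}))" by (simp add: search_inv_def)
  qed
qed

lemma search:
  assumes m: "loaded m"
  shows "triple M (n + 2) (search L) m (\<lambda>m. loaded m \<and> val m 18 = int (card (adj\<^sup>* `` {1})))"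
  unfolding search_def
proof (intro triple_Seq)
  let ?Q = "\<lambda>m. loaded m \<and> (\<forall>u\<in>{1..int n}. content m (Work 15, u) = 0)"
  have "content m (Input, 0) = int n" using m by (simp add: loaded_def)
  from ptriple_frame[OF clear_array[OF this, of "Work 15"]]
  show "triple M (n + 2) (clear_array (Work 15)) m ?Q"
  proof (rule triple_mono)
    fix m' :: "'a mem"
    assume "(content m' (Input, 0) = int n \<and> (\<forall>u\<in>{1..int n}. content m' (Work 15, u) = 0)) \<and>
       (\<forall>x i. x \<notin> writes (clear_array (Work 15) :: 'a com) \<longrightarrow> content m' (x, i) = content m (x, i))"
    moreover have "x \<notin> writes (clear_array (Work 15) :: 'a com)" if "x \<in> set L" for x
      using L_neq[OF that] by (auto simp: clear_array_def vertex_loop_def)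
    ultimately show "?Q m'" using m by (simp add: loaded_def)
  qed auto
  let ?Q1 = "\<lambda>m. loaded m \<and> (\<forall>u\<in>{1..int n}. content m (Work 15, u) = of_bool (u = 1))"
  let ?Q2 = "\<lambda>m. ?Q1 m \<and> content m (Work 16, 0) = 1"
  fix m1 :: "'a mem" assume m1: "?Q m1"
  show "triple M (n + 2) (Assign (Work 15) (Lit 1) (Lit 1)) m1 ?Q1"
    by (rule safe_triple) (use m1 in \<open>auto simp: fits01 loaded_upd\<close>)
  fix m2 :: "'a mem" assume m2: "?Q1 m2"
  show "triple M (n + 2) (Assign (Work 16) (Lit 0) (Lit 1)) m2 ?Q2"
    by (rule safe_triple) (use m2 in \<open>auto simp: fits01 loaded_upd\<close>)
  fix m3 :: "'a mem" assume m3: "?Q2 m3"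
  show "triple M (n + 2) (set_var 17 (Lit 0)) m3 (\<lambda>m. ?Q2 m \<and> val m 17 = 0)"
    by (rule safe_triple) (use m3 in \<open>auto simp: fits01 loaded_upd\<close>)
  fix m4 :: "'a mem" assume m4: "?Q2 m4 \<and> val m4 17 = 0"
  show "triple M (n + 2) (set_var 18 (Lit 1)) m4 (\<lambda>m. (?Q2 m \<and> val m 17 = 0) \<and> val m 18 = 1)"
    by (rule safe_triple) (use m4 in \<open>auto simp: fits01 loaded_upd\<close>)
  fix m5 :: "'a mem" assume m5: "(?Q2 m5 \<and> val m5 17 = 0) \<and> val m5 18 = 1"
  have "{0..<1::int} = {0}" by auto
  then have q: "queue m5 = {1}" using m5 by simp
  have "{0..<val m5 18} = {0}" using m5 by auto
  then have "inj_on (\<lambda>i. content m5 (Work 16, i)) {0..<val m5 18}" by simp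
  then have "search_inv m5" unfolding search_inv_def q using m5 n by auto
  then show "triple M (n + 2) (search_loop L) m5 (\<lambda>m. loaded m \<and> val m 18 = int (card (adj\<^sup>* `` {1})))"
    by (rule search_loop)
qed

end

text \<open>
  The arrays below 20 are in use by other parts of the program.
\<close>

definition inverse_array :: "('a \<Rightarrow> nat) \<Rightarrow> 'a \<Rightarrow> 'a name" where
  "inverse_array idx a = Work (20 + idx a)"

definition half_edge_arrays :: "('a \<Rightarrow> nat) \<Rightarrow> 'a list \<Rightarrow> 'a name list" where
  "half_edge_arrays idx as = map Edge as @ map (inverse_array idx) as"

definition attempt :: "('a \<Rightarrow> nat) \<Rightarrow> 'a list \<Rightarrow> 'a com" where
  "attempt idx as = Seq (seqs (map sample as))
     (Seq (seqs (map (\<lambda>a. invert_array (Edge a) (inverse_array idx a)) as))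
     (Seq (trim_check (half_edge_arrays idx as))
     (Seq (search (half_edge_arrays idx as))
       (If (Eq (var 18) size_exp) (If (Eq (var 13) (Lit 0)) (set_var 10 (Lit 1)) Skip) Skip))))"

lemma writes_sample: "writes (sample a) \<subseteq> insert (Edge a) (Work ` {..<20})"
  by (auto simp: sample_def table_loop_def rank_loop_def pool_loop_def edge_loop_def)

lemma done_not_written: "Work 10 \<notin> writes (sample a)"
  by (simp add: sample_def table_loop_def rank_loop_def pool_loop_def edge_loop_def)

lemma writes_invert: "writes (invert_array x y) = {Work 6, y}"
  by (auto simp: invert_array_def clear_array_def vertex_loop_def)

lemma writes_trim: "writes (trim_check L) \<subseteq> {Work 6, Work 13, Work 14}"
  by (auto simp: trim_check_def vertex_loop_def writes_seqs)

lemma writes_search: "writes (search L) \<subseteq> {Work 6, Work 15, Work 16, Work 17, Work 18, Work 19}"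
  by (auto simp: search_def search_loop_def clear_array_def vertex_loop_def writes_seqs visit_def)

lemma out_rel_cong: "(\<And>u. content m (Edge a, u) = content m' (Edge a, u)) \<Longrightarrow> out_rel n a m = out_rel n a m'"
  by (simp add: out_rel_def)

context machine
begin

text \<open>
  The letters are sampled independently, since sampling one letter does not touch the array of
  another one.
\<close>

lemma sample_all:
  assumes "distinct as" "\<And>a. a \<in> set as \<Longrightarrow> R a \<in> pinj {1..int n}" "content m (Input, 0) = int n"
  shows "ptriple M (n + 2) (seqs (map sample as)) m (\<lambda>m. content m (Input, 0) = int n \<and> (\<forall>a\<in>set as. sampled a m))
    (\<lambda>m. of_bool (\<forall>a\<in>set as. out_rel n a m = R a)) ((1 / real (card (pinj {1..int n}))) ^ length as)"
  using assms
proof (induction as arbitrary: m)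
  case Nil
  then show ?case by (auto intro: ptriple_Skip)
next
  case (Cons a as)
  let ?c = "1 / real (card (pinj {1..int n}))"
  let ?rest = "seqs (map sample as)"
  have w: "Edge a \<notin> writes ?rest" using Cons.prems(1) writes_sample by (force simp: writes_seqs)
  have first: "ptriple M (n + 2) (sample a) m (sampled a) (\<lambda>m. ?c ^ length as * of_bool (out_rel n a m = R a)) (?c ^ length as * ?c)"
    by (rule ptriple_scale[OF sample]) (use Cons.prems in auto)
  have rest: "ptriple M (n + 2) ?rest m' (\<lambda>m. content m (Input, 0) = int n \<and> (\<forall>a\<in>set (a # as). sampled a m))
     (\<lambda>m. of_bool (\<forall>a\<in>set (a # as). out_rel n a m = R a)) (?c ^ length as * of_bool (out_rel n a m' = R a))"
    if s: "sampled a m'" for m' :: "'a mem"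
  proof -
    have "content m' (Input, 0) = int n" using s by (simp add: sampled_def)
    from ptriple_scale[OF ptriple_frame[OF Cons.IH[OF _ _ this]], of "of_bool (out_rel n a m' = R a)"] Cons.prems
    have "ptriple M (n + 2) ?rest m' (\<lambda>m. (content m (Input, 0) = int n \<and> (\<forall>a\<in>set as. sampled a m)) \<and>
        (\<forall>x i. x \<notin> writes ?rest \<longrightarrow> content m (x, i) = content m' (x, i)))
      (\<lambda>m. of_bool (out_rel n a m' = R a) * of_bool (\<forall>a\<in>set as. out_rel n a m = R a)) (of_bool (out_rel n a m' = R a) * ?c ^ length as)"
      by simp
    then show ?thesis
    proof (rule ptriple_mono)
      fix m1 :: "'a mem"
      assume m1: "(content m1 (Input, 0) = int n \<and> (\<forall>a\<in>set as. sampled a m1)) \<and>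
        (\<forall>x i. x \<notin> writes ?rest \<longrightarrow> content m1 (x, i) = content m' (x, i))"
      then have e: "content m1 (Edge a, u) = content m' (Edge a, u)" for u using w by blast
      have o: "out_rel n a m1 = out_rel n a m'" by (rule out_rel_cong) (rule e)
      show "content m1 (Input, 0) = int n \<and> (\<forall>a\<in>set (a # as). sampled a m1)"
        using m1 s e o by (simp add: sampled_def)
      show "of_bool (out_rel n a m' = R a) * of_bool (\<forall>a\<in>set as. out_rel n a m1 = R a) \<le> (of_bool (\<forall>a\<in>set (a # as). out_rel n a m1 = R a) :: real)"
        using o by simp
    qed simp_all
  qed
  show ?case
    using ptriple_Seq[OF first rest] by (simp add: mult.commute)
qed

lemma output_graph_rel: "a \<in> A \<Longrightarrow> edge_rel (snd (output_graph A n m)) a = out_rel n a m"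
  by (auto simp: edge_rel_def output_graph_def out_rel_def)

lemma output_graph_graphs:
  assumes "\<And>a. a \<in> A \<Longrightarrow> out_rel n a m \<in> pinj {1..int n}"
  shows "snd (output_graph A n m) \<in> graphs A {1..int n}"
proof -
  have "u = u'" if "a \<in> A" "u \<in> {1..int n}" "u' \<in> {1..int n}" "v \<in> {1..int n}" "content m (Edge a, u) = v" "content m (Edge a, u') = v" for a u u' v
  proof -
    have "(u, v) \<in> out_rel n a m" "(u', v) \<in> out_rel n a m" using that by (auto simp: out_rel_def)
    with assms[OF that(1)] show ?thesis unfolding pinj_def single_valued_def by blast
  qed
  then show ?thesis unfolding graphs_def A_graph_def output_graph_def by auto
qed

lemma output_graph_eq:
  assumes "E \<in> graphs A {1..int n}" "\<And>a. a \<in> A \<Longrightarrow> out_rel n a m \<in> pinj {1..int n}"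
  shows "snd (output_graph A n m) = E \<longleftrightarrow> (\<forall>a\<in>A. out_rel n a m = edge_rel E a)"
  using graphs_eqI[OF output_graph_graphs[OF assms(2)] assms(1)] output_graph_rel by metis

definition half_edge_array :: "('a \<Rightarrow> nat) \<Rightarrow> 'a \<times> bool \<Rightarrow> 'a name" where
  "half_edge_array idx y = (if snd y then Edge (fst y) else inverse_array idx (fst y))"

definition inverted :: "('a \<Rightarrow> nat) \<Rightarrow> 'a set \<Rightarrow> 'a mem \<Rightarrow> bool" where
  "inverted idx X m \<longleftrightarrow> (\<forall>a\<in>X. \<forall>v\<in>{1..int n}. 0 \<le> content m (inverse_array idx a, v) \<and> content m (inverse_array idx a, v) \<le> int n \<and>
     (\<forall>u\<in>{1..int n}. content m (inverse_array idx a, v) = u \<longleftrightarrow> content m (Edge a, u) = v))"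

lemma set_half_edge_arrays: "set (half_edge_arrays idx as) = half_edge_array idx ` (set as \<times> UNIV)"
proof -
  have eq: "set as \<times> UNIV = (\<lambda>a. (a, True)) ` set as \<union> (\<lambda>a. (a, False)) ` set as" by auto
  show ?thesis unfolding eq image_Un image_image half_edge_array_def by (simp add: half_edge_arrays_def)
qed

lemma inj_half_edge_array:
  assumes "inj_on idx A" shows "inj_on (half_edge_array idx) (A \<times> UNIV)"
proof (rule inj_onI)
  fix x y assume "x \<in> A \<times> UNIV" "y \<in> A \<times> UNIV" "half_edge_array idx x = half_edge_array idx y"
  then show "x = y"
    using assms by (cases x; cases y) (auto simp: half_edge_array_def inverse_array_def split: if_splits dest: inj_onD)
qed

lemma half_edge_array_hop:
  assumes s: "\<forall>a\<in>A. sampled a m" and inv: "inverted idx A m" and y: "fst y \<in> A" and u: "u \<in> {1..int n}"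
  shows "0 \<le> content m (half_edge_array idx y, u) \<and> content m (half_edge_array idx y, u) \<le> int n"
    and "v \<noteq> 0 \<Longrightarrow> content m (half_edge_array idx y, u) = v \<longleftrightarrow> hop (output_graph A n m) u y v"
proof -
  show b: "0 \<le> content m (half_edge_array idx y, u) \<and> content m (half_edge_array idx y, u) \<le> int n"
    using s inv y u by (auto simp: sampled_def inverted_def half_edge_array_def)
  assume v0: "v \<noteq> 0"
  show "content m (half_edge_array idx y, u) = v \<longleftrightarrow> hop (output_graph A n m) u y v"
  proof (cases "v \<in> {1..int n}")
    case False
    then have "\<not> hop (output_graph A n m) u y v" by (auto simp: hop_def output_graph_def)
    moreover have "content m (half_edge_array idx y, u) \<noteq> v" using b False v0 by auto
    ultimately show ?thesis by blast
  next
    case True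
    show ?thesis
    proof (cases "snd y")
      case True
      then show ?thesis using \<open>v \<in> {1..int n}\<close> u y by (auto simp: half_edge_array_def hop_def output_graph_def)
    next
      case False
      have "content m (inverse_array idx (fst y), u) = v \<longleftrightarrow> content m (Edge (fst y), v) = u"
        using inv y u True unfolding inverted_def by blast
      then show ?thesis using True False u y by (auto simp: half_edge_array_def hop_def output_graph_def)
    qed
  qed
qed

lemma invert_all:
  assumes A: "finite A" "set as = A" "inj_on idx A" and s: "content m (Input, 0) = int n" "\<forall>a\<in>A. sampled a m"
  shows "triple M (n + 2) (seqs (map (\<lambda>a. invert_array (Edge a) (inverse_array idx a)) as)) m
    (\<lambda>m'. content m' (Input, 0) = int n \<and> (\<forall>a\<in>A. sampled a m') \<and> inverted idx A m' \<and> (\<forall>a u. content m' (Edge a, u) = content m (Edge a, u)))"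
proof -
  define J where "J X m' \<longleftrightarrow> content m' (Input, 0) = int n \<and> (\<forall>a\<in>A. sampled a m') \<and> X \<subseteq> A \<and> inverted idx X m' \<and>
    (\<forall>a u. content m' (Edge a, u) = content m (Edge a, u))" for X and m' :: "'a mem"
  have "triple M (n + 2) (seqs (map (\<lambda>a. invert_array (Edge a) (inverse_array idx a)) as)) m (J ({} \<union> set as))"
  proof (rule triple_seqs[where J = J])
    fix a X and m1 :: "'a mem" assume a: "a \<in> set as" and J: "J X m1"
    have sa: "sampled a m1" using J a A by (auto simp: J_def)
    let ?x = "Edge a" and ?y = "inverse_array idx a"
    have inj: "u = u'" if "u \<in> {1..int n}" "u' \<in> {1..int n}" "content m1 (?x, u) = content m1 (?x, u')" "content m1 (?x, u) \<noteq> 0" for u u'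
    proof -
      have "content m1 (?x, u) \<in> {1..int n}" using sa that unfolding sampled_def by force
      then have "(u, content m1 (?x, u)) \<in> out_rel n a m1" "(u', content m1 (?x, u)) \<in> out_rel n a m1"
        using that by (auto simp: out_rel_def)
      with sa show ?thesis unfolding sampled_def pinj_def single_valued_def by blast
    qed
    have "triple M (n + 2) (invert_array ?x ?y) m1 (\<lambda>m. content m (Input, 0) = int n \<and>
     (\<forall>v\<in>{1..int n}. 0 \<le> content m (?y, v) \<and> content m (?y, v) \<le> int n \<and> (\<forall>u\<in>{1..int n}. content m (?y, v) = u \<longleftrightarrow> content m1 (?x, u) = v)))"
      by (rule invert_array) (use J sa inj in \<open>auto simp: J_def sampled_def inverse_array_def\<close>)
    from ptriple_frame[OF this] show "triple M (n + 2) (invert_array ?x ?y) m1 (J (insert a X))"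
    proof (rule triple_mono)
      fix m2 :: "'a mem"
      assume m2: "(content m2 (Input, 0) = int n \<and>
     (\<forall>v\<in>{1..int n}. 0 \<le> content m2 (?y, v) \<and> content m2 (?y, v) \<le> int n \<and> (\<forall>u\<in>{1..int n}. content m2 (?y, v) = u \<longleftrightarrow> content m1 (?x, u) = v))) \<and>
        (\<forall>x i. x \<notin> writes (invert_array ?x ?y) \<longrightarrow> content m2 (x, i) = content m1 (x, i))"
      have E: "content m2 (Edge b, u) = content m1 (Edge b, u)" for b u
        using m2 unfolding writes_invert by (auto simp: inverse_array_def)
      have o: "out_rel n b m2 = out_rel n b m1" for b by (rule out_rel_cong) (rule E)
      have I: "content m2 (inverse_array idx b, v) = content m1 (inverse_array idx b, v)" if "b \<in> A" "b \<noteq> a" for b v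
      proof -
        have "idx b \<noteq> idx a" using that A a by (auto dest: inj_onD)
        then have "inverse_array idx b \<notin> {Work 6, ?y}" by (auto simp: inverse_array_def)
        then show ?thesis using m2 unfolding writes_invert by blast
      qed
      have "sampled b m2" if "b \<in> A" for b
      proof -
        have "sampled b m1" using J that by (simp add: J_def)
        with m2 show ?thesis unfolding sampled_def E o by blast
      qed
      moreover have "inverted idx (insert a X) m2"
        unfolding inverted_def
      proof
        fix b assume b: "b \<in> insert a X"
        show "\<forall>v\<in>{1..int n}. 0 \<le> content m2 (inverse_array idx b, v) \<and> content m2 (inverse_array idx b, v) \<le> int n \<and>
          (\<forall>u\<in>{1..int n}. content m2 (inverse_array idx b, v) = u \<longleftrightarrow> content m2 (Edge b, u) = v)"
        proof (cases "b = a")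
          case True
          show ?thesis unfolding True E using m2 by blast
        next
          case False
          then have "b \<in> X" "b \<in> A" using b J by (auto simp: J_def)
          then show ?thesis unfolding E I[OF \<open>b \<in> A\<close> False] using J unfolding J_def inverted_def by blast
        qed
      qed
      ultimately show "J (insert a X) m2" using J m2 a A by (auto simp: J_def E)
    qed
  next
    show "J {} m" using s by (simp add: J_def inverted_def)
  qed
  then show ?thesis by (rule triple_mono) (simp add: J_def A)
qed

lemma adj_path:
  assumes "nb = neighbours.adj n (half_edge_arrays idx as) (\<lambda>x u. content m (x, u))" "set as = A" "\<forall>a\<in>A. sampled a m" "inverted idx A m"
    and "neighbours n M (half_edge_arrays idx as) (\<lambda>x u. content m (x, u))"
  shows "nb = {(u, v). \<exists>y. hop (output_graph A n m) u y v}"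
proof -
  have V: "hop (output_graph A n m) u y v \<Longrightarrow> u \<in> {1..int n} \<and> v \<in> {1..int n} \<and> fst y \<in> A" for u y v
    by (auto simp: hop_def output_graph_def split: if_splits)
  have iff: "u \<in> {1..int n} \<and> v \<noteq> 0 \<and> (\<exists>x\<in>half_edge_array idx ` (A \<times> UNIV). content m (x, u) = v) \<longleftrightarrow>
    (\<exists>y. hop (output_graph A n m) u y v)" for u v
  proof
    assume l: "u \<in> {1..int n} \<and> v \<noteq> 0 \<and> (\<exists>x\<in>half_edge_array idx ` (A \<times> UNIV). content m (x, u) = v)"
    then obtain y where "fst y \<in> A" "content m (half_edge_array idx y, u) = v" by auto
    with l have "hop (output_graph A n m) u y v" using half_edge_array_hop(2)[OF assms(3,4), of y u v] by blast
    then show "\<exists>y. hop (output_graph A n m) u y v" by blast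
  next
    assume "\<exists>y. hop (output_graph A n m) u y v"
    then obtain y where h: "hop (output_graph A n m) u y v" by blast
    with V have uv: "u \<in> {1..int n}" "v \<in> {1..int n}" "fst y \<in> A" by blast+
    with h half_edge_array_hop(2)[OF assms(3,4) uv(3,1), of v] have "content m (half_edge_array idx y, u) = v" by auto
    moreover have "y \<in> A \<times> UNIV" using uv(3) by (simp add: mem_Times_iff)
    ultimately show "u \<in> {1..int n} \<and> v \<noteq> 0 \<and> (\<exists>x\<in>half_edge_array idx ` (A \<times> UNIV). content m (x, u) = v)"
      using uv by auto
  qed
  show ?thesis unfolding assms(1) neighbours.adj_def[OF assms(5)] set_half_edge_arrays assms(2) iff ..
qed

lemma output_connected:
  assumes G: "snd (output_graph A n m) \<in> graphs A {1..int n}"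
  shows "card ({(u, v). \<exists>y. hop (output_graph A n m) u y v}\<^sup>* `` {1}) = n \<longleftrightarrow> connected_graph (output_graph A n m)"
proof -
  let ?G = "output_graph A n m"
  let ?R = "{(u, v). \<exists>y. hop ?G u y v}\<^sup>* `` {1}"
  have V: "fst ?G = {1..int n}" by (simp add: output_graph_def)
  have AG: "A_graph A ?G" using G by (simp add: graphs_def output_graph_def)
  have path: "v \<in> ?R \<longleftrightarrow> (\<exists>w. labels_path ?G 1 w v)" for v
  proof
    assume "v \<in> ?R"
    then have "(1, v) \<in> {(u, v). \<exists>y. hop ?G u y v}\<^sup>*" by simp
    then show "\<exists>w. labels_path ?G 1 w v"
    proof (induction rule: rtrancl_induct)
      case base
      show ?case by (rule exI[of _ "[]"]) simp
    next
      case (step u v)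
      then obtain w y where "labels_path ?G 1 w u" "hop ?G u y v" by auto
      then have "labels_path ?G 1 (w @ [y]) v" by (auto simp: labels_path_append)
      then show ?case by blast
    qed
  next
    have "labels_path ?G u w v \<Longrightarrow> (u, v) \<in> {(u, v). \<exists>y. hop ?G u y v}\<^sup>*" for u w
    proof (induction w arbitrary: u)
      case (Cons y w)
      then obtain x where "hop ?G u y x" "(x, v) \<in> {(u, v). \<exists>y. hop ?G u y v}\<^sup>*" by auto
      then have "(u, x) \<in> {(u, v). \<exists>y. hop ?G u y v}" by blast
      then show ?case by (rule converse_rtrancl_into_rtrancl) fact
    qed simp
    then show "\<exists>w. labels_path ?G 1 w v \<Longrightarrow> v \<in> ?R" by auto
  qed
  have sub: "?R \<subseteq> {1..int n}"
  proof
    fix v assume "v \<in> ?R"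
    then obtain w where "labels_path ?G 1 w v" unfolding path by blast
    from labels_path_vertex[OF AG _ this] show "v \<in> {1..int n}" using n V by simp
  qed
  have "card ?R = n \<longleftrightarrow> ?R = {1..int n}"
  proof
    assume "card ?R = n"
    then show "?R = {1..int n}" by (intro card_subset_eq sub) auto
  qed auto
  also have "\<dots> \<longleftrightarrow> connected_graph ?G"
  proof
    assume R: "?R = {1..int n}"
    show "connected_graph ?G"
    proof (rule path_connected_graph)
      fix u v assume "u \<in> fst ?G" "v \<in> fst ?G"
      then have "u \<in> ?R" "v \<in> ?R" unfolding R V by auto
      then obtain w w' where "labels_path ?G 1 w u" "labels_path ?G 1 w' v" unfolding path by blast
      then have "labels_path ?G u (inv_word w @ w') v" by (auto simp: labels_path_append labels_path_inv)
      then show "\<exists>w. labels_path ?G u w v" by blast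
    qed
  next
    assume "connected_graph ?G"
    from connected_path[OF this, of 1] have "v \<in> ?R" if "v \<in> {1..int n}" for v
      unfolding path using that n V by auto
    with sub show "?R = {1..int n}" by blast
  qed
  finally show ?thesis .
qed

lemma output_trim:
  assumes A: "finite A" and G: "snd (output_graph A n m) \<in> graphs A {1..int n}"
  shows "(\<forall>w\<in>{2..int n}. 2 \<le> card {y \<in> A \<times> UNIV. \<exists>v. hop (output_graph A n m) w y v}) \<longleftrightarrow> trim (output_graph A n m) 1"
proof -
  let ?G = "output_graph A n m"
  have V: "fst ?G = {1..int n}" by (simp add: output_graph_def)
  have AG: "A_graph A ?G" using G by (simp add: graphs_def output_graph_def)
  have finE: "finite (snd ?G)"
    by (rule finite_subset[of _ "{1..int n} \<times> A \<times> {1..int n}"]) (use A in \<open>auto simp: output_graph_def\<close>)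
  have "2 \<le> card {y \<in> A \<times> UNIV. \<exists>v. hop ?G w y v} \<longleftrightarrow> \<not> is_leaf ?G w" for w
  proof
    let ?Y = "{y \<in> A \<times> UNIV. \<exists>v. hop ?G w y v}"
    have finY: "finite ?Y" using A by auto
    {
      assume "2 \<le> card ?Y"
      then have "\<not> card ?Y \<le> Suc 0" by simp
      then obtain y y' where "y \<in> ?Y" "y' \<in> ?Y" "y \<noteq> y'" using card_le_Suc0_iff_eq[OF finY] by blast
      with two_hops_not_leaf[OF finE] show "\<not> is_leaf ?G w" by blast
    next
      assume leaf: "\<not> is_leaf ?G w"
      obtain y x where y: "hop ?G w y x" using not_leaf_other_letter[OF AG leaf] by blast
      obtain y' x' where y': "hop ?G w y' x'" "y' \<noteq> y" using not_leaf_other_letter[OF AG leaf, of y] by blast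
      have "y \<in> ?Y" "y' \<in> ?Y" using y y'(1) hop_vertices[OF AG y] hop_vertices[OF AG y'(1)] by (auto simp: mem_Times_iff)
      then have "{y, y'} \<subseteq> ?Y" by blast
      from card_mono[OF finY this] y'(2) show "2 \<le> card ?Y" by simp
    }
  qed
  then have deg: "(2 \<le> card {y \<in> A \<times> UNIV. \<exists>v. hop ?G w y v}) = (\<not> is_leaf ?G w)" for w .
  have "w \<in> {2..int n} \<longleftrightarrow> w \<in> {1..int n} \<and> w \<noteq> 1" for w by auto
  then show ?thesis unfolding trim_def V deg by blast
qed

end

section \<open>Drawing a graph and testing it\<close>

context machine
begin

definition attempted :: "'a set \<Rightarrow> 'a mem \<Rightarrow> bool" where
  "attempted A m \<longleftrightarrow> content m (Input, 0) = int n \<and> snd (output_graph A n m) \<in> graphs A {1..int n} \<and>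
     val m 10 = of_bool (admissible A (output_graph A n m) 1)"

lemma check:
  assumes A: "finite A" "set as = A" "distinct as" "inj_on idx A" and big: "fits M (2 * int (length as))"
    and m: "content m (Input, 0) = int n" "\<forall>a\<in>A. sampled a m" "inverted idx A m" "val m 10 = 0"
  shows "triple M (n + 2) (Seq (trim_check (half_edge_arrays idx as)) (Seq (search (half_edge_arrays idx as))
       (If (Eq (var 18) size_exp) (If (Eq (var 13) (Lit 0)) (set_var 10 (Lit 1)) Skip) Skip))) m
     (\<lambda>m'. attempted A m' \<and> (\<forall>a u. content m' (Edge a, u) = content m (Edge a, u)))"
proof -
  let ?L = "half_edge_arrays idx as" and ?nb = "\<lambda>x u. content m (x, u)" and ?G = "output_graph A n m"
  have setL: "set ?L = half_edge_array idx ` (A \<times> UNIV)" using set_half_edge_arrays[of idx as] A(2) by simp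
  have lenL: "length ?L = 2 * length as" by (simp add: half_edge_arrays_def)
  have inj: "inj_on (half_edge_array idx) (A \<times> UNIV)" by (rule inj_half_edge_array[OF A(4)])
  have arr: "0 \<le> content m (half_edge_array idx y, u) \<and> content m (half_edge_array idx y, u) \<le> int n"
    "v \<noteq> 0 \<Longrightarrow> content m (half_edge_array idx y, u) = v \<longleftrightarrow> hop ?G u y v" if "fst y \<in> A" "u \<in> {1..int n}" for y u v
    using half_edge_array_hop[OF m(2,3) that] by blast+
  interpret nbh: neighbours n M ?L ?nb
  proof unfold_locales
    show "Input \<notin> set ?L" by (auto simp: half_edge_arrays_def inverse_array_def)
    show "\<And>k. k < 20 \<Longrightarrow> Work k \<notin> set ?L" by (auto simp: half_edge_arrays_def inverse_array_def)
    show "distinct ?L"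
      using A by (auto simp: half_edge_arrays_def inverse_array_def distinct_map inj_on_def)
    show "\<And>x u. x \<in> set ?L \<Longrightarrow> u \<in> {1..int n} \<Longrightarrow> 0 \<le> content m (x, u) \<and> content m (x, u) \<le> int n"
      using arr(1) unfolding setL by auto
  qed
  have G: "snd ?G \<in> graphs A {1..int n}" using m(2) by (intro output_graph_graphs) (auto simp: sampled_def)
  have adj: "nbh.adj = {(u, v). \<exists>y. hop ?G u y v}"
    by (rule adj_path[OF refl A(2) m(2,3) nbh.neighbours_axioms])
  have deg: "nbh.degree w = card {y \<in> A \<times> UNIV. \<exists>v. hop ?G w y v}" if w: "w \<in> {1..int n}" for w
  proof -
    have "{x \<in> set ?L. content m (x, w) \<noteq> 0} = half_edge_array idx ` {y \<in> A \<times> UNIV. content m (half_edge_array idx y, w) \<noteq> 0}"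
      unfolding setL by blast
    also have "card \<dots> = card {y \<in> A \<times> UNIV. content m (half_edge_array idx y, w) \<noteq> 0}"
      by (rule card_image, rule inj_on_subset[OF inj]) blast
    also have "{y \<in> A \<times> UNIV. content m (half_edge_array idx y, w) \<noteq> 0} = {y \<in> A \<times> UNIV. \<exists>v. hop ?G w y v}"
    proof (rule Collect_cong, rule conj_cong[OF refl])
      fix y assume "y \<in> A \<times> (UNIV :: bool set)"
      then have y: "fst y \<in> A" by auto
      have h0: "\<not> hop ?G w y 0" by (auto simp: hop_def output_graph_def)
      show "content m (half_edge_array idx y, w) \<noteq> 0 \<longleftrightarrow> (\<exists>v. hop ?G w y v)"
      proof
        assume "content m (half_edge_array idx y, w) \<noteq> 0"
        from arr(2)[OF y w this] show "\<exists>v. hop ?G w y v" by blast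
      next
        assume "\<exists>v. hop ?G w y v"
        then obtain v where h: "hop ?G w y v" by blast
        with h0 have v: "v \<noteq> 0" by auto
        from arr(2)[OF y w v] h v show "content m (half_edge_array idx y, w) \<noteq> 0" by simp
      qed
    qed
    finally show ?thesis unfolding nbh.degree_def .
  qed
  have trim: "(\<forall>w\<in>{2..int n}. 2 \<le> nbh.degree w) \<longleftrightarrow> trim ?G 1"
    unfolding output_trim[OF A(1) G, symmetric] using deg by auto
  have conn: "int (card (nbh.adj\<^sup>* `` {1})) = int n \<longleftrightarrow> connected_graph ?G"
    unfolding adj output_connected[OF G, symmetric] by simp
  have adm: "admissible A ?G 1 \<longleftrightarrow> connected_graph ?G \<and> trim ?G 1"
    using G n by (auto simp: admissible_def graphs_def output_graph_def)
  let ?E = "\<lambda>m'. \<forall>a u. content m' (Edge a, u) = content m (Edge a, u)"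
  have loaded: "nbh.loaded m" using m(1) by (simp add: nbh.loaded_def)
  have long: "int (length ?L) \<le> 2 * int (length as)" by (simp add: lenL)
  let ?R1 = "\<lambda>m'. nbh.loaded m' \<and> (val m' 13 = 0 \<longleftrightarrow> trim ?G 1) \<and> val m' 10 = 0 \<and> ?E m' \<and> val m' 13 \<in> {0, 1}"
  have 1: "triple M (n + 2) (trim_check ?L) m ?R1"
    using ptriple_frame[OF nbh.trim_check[OF loaded long big]]
  proof (rule triple_mono)
    fix m' :: "'a mem"
    assume m': "(nbh.loaded m' \<and> (val m' 13 = 0 \<longleftrightarrow> (\<forall>w\<in>{2..int n}. 2 \<le> nbh.degree w)) \<and> val m' 13 \<in> {0, 1}) \<and>
      (\<forall>x i. x \<notin> writes (trim_check ?L) \<longrightarrow> content m' (x, i) = content m (x, i))"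
    have "Work 10 \<notin> writes (trim_check ?L)" "Edge a \<notin> writes (trim_check ?L)" for a
      using writes_trim[of ?L] by auto
    with m' show "?R1 m'" using m(4) unfolding trim by auto
  qed
  have 2: "triple M (n + 2) (search ?L) m1 (\<lambda>m'. ?R1 m' \<and> (val m' 18 = int n \<longleftrightarrow> connected_graph ?G) \<and> fits M (val m' 18))"
    if m1: "?R1 m1" for m1
  proof (rule triple_mono[OF ptriple_frame[OF nbh.search]])
    show "nbh.loaded m1" using m1 by simp
    fix m' :: "'a mem"
    assume m': "(nbh.loaded m' \<and> val m' 18 = int (card (nbh.adj\<^sup>* `` {1}))) \<and>
      (\<forall>x i. x \<notin> writes (search ?L) \<longrightarrow> content m' (x, i) = content m1 (x, i))"
    have w: "Work 10 \<notin> writes (search ?L)" "Work 13 \<notin> writes (search ?L)" "Edge a \<notin> writes (search ?L)" for a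
      using writes_search[of ?L] by auto
    have sub: "nbh.adj\<^sup>* `` {1} \<subseteq> {1..int n}"
    proof
      fix v assume "v \<in> nbh.adj\<^sup>* `` {1}"
      then have "(1, v) \<in> nbh.adj\<^sup>*" by simp
      then show "v \<in> {1..int n}"
        by (cases rule: rtranclE) (use n in \<open>auto simp: adj hop_def output_graph_def split: if_splits\<close>)
    qed
    from card_mono[OF _ sub] have "fits M (int (card (nbh.adj\<^sup>* `` {1})))" by (intro fits_vertex) auto
    with m' w m1 conn show "?R1 m' \<and> (val m' 18 = int n \<longleftrightarrow> connected_graph ?G) \<and> fits M (val m' 18)" by auto
  qed
  have 3: "triple M (n + 2) (If (Eq (var 18) size_exp) (If (Eq (var 13) (Lit 0)) (set_var 10 (Lit 1)) Skip) Skip) m2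
      (\<lambda>m'. attempted A m' \<and> ?E m')"
    if m2: "?R1 m2 \<and> (val m2 18 = int n \<longleftrightarrow> connected_graph ?G) \<and> fits M (val m2 18)" for m2
  proof (rule safe_triple)
    have same: "output_graph A n m' = ?G" if "?E m'" for m' using that by (simp add: output_graph_def)
    have inp: "content m2 (Input, 0) = int n" using m2 by (simp add: nbh.loaded_def)
    have fin: "attempted A m' \<and> ?E m'" if "content m' (Input, 0) = int n" "?E m'" "val m' 10 = of_bool (connected_graph ?G \<and> trim ?G 1)" for m'
      using that G same[OF that(2)] adm by (simp add: attempted_def)
    show "safe M (If (Eq (var 18) size_exp) (If (Eq (var 13) (Lit 0)) (set_var 10 (Lit 1)) Skip) Skip) (\<lambda>m'. attempted A m' \<and> ?E m') m2"
    proof (cases "connected_graph ?G \<and> trim ?G 1")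
      case True
      have "attempted A (m2((Work 10, 0) \<mapsto> 1)) \<and> ?E (m2((Work 10, 0) \<mapsto> 1))"
        by (rule fin) (use m2 inp True in auto)
      then show ?thesis using m2 inp True by (auto simp: fits01 fits_vertex)
    next
      case False
      have "attempted A m2 \<and> ?E m2" by (rule fin) (use m2 inp False in auto)
      then show ?thesis using m2 inp False by (auto simp: fits01 fits_vertex)
    qed
  qed simp
  show ?thesis by (intro triple_Seq[OF 1] triple_Seq[OF 2] 3)
qed

lemma attempt:
  assumes A: "finite A" "set as = A" "distinct as" "inj_on idx A" and big: "fits M (2 * int (length as))"
    and m: "content m (Input, 0) = int n" "val m 10 = 0" and E: "E \<in> graphs A {1..int n}"
  shows "ptriple M (n + 2) (attempt idx as) m (attempted A) (\<lambda>m. of_bool (snd (output_graph A n m) = E))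
     (1 / real (card (graphs A {1..int n})))"
proof -
  let ?c = "1 / real (card (pinj {1..int n}))"
  let ?all = "\<lambda>m. \<forall>a\<in>A. out_rel n a m = edge_rel E a"
  have first: "ptriple M (n + 2) (seqs (map sample as)) m
      (\<lambda>m. content m (Input, 0) = int n \<and> (\<forall>a\<in>A. sampled a m) \<and> val m 10 = 0) (\<lambda>m. of_bool (?all m)) (?c ^ length as)"
  proof -
    have w: "Work 10 \<notin> writes (seqs (map sample as))" by (simp add: writes_seqs done_not_written)
    have "ptriple M (n + 2) (seqs (map sample as)) m (\<lambda>m. content m (Input, 0) = int n \<and> (\<forall>a\<in>set as. sampled a m))
       (\<lambda>m. of_bool (\<forall>a\<in>set as. out_rel n a m = edge_rel E a)) (?c ^ length as)"
      by (rule sample_all) (use A m edge_rel_pinj[OF E] in auto)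
    from ptriple_frame[OF this] show ?thesis
      by (rule ptriple_mono) (use w m A in auto)
  qed
  have rest: "ptriple M (n + 2) (Seq (seqs (map (\<lambda>a. invert_array (Edge a) (inverse_array idx a)) as))
     (Seq (trim_check (half_edge_arrays idx as)) (Seq (search (half_edge_arrays idx as))
       (If (Eq (var 18) size_exp) (If (Eq (var 13) (Lit 0)) (set_var 10 (Lit 1)) Skip) Skip)))) m1
     (attempted A) (\<lambda>m. of_bool (snd (output_graph A n m) = E)) (of_bool (?all m1))"
    if m1: "content m1 (Input, 0) = int n \<and> (\<forall>a\<in>A. sampled a m1) \<and> val m1 10 = 0" for m1 :: "'a mem"
  proof -
    let ?inv = "seqs (map (\<lambda>a. invert_array (Edge a) (inverse_array idx a)) as)"
    let ?Q = "\<lambda>m'. content m' (Input, 0) = int n \<and> (\<forall>a\<in>A. sampled a m') \<and> inverted idx A m' \<and>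
      (\<forall>a u. content m' (Edge a, u) = content m1 (Edge a, u)) \<and> val m' 10 = 0"
    have w: "Work 10 \<notin> writes ?inv" by (auto simp: writes_seqs writes_invert inverse_array_def)
    have 1: "triple M (n + 2) ?inv m1 ?Q"
      by (rule triple_mono[OF ptriple_frame[OF invert_all[OF A(1,2,4)]]]) (use w m1 in auto)
    have 2: "triple M (n + 2) (Seq (trim_check (half_edge_arrays idx as)) (Seq (search (half_edge_arrays idx as))
       (If (Eq (var 18) size_exp) (If (Eq (var 13) (Lit 0)) (set_var 10 (Lit 1)) Skip) Skip))) m2
      (\<lambda>m'. attempted A m' \<and> (\<forall>a u. content m' (Edge a, u) = content m1 (Edge a, u)))" if "?Q m2" for m2 :: "'a mem"
      by (rule triple_mono[OF check[OF A big]]) (use that in auto)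
    from triple_Seq[OF 1 2]
    show ?thesis
    proof (rule ptriple_mono[OF ptriple_const])
      fix m' :: "'a mem" assume m': "attempted A m' \<and> (\<forall>a u. content m' (Edge a, u) = content m1 (Edge a, u))"
      then have o: "out_rel n a m' = out_rel n a m1" for a by (intro out_rel_cong) auto
      have "out_rel n a m' \<in> pinj {1..int n}" if "a \<in> A" for a using m1 that unfolding o by (auto simp: sampled_def)
      from output_graph_eq[OF E this] show "of_bool (?all m1) \<le> (of_bool (snd (output_graph A n m') = E) :: real)"
        unfolding o by simp
    qed auto
  qed
  have "?c ^ length as = 1 / real (card (graphs A {1..int n}))"
    using A distinct_card[OF A(3)] by (simp add: card_graphs power_divide)
  with ptriple_Seq[OF first rest] show ?thesis unfolding attempt_def by simp
qed

end

section \<open>Rejection\<close>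

text \<open>
  The lower bounds for the single elements of \<open>G\<close> add up to 1.
\<close>

lemma uniform_of_lower_bound:
  assumes fin: "finite G" and supp: "\<And>m. m \<in> set_pmf p \<Longrightarrow> f m \<in> G"
    and low: "\<And>E. E \<in> G \<Longrightarrow> 1 / real (card G) \<le> measure_pmf.prob p {m. f m = E}"
    and X: "X \<subseteq> G" and G: "G \<noteq> {}"
  shows "measure_pmf.prob p {m. f m \<in> X} = real (card X) / real (card G)"
proof -
  have ge: "real (card Y) / real (card G) \<le> measure_pmf.prob p {m. f m \<in> Y}" if Y: "Y \<subseteq> G" for Y
  proof -
    have fY: "finite Y" using Y fin finite_subset by blast
    have "real (card Y) / real (card G) = (\<Sum>E\<in>Y. 1 / real (card G))" by simp
    also have "\<dots> \<le> (\<Sum>E\<in>Y. measure_pmf.prob p {m. f m = E})" using low Y by (intro sum_mono) auto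
    also have "\<dots> = measure_pmf.prob p (\<Union>E\<in>Y. {m. f m = E})"
      by (rule measure_pmf.finite_measure_finite_Union[symmetric]) (use fY in \<open>auto simp: disjoint_family_on_def\<close>)
    also have "(\<Union>E\<in>Y. {m. f m = E}) = {m. f m \<in> Y}" by auto
    finally show ?thesis .
  qed
  have "measure_pmf.prob p {m. f m \<in> X} + measure_pmf.prob p {m. f m \<in> G - X} = measure_pmf.prob p ({m. f m \<in> X} \<union> {m. f m \<in> G - X})"
    by (rule measure_pmf.finite_measure_Union[symmetric]) auto
  also have "\<dots> \<le> 1" by simp
  finally have "measure_pmf.prob p {m. f m \<in> X} \<le> 1 - real (card (G - X)) / real (card G)" using ge[of "G - X"] by auto
  also have "\<dots> = real (card X) / real (card G)"
  proof -
    have "card (G - X) = card G - card X" using X fin finite_subset by (intro card_Diff_subset) auto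
    moreover have "card X \<le> card G" using X fin by (rule card_mono[rotated])
    moreover have "real (card G) > 0" using G fin by (simp add: card_gt_0_iff)
    ultimately show ?thesis by (simp add: of_nat_diff field_simps)
  qed
  finally show ?thesis using ge[OF X] by simp
qed

text \<open>
  As a function of the memory the bound decreases on average by the cost of an iteration,
  because the loop ends with probability at least \<open>\<delta>\<close>.
\<close>

lemma While_upper:
  assumes ok: "\<And>m. I m \<Longrightarrow> test_ok M m b"
    and body: "\<And>m. I m \<Longrightarrow> eval_test m b \<Longrightarrow> \<exists>p. sure M c m k p \<and> (\<forall>m'\<in>set_pmf p. I m') \<and>
       measure_pmf.prob p {m'. eval_test m' b} \<le> 1 - \<delta>"
    and C: "ops_bounded C M w" and \<delta>: "0 < \<delta>" and m: "I m"
  shows "cost_upto C t (While b c) (\<lambda>_. 0) m \<le>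
     ennreal (real (test_ops b) * w + (if eval_test m b then (real k * w + real (test_ops b) * w) / \<delta> else 0))"
  using m
proof (induction t arbitrary: m)
  case 0
  then show ?case by simp
next
  case (Suc t)
  let ?Z = "real (test_ops b) * w" and ?Y = "(real k * w + real (test_ops b) * w) / \<delta>"
  have w: "0 \<le> w" using C by (simp add: ops_bounded_def)
  then have Y: "0 \<le> ?Y" and Z: "0 \<le> ?Z" using \<delta> by auto
  have test: "test_cost C m b \<le> ?Z" by (rule test_cost_le[OF C ok[OF Suc.prems]])
  show ?case
  proof (cases "eval_test m b")
    case False
    then show ?thesis using test by (auto simp: cost_upto_While simp del: cost_upto.simps intro!: ennreal_leI)
  next
    case True
    from body[OF Suc.prems True] obtain p where p: "sure M c m k p" "\<forall>m'\<in>set_pmf p. I m'"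
      "measure_pmf.prob p {m'. eval_test m' b} \<le> 1 - \<delta>" by blast
    let ?\<Phi> = "\<lambda>m'. ?Z + ?Y * indicator {m'. eval_test m' b} m'"
    have int: "integrable (measure_pmf p) ?\<Phi>" by (rule integrable_measure_pmf_finite[OF sure_finite[OF p(1)]])
    have "cost_upto C t (Seq c (While b c)) (\<lambda>_. 0) m \<le> cost_upto C t c (cost_upto C t (While b c) (\<lambda>_. 0)) m" by (rule cost_upto_Seq_le)
    also have "\<dots> \<le> ennreal (real k * w) + (\<integral>\<^sup>+ m'. cost_upto C t (While b c) (\<lambda>_. 0) m' \<partial>measure_pmf p)" by (rule sure_upper[OF p(1) C])
    also have "\<dots> \<le> ennreal (real k * w) + (\<integral>\<^sup>+ m'. ennreal (?\<Phi> m') \<partial>measure_pmf p)"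
    proof (intro add_left_mono nn_integral_mono_AE)
      show "AE m' in measure_pmf p. cost_upto C t (While b c) (\<lambda>_. 0) m' \<le> ennreal (?\<Phi> m')"
        unfolding AE_measure_pmf_iff
      proof
        fix m' assume "m' \<in> set_pmf p"
        then have "cost_upto C t (While b c) (\<lambda>_. 0) m' \<le> ennreal (?Z + (if eval_test m' b then ?Y else 0))" using Suc.IH p(2) by blast
        then show "cost_upto C t (While b c) (\<lambda>_. 0) m' \<le> ennreal (?\<Phi> m')" by (cases "eval_test m' b") auto
      qed
    qed
    also have "(\<integral>\<^sup>+ m'. ennreal (?\<Phi> m') \<partial>measure_pmf p) = ennreal (measure_pmf.expectation p ?\<Phi>)"
    proof (rule nn_integral_eq_integral[OF int])
      have "0 \<le> ?\<Phi> m'" for m' using Y Z by (cases "eval_test m' b") auto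
      then show "AE m' in measure_pmf p. 0 \<le> ?\<Phi> m'" by simp
    qed
    also have "measure_pmf.expectation p ?\<Phi> = ?Z + ?Y * measure_pmf.prob p {m'. eval_test m' b}"
      by (subst Bochner_Integration.integral_add) (auto intro!: integrable_measure_pmf_finite sure_finite[OF p(1)])
    also have "ennreal (?Z + ?Y * measure_pmf.prob p {m'. eval_test m' b}) \<le> ennreal (?Z + ?Y * (1 - \<delta>))"
      using Y p(3) by (intro ennreal_leI add_left_mono mult_left_mono) auto
    finally have "cost_upto C t (Seq c (While b c)) (\<lambda>_. 0) m \<le> ennreal (real k * w) + ennreal (?Z + ?Y * (1 - \<delta>))"
      by (simp add: add_left_mono)
    then have "cost_upto C (Suc t) (While b c) (\<lambda>_. 0) m \<le> ennreal ?Z + (ennreal (real k * w) + ennreal (?Z + ?Y * (1 - \<delta>)))"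
      using True test by (auto simp: cost_upto_While simp del: cost_upto.simps intro!: add_mono ennreal_leI)
    also have "\<dots> = ennreal (?Z + (real k * w + (?Z + ?Y * (1 - \<delta>))))"
    proof -
      have "0 \<le> 1 - \<delta>" using p(3) measure_nonneg[of "measure_pmf p"] by (meson order_trans)
      then have "0 \<le> ?Z + ?Y * (1 - \<delta>)" by (rule add_nonneg_nonneg[OF Z mult_nonneg_nonneg[OF Y]])
      moreover have "0 \<le> real k * w" using w by simp
      ultimately show ?thesis using Z by (simp only: ennreal_plus add_nonneg_nonneg)
    qed
    also have "?Z + (real k * w + (?Z + ?Y * (1 - \<delta>))) = ?Z + ?Y" using \<delta> by (simp add: field_simps)
    finally show ?thesis using True by simp
  qed
qed

text \<open>
  The left-hand side is a lower bound for the probability that one of the first \<open>j\<close>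
  attempts succeeds with \<open>P\<close>.
\<close>

lemma While_lower:
  assumes body: "\<And>m. I m \<Longrightarrow> eval_test m b \<Longrightarrow> \<exists>p. sure M c m k p \<and> (\<forall>m'\<in>set_pmf p. I m') \<and>
       x \<le> measure_pmf.prob p {m'. \<not> eval_test m' b \<and> P m'} \<and> f \<le> measure_pmf.prob p {m'. eval_test m' b}"
    and x: "0 \<le> x" "0 \<le> f" and m: "I m" "eval_test m b"
  shows "\<exists>t. ennreal (x * (\<Sum>i<j. f ^ i)) \<le> cost_upto C t (While b c) (indicator {m. P m}) m"
  using m
proof (induction j arbitrary: m)
  case 0
  then show ?case by simp
next
  case (Suc j)
  let ?S = "x * (\<Sum>i<j. f ^ i)" and ?g = "indicator {m. P m} :: 'a mem \<Rightarrow> ennreal"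
  have S: "0 \<le> ?S" using x by (auto intro!: mult_nonneg_nonneg sum_nonneg)
  from body[OF Suc.prems] obtain p where p: "sure M c m k p" "\<forall>m'\<in>set_pmf p. I m'"
    "x \<le> measure_pmf.prob p {m'. \<not> eval_test m' b \<and> P m'}" "f \<le> measure_pmf.prob p {m'. eval_test m' b}" by blast
  have fin: "finite (set_pmf p)" by (rule sure_finite[OF p(1)])
  let ?\<Phi> = "\<lambda>m'. indicator {m'. \<not> eval_test m' b \<and> P m'} m' + ?S * indicator {m'. eval_test m' b} m'"
  have "\<forall>m'\<in>set_pmf p. \<exists>t. ennreal (?\<Phi> m') \<le> cost_upto C t (While b c) ?g m'"
  proof
    fix m' assume m': "m' \<in> set_pmf p"
    show "\<exists>t. ennreal (?\<Phi> m') \<le> cost_upto C t (While b c) ?g m'"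
    proof (cases "eval_test m' b")
      case True
      then show ?thesis using Suc.IH[of m'] p(2) m' by auto
    next
      case False
      then have "ennreal (?\<Phi> m') \<le> cost_upto C (Suc 0) (While b c) ?g m'"
        by (auto simp: cost_upto_While indicator_def simp del: cost_upto.simps)
      then show ?thesis by blast
    qed
  qed
  from bchoice[OF this] obtain tt where "\<forall>m'\<in>set_pmf p. ennreal (?\<Phi> m') \<le> cost_upto C (tt m') (While b c) ?g m'" ..
  note tt = this[rule_format]
  define t1 where "t1 = Max (tt ` set_pmf p)"
  have t1: "ennreal (?\<Phi> m') \<le> cost_upto C t1 (While b c) ?g m'" if "m' \<in> set_pmf p" for m'
    by (rule order_trans[OF tt[OF that] cost_upto_mono_time]) (use fin that in \<open>auto simp: t1_def\<close>)
  obtain t0 where t0: "\<And>g. (\<integral>\<^sup>+ m'. g m' \<partial>measure_pmf p) \<le> cost_upto C t0 c g m" using sure_lower[OF p(1), where C = C] by blast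
  have "ennreal (x * (\<Sum>i<Suc j. f ^ i)) = ennreal (x + ?S * f)"
    by (simp only: sum.lessThan_Suc_shift) (simp add: sum_distrib_left sum_distrib_right algebra_simps)
  also have "\<dots> \<le> ennreal (measure_pmf.expectation p ?\<Phi>)"
  proof (rule ennreal_leI)
    have "measure_pmf.expectation p ?\<Phi> = measure_pmf.prob p {m'. \<not> eval_test m' b \<and> P m'} + ?S * measure_pmf.prob p {m'. eval_test m' b}"
      by (subst Bochner_Integration.integral_add) (auto intro!: integrable_measure_pmf_finite fin)
    then show "x + ?S * f \<le> measure_pmf.expectation p ?\<Phi>" using p(3,4) S by (simp add: add_mono mult_left_mono)
  qed
  also have "\<dots> = (\<integral>\<^sup>+ m'. ennreal (?\<Phi> m') \<partial>measure_pmf p)"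
    using S by (intro nn_integral_eq_integral[symmetric] integrable_measure_pmf_finite fin) auto
  also have "\<dots> \<le> (\<integral>\<^sup>+ m'. cost_upto C t1 (While b c) ?g m' \<partial>measure_pmf p)"
    by (intro nn_integral_mono_AE) (use t1 in \<open>auto simp: AE_measure_pmf_iff\<close>)
  also have "\<dots> \<le> cost_upto C t0 c (cost_upto C t1 (While b c) ?g) m" by (rule t0)
  also have "\<dots> \<le> cost_upto C (Suc (t0 + t1)) (Seq c (While b c)) ?g m" by (rule cost_upto_Seq_ge)
  also have "\<dots> \<le> cost_upto C (Suc (Suc (t0 + t1))) (While b c) ?g m"
    unfolding cost_upto_While[of C "Suc (t0 + t1)"] using Suc.prems(2) by (simp del: cost_upto.simps add: add_increasing)
  finally show ?case by blast
qed

lemma ops_bounded_unit: "ops_bounded unit_cost M 1"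
  by (simp add: ops_bounded_def unit_cost_def)

lemma bit_length_le:
  assumes "fits M x" "1 \<le> M" shows "bit_length x \<le> log 2 M + 2"
proof (cases "x = 0")
  case True
  then show ?thesis using assms by (simp add: bit_length_def bitlen_def floorlog_def)
next
  case False
  then have "bit_length x = real_of_int (\<lfloor>log 2 \<bar>x\<bar>\<rfloor> + 1) + 1" by (simp add: bit_length_def bitlen_alt_def)
  also have "\<dots> \<le> log 2 \<bar>x\<bar> + 2" by simp
  also have "log 2 \<bar>x\<bar> \<le> log 2 M" using False assms by (simp add: fits_def)
  finally show ?thesis by simp
qed

text \<open>
  The model is applied at \<open>n + 1\<close> since it says nothing about \<open>n = 1\<close>,
  where the logarithm vanishes. All operations are charged like a multiplication of two long
  integers.
\<close>

lemma ops_bounded_bit: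
  assumes C: "bit_cost_model C"
  shows "\<exists>B\<ge>0. \<forall>n\<ge>1. ops_bounded C ((int n + 1) ^ (4 * n + 4 + d)) (B * (real (n + 1) * (log 2 (real (n + 1)))\<^sup>2))"
proof -
  define K where "K = real (4 + d + 2)"
  have len: "bit_length x \<le> K * (real (n + 1) * log 2 (real (n + 1)))" if "n \<ge> 1" "fits ((int n + 1) ^ (4 * n + 4 + d)) x" for n x
  proof -
    have l1: "1 \<le> log 2 (real (n + 1))" using that(1) by (simp add: le_log_iff)
    have "bit_length x \<le> log 2 (real_of_int ((int n + 1) ^ (4 * n + 4 + d))) + 2"
      by (rule bit_length_le[OF that(2)]) (simp add: one_le_power)
    also have "log 2 (real_of_int ((int n + 1) ^ (4 * n + 4 + d))) = real (4 * n + 4 + d) * log 2 (real (n + 1))"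
      by (simp add: log_nat_power add.commute)
    also have "real (4 * n + 4 + d) * log 2 (real (n + 1)) + 2 \<le> real (4 * n + 4 + d) * log 2 (real (n + 1)) + 2 * log 2 (real (n + 1))"
      using l1 by simp
    also have "\<dots> = real (4 * n + 4 + d + 2) * log 2 (real (n + 1))" by (simp add: algebra_simps)
    also have "\<dots> \<le> (K * real (n + 1)) * log 2 (real (n + 1))"
      using l1 unfolding K_def by (intro mult_right_mono) (auto simp: algebra_simps)
    finally show ?thesis by (simp add: mult.assoc)
  qed
  have "\<forall>f\<in>{c_read C, c_write C, c_compare C, c_add C, c_sub C}. \<exists>B. \<forall>n\<ge>2. \<forall>x y.
        bit_length x \<le> K * (real n * log 2 n) \<and> bit_length y \<le> K * (real n * log 2 n) \<longrightarrow>
        f x y \<le> B * (real n * log 2 n)"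
    using C unfolding bit_cost_model_def by blast
  then have ex: "\<exists>B. \<forall>n\<ge>2. \<forall>x y. bit_length x \<le> K * (real n * log 2 n) \<and> bit_length y \<le> K * (real n * log 2 n) \<longrightarrow>
        f x y \<le> B * (real n * log 2 n)" if "f \<in> {c_read C, c_write C, c_compare C, c_add C, c_sub C}" for f using that by blast
  obtain B1 where B1: "\<And>n x y. n \<ge> 2 \<Longrightarrow> bit_length x \<le> K * (real n * log 2 n) \<Longrightarrow> bit_length y \<le> K * (real n * log 2 n) \<Longrightarrow>
      c_read C x y \<le> B1 * (real n * log 2 n)"
    using ex[of "c_read C"] by blast
  obtain B2 where B2: "\<And>n x y. n \<ge> 2 \<Longrightarrow> bit_length x \<le> K * (real n * log 2 n) \<Longrightarrow> bit_length y \<le> K * (real n * log 2 n) \<Longrightarrow>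
      c_write C x y \<le> B2 * (real n * log 2 n)"
    using ex[of "c_write C"] by blast
  obtain B3 where B3: "\<And>n x y. n \<ge> 2 \<Longrightarrow> bit_length x \<le> K * (real n * log 2 n) \<Longrightarrow> bit_length y \<le> K * (real n * log 2 n) \<Longrightarrow>
      c_compare C x y \<le> B3 * (real n * log 2 n)"
    using ex[of "c_compare C"] by blast
  obtain B4 where B4: "\<And>n x y. n \<ge> 2 \<Longrightarrow> bit_length x \<le> K * (real n * log 2 n) \<Longrightarrow> bit_length y \<le> K * (real n * log 2 n) \<Longrightarrow>
      c_add C x y \<le> B4 * (real n * log 2 n)"
    using ex[of "c_add C"] by blast
  obtain B5 where B5: "\<And>n x y. n \<ge> 2 \<Longrightarrow> bit_length x \<le> K * (real n * log 2 n) \<Longrightarrow> bit_length y \<le> K * (real n * log 2 n) \<Longrightarrow>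
      c_sub C x y \<le> B5 * (real n * log 2 n)"
    using ex[of "c_sub C"] by blast
  obtain B6 where B6: "\<And>n x y. n \<ge> 2 \<Longrightarrow> bit_length x \<le> K * (real n * log 2 n) \<Longrightarrow> bit_length y \<le> K * (real n * log 2 n) \<Longrightarrow>
      c_mul C x y \<le> B6 * (real n * (log 2 n)\<^sup>2)"
    using C unfolding bit_cost_model_def by meson
  obtain B7 where B7: "\<And>N. N \<ge> 1 \<Longrightarrow> c_draw C N \<le> B7 * bit_length N"
    using C unfolding bit_cost_model_def by blast
  define B where "B = \<bar>B1\<bar> + \<bar>B2\<bar> + \<bar>B3\<bar> + \<bar>B4\<bar> + \<bar>B5\<bar> + \<bar>B6\<bar> + \<bar>B7\<bar> * K"
  have K0: "0 \<le> K" by (simp add: K_def)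
  have B0: "0 \<le> B" using K0 unfolding B_def by (intro add_nonneg_nonneg mult_nonneg_nonneg) auto
  moreover have "ops_bounded C ((int n + 1) ^ (4 * n + 4 + d)) (B * (real (n + 1) * (log 2 (real (n + 1)))\<^sup>2))" if n: "n \<ge> 1" for n
    unfolding ops_bounded_def
  proof (intro conjI allI impI)
    let ?l = "log 2 (real (n + 1))" and ?w = "real (n + 1) * (log 2 (real (n + 1)))\<^sup>2"
    have l1: "1 \<le> ?l" using n by (simp add: le_log_iff)
    have v: "real (n + 1) * ?l \<le> ?w"
    proof (rule mult_left_mono)
      have "?l * 1 \<le> ?l * ?l" using l1 by (intro mult_left_mono) auto
      then show "?l \<le> ?l\<^sup>2" by (simp add: power2_eq_square)
    qed simp
    have w0: "0 \<le> ?w" by simp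
    have vw: "b * (real (n + 1) * ?l) \<le> B * ?w" if "b \<le> B" for b
    proof -
      have "b * (real (n + 1) * ?l) \<le> B * (real (n + 1) * ?l)" using that l1 by (intro mult_right_mono) auto
      also have "\<dots> \<le> B * ?w" using v B0 by (rule mult_left_mono)
      finally show ?thesis .
    qed
    have bB: "B1 \<le> B" "B2 \<le> B" "B3 \<le> B" "B4 \<le> B" "B5 \<le> B" "B6 \<le> B" "\<bar>B7\<bar> * K \<le> B"
      using K0 mult_nonneg_nonneg[of "\<bar>B7\<bar>" K] unfolding B_def by linarith+
    show "0 \<le> B * ?w" using B0 w0 by (rule mult_nonneg_nonneg)
    fix x y :: int
    {
      assume "fits ((int n + 1) ^ (4 * n + 4 + d)) x" "fits ((int n + 1) ^ (4 * n + 4 + d)) y"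
      note xy = len[OF n this(1)] len[OF n this(2)]
      have n2: "2 \<le> n + 1" using n by simp
      show "c_read C x y \<le> B * ?w" by (rule order_trans[OF B1[OF n2 xy] vw[OF bB(1)]])
      show "c_write C x y \<le> B * ?w" by (rule order_trans[OF B2[OF n2 xy] vw[OF bB(2)]])
      show "c_compare C x y \<le> B * ?w" by (rule order_trans[OF B3[OF n2 xy] vw[OF bB(3)]])
      show "c_add C x y \<le> B * ?w" by (rule order_trans[OF B4[OF n2 xy] vw[OF bB(4)]])
      show "c_sub C x y \<le> B * ?w" by (rule order_trans[OF B5[OF n2 xy] vw[OF bB(5)]])
      show "c_mul C x y \<le> B * ?w" by (rule order_trans[OF B6[OF n2 xy] mult_right_mono[OF bB(6) w0]])
    }
    fix N assume N: "1 \<le> N \<and> N \<le> (int n + 1) ^ (4 * n + 4 + d)"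
    then have "bit_length N \<le> K * (real (n + 1) * ?l)" by (intro len[OF n]) (simp add: fits_def)
    moreover have "0 \<le> bit_length N" by (simp add: bit_length_def bitlen_nonneg)
    ultimately have "B7 * bit_length N \<le> \<bar>B7\<bar> * (K * (real (n + 1) * ?l))" by (intro mult_mono) auto
    then have "B7 * bit_length N \<le> (\<bar>B7\<bar> * K) * (real (n + 1) * ?l)" by (simp only: mult.assoc)
    with B7[of N] N vw[OF bB(7)] show "c_draw C N \<le> B * ?w" by linarith
  qed
  ultimately show ?thesis by blast
qed

section \<open>Drawing a subgroup\<close>

definition draw_subgroup :: "('a \<Rightarrow> nat) \<Rightarrow> 'a list \<Rightarrow> 'a com" where
  "draw_subgroup idx as = Seq (set_var 10 (Lit 0)) (While (Eq (var 10) (Lit 0)) (attempt idx as))"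

lemma step_frame:
  "(c', m') \<in> set_pmf (step c m) \<Longrightarrow> writes c' \<subseteq> writes c \<and> (\<forall>x i. x \<notin> writes c \<longrightarrow> content m' (x, i) = content m (x, i))"
proof (induction c arbitrary: c' m')
  case (Seq c d)
  show ?case
  proof (cases "c = Skip")
    case True
    then show ?thesis using Seq.prems by auto
  next
    case False
    then obtain c1 where "(c1, m') \<in> set_pmf (step c m)" "c' = Seq c1 d" using Seq.prems by auto
    with Seq.IH(1)[of c1 m'] show ?thesis by auto
  qed
qed (auto split: if_splits)

lemma run_frame:
  "(c', m') \<in> set_pmf (run c m t) \<Longrightarrow> writes c' \<subseteq> writes c \<and> (\<forall>x i. x \<notin> writes c \<longrightarrow> content m' (x, i) = content m (x, i))"
proof (induction t arbitrary: c' m')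
  case (Suc t)
  then obtain c1 m1 where 1: "(c1, m1) \<in> set_pmf (run c m t)" "(c', m') \<in> set_pmf (step c1 m1)" by auto
  from Suc.IH[OF 1(1)] step_frame[OF 1(2)] show ?case by (metis subset_iff)
qed simp

lemma run_Skip: "run Skip m t = return_pmf (Skip, m)"
  by (induction t) (auto simp: bind_return_pmf)

lemma reachable_Skip: "reachable Skip m = {(Skip, m)}"
  by (auto simp: reachable_def run_Skip)

lemma input_not_written:
  fixes as :: "'a list"
  shows "Input \<notin> writes (draw_subgroup idx as)"
proof -
  have "Input \<notin> writes (sample a)" for a :: 'a using writes_sample[of a] by auto
  moreover have "Input \<notin> writes (trim_check L)" "Input \<notin> writes (search L)" for L :: "'a name list"
    using writes_trim[of L] writes_search[of L] by auto
  ultimately show ?thesis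
    by (auto simp: draw_subgroup_def attempt_def writes_seqs writes_invert inverse_array_def)
qed

text \<open>
  Earlier draws may leave anything in the working memory; only the input has to survive.
\<close>

lemma ready_input:
  "ready Skip (draw_subgroup idx as) n m \<Longrightarrow> content m (Input, 0) = int n"
proof (induction rule: ready.induct)
  case (after_pre m)
  then show ?case by (simp add: reachable_Skip input_mem_def content_def)
next
  case (after_draw m m')
  then obtain t where "(Skip, m') \<in> set_pmf (run (draw_subgroup idx as) m t)" by (auto simp: reachable_def)
  from run_frame[OF this] input_not_written after_draw.IH show ?case by metis
qed

context machine
begin

lemma attempt_law:
  assumes A: "finite A" "set as = A" "distinct as" "inj_on idx A" and big: "fits M (2 * int (length as))"
    and m: "content m (Input, 0) = int n" "val m 10 = 0"
  shows "\<exists>p. sure M (attempt idx as) m ((n + 2) * sz (attempt idx as)) p \<and> (\<forall>m'\<in>set_pmf p. attempted A m') \<and>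
    (\<forall>X\<subseteq>graphs A {1..int n}. measure_pmf.prob p {m'. snd (output_graph A n m') \<in> X} =
       real (card X) / real (card (graphs A {1..int n})))"
proof -
  let ?G = "graphs A {1..int n}"
  note att = attempt[OF A big m]
  have "{} \<in> ?G" by (simp add: graphs_def A_graph_def)
  then have ne: "?G \<noteq> {}" by blast
  from att[OF \<open>{} \<in> ?G\<close>] obtain p where p: "sure M (attempt idx as) m ((n + 2) * sz (attempt idx as)) p"
    "\<forall>m'\<in>set_pmf p. attempted A m'" unfolding ptriple_def by blast
  have low: "1 / real (card ?G) \<le> measure_pmf.prob p {m'. snd (output_graph A n m') = E}" if E: "E \<in> ?G" for E
  proof -
    from att[OF E] obtain p' where p': "sure M (attempt idx as) m ((n + 2) * sz (attempt idx as)) p'"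
      "1 / real (card ?G) \<le> measure_pmf.expectation p' (\<lambda>m. of_bool (snd (output_graph A n m) = E))" unfolding ptriple_def by blast
    have "p' = p" by (rule sure_unique[OF p'(1) p(1)])
    moreover have "(\<lambda>m. of_bool (snd (output_graph A n m) = E)) = (indicat_real {m'. snd (output_graph A n m') = E})"
      by (auto simp: fun_eq_iff indicator_def)
    ultimately show ?thesis using p'(2) by simp
  qed
  have "measure_pmf.prob p {m'. snd (output_graph A n m') \<in> X} = real (card X) / real (card ?G)" if "X \<subseteq> ?G" for X
    by (rule uniform_of_lower_bound[OF finite_graphs[OF A(1)] _ low that ne]) (use p(2) in \<open>auto simp: attempted_def\<close>)
  with p show ?thesis by blast
qed

lemma attempted_labelled:
  assumes "attempted A m"
  shows "val m 10 \<noteq> 0 \<longleftrightarrow> snd (output_graph A n m) \<in> labelled A n"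
    and "val m 10 \<noteq> 0 \<and> graphical_rep A (output_graph A n m) 1 H \<longleftrightarrow>
      snd (output_graph A n m) \<in> {E \<in> labelled A n. label_lang n E = H}"
    and "val m 10 \<noteq> 0 \<and> \<not> graphical_rep A (output_graph A n m) 1 H \<longleftrightarrow>
      snd (output_graph A n m) \<in> {E \<in> labelled A n. label_lang n E \<noteq> H}"
proof -
  let ?G = "output_graph A n m"
  have G: "({1..int n}, snd ?G) = ?G" by (simp add: output_graph_def)
  have v: "val m 10 = of_bool (admissible A ?G 1)" using assms by (simp add: attempted_def)
  show "val m 10 \<noteq> 0 \<longleftrightarrow> snd ?G \<in> labelled A n"
    unfolding labelled_def mem_Collect_eq G v by simp
  show "val m 10 \<noteq> 0 \<and> graphical_rep A ?G 1 H \<longleftrightarrow> snd ?G \<in> {E \<in> labelled A n. label_lang n E = H}"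
    unfolding labelled_def label_lang_def mem_Collect_eq G v graphical_rep_lang by auto
  show "val m 10 \<noteq> 0 \<and> \<not> graphical_rep A ?G 1 H \<longleftrightarrow> snd ?G \<in> {E \<in> labelled A n. label_lang n E \<noteq> H}"
    unfolding labelled_def label_lang_def mem_Collect_eq G v graphical_rep_lang by auto
qed

lemma attempted_fail:
  assumes "attempted A m"
  shows "val m 10 = 0 \<longleftrightarrow> snd (output_graph A n m) \<in> graphs A {1..int n} - labelled A n"
proof -
  have "snd (output_graph A n m) \<in> graphs A {1..int n}" using assms by (simp add: attempted_def)
  with attempted_labelled(1)[OF assms] show ?thesis by blast
qed

lemma labelled_sub: "labelled A n \<subseteq> graphs A {1..int n}"
  by (auto simp: labelled_def graphs_def admissible_def)

text \<open>
  The probability of success is the quotient of the probabilities, in a single attempt, of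
  acceptance with \<open>P\<close> and of acceptance.
\<close>

lemma draw_halt:
  assumes A: "finite A" "set as = A" "distinct as" "inj_on idx A" and big: "fits M (2 * int (length as))"
    and m: "content m (Input, 0) = int n" and ne: "labelled A n \<noteq> {}"
    and X: "X \<subseteq> labelled A n"
    and P: "\<And>m'. attempted A m' \<Longrightarrow> val m' 10 \<noteq> 0 \<and> P m' \<longleftrightarrow> snd (output_graph A n m') \<in> X"
  shows "real (card X) / real (card (labelled A n)) \<le> halt_prob (draw_subgroup idx as) m P"
proof -
  let ?b = "Eq (var 10) (Lit 0)" and ?body = "attempt idx as" and ?G = "graphs A {1..int n}"
  let ?I = "\<lambda>m'. content m' (Input, 0) = int n"
  define x where "x = real (card X) / real (card ?G)"
  define s where "s = real (card (labelled A n)) / real (card ?G)"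
  have finG: "finite ?G" by (rule finite_graphs[OF A(1)]) simp
  have finL: "finite (labelled A n)" by (rule finite_labelled[OF A(1)])
  have L0: "0 < card (labelled A n)" using ne finL by (simp add: card_gt_0_iff)
  have LG: "card (labelled A n) \<le> card ?G" by (rule card_mono[OF finG labelled_sub])
  have s: "0 < s" "s \<le> 1" using L0 LG unfolding s_def by auto
  have x: "0 \<le> x" by (simp add: x_def)
  have body: "\<exists>p. sure M ?body m1 ((n + 2) * sz ?body) p \<and> (\<forall>m'\<in>set_pmf p. ?I m') \<and>
      x \<le> measure_pmf.prob p {m'. \<not> eval_test m' ?b \<and> P m'} \<and> 1 - s \<le> measure_pmf.prob p {m'. eval_test m' ?b}"
    if m1: "?I m1" "eval_test m1 ?b" for m1
  proof -
    from attempt_law[OF A big m1(1)] m1(2) obtain p where p: "sure M ?body m1 ((n + 2) * sz ?body) p"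
      "\<forall>m'\<in>set_pmf p. attempted A m'"
      "\<And>Y. Y \<subseteq> ?G \<Longrightarrow> measure_pmf.prob p {m'. snd (output_graph A n m') \<in> Y} = real (card Y) / real (card ?G)" by auto
    have "measure_pmf.prob p {m'. \<not> eval_test m' ?b \<and> P m'} = measure_pmf.prob p {m'. snd (output_graph A n m') \<in> X}"
      by (rule measure_pmf.finite_measure_eq_AE) (use p(2) P in \<open>auto simp: AE_measure_pmf_iff\<close>)
    also have "\<dots> = x" unfolding x_def by (rule p(3)) (use X labelled_sub in blast)
    finally have 1: "x \<le> measure_pmf.prob p {m'. \<not> eval_test m' ?b \<and> P m'}" by simp
    have "measure_pmf.prob p {m'. eval_test m' ?b} = measure_pmf.prob p {m'. snd (output_graph A n m') \<in> ?G - labelled A n}"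
      by (rule measure_pmf.finite_measure_eq_AE)
         (use p(2) attempted_fail[of A] in \<open>auto simp: AE_measure_pmf_iff\<close>)
    also have "\<dots> = real (card (?G - labelled A n)) / real (card ?G)" by (rule p(3)) blast
    also have "card (?G - labelled A n) = card ?G - card (labelled A n)" by (rule card_Diff_subset[OF finL labelled_sub])
    also have "real (card ?G - card (labelled A n)) / real (card ?G) = 1 - s"
      using LG L0 unfolding s_def by (simp add: of_nat_diff field_simps)
    finally have 2: "1 - s \<le> measure_pmf.prob p {m'. eval_test m' ?b}" by simp
    have "\<forall>m'\<in>set_pmf p. ?I m'" using p(2) by (auto simp: attempted_def)
    with p(1) 1 2 show ?thesis by blast
  qed
  let ?m0 = "m((Work 10, 0) \<mapsto> 0)"
  have lower: "x * (\<Sum>i<j. (1 - s) ^ i) \<le> halt_prob (draw_subgroup idx as) m P" for j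
  proof -
    have "\<exists>t. ennreal (x * (\<Sum>i<j. (1 - s) ^ i)) \<le> cost_upto zero_cost t (While ?b ?body) (indicator {m. P m}) ?m0"
      by (rule While_lower[where I = ?I, OF body x]) (use s m in auto)
    then obtain t where t: "ennreal (x * (\<Sum>i<j. (1 - s) ^ i)) \<le> cost_upto zero_cost t (While ?b ?body) (indicator {m. P m}) ?m0" by blast
    also have "\<dots> = cost_upto zero_cost (Suc 0) (set_var 10 (Lit 0)) (cost_upto zero_cost t (While ?b ?body) (indicator {m. P m})) m"
      by (simp del: step_cost.simps)
    also have "\<dots> \<le> cost_upto zero_cost (Suc (Suc 0 + t)) (Seq (set_var 10 (Lit 0)) (While ?b ?body)) (indicator {m. P m}) m"
      by (rule cost_upto_Seq_ge)
    finally show ?thesis unfolding draw_subgroup_def by (rule halt_prob_ge)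
  qed
  have "(\<lambda>j. x * (\<Sum>i<j. (1 - s) ^ i)) \<longlonglongrightarrow> x * (1 / (1 - (1 - s)))"
    by (intro tendsto_mult tendsto_const geometric_sums[unfolded sums_def]) (use s in auto)
  then have "x / s \<le> halt_prob (draw_subgroup idx as) m P"
    using lower by (intro LIMSEQ_le_const2) auto
  moreover have "x / s = real (card X) / real (card (labelled A n))"
    using L0 LG by (simp add: x_def s_def)
  ultimately show ?thesis by simp
qed

lemma draw_uniform:
  assumes A: "finite A" "set as = A" "distinct as" "inj_on idx A" and big: "fits M (2 * int (length as))"
    and m: "content m (Input, 0) = int n" and ne: "labelled A n \<noteq> {}"
  shows "uniform_subgroup_output A n (draw_subgroup idx as) m"
  unfolding uniform_subgroup_output_def
proof
  fix H assume H: "H \<in> subgroups_of_size A n"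
  let ?P = "\<lambda>m'. graphical_rep A (output_graph A n m') 1 H"
  let ?L = "labelled A n" and ?X = "{E \<in> labelled A n. label_lang n E = H}" and ?Y = "{E \<in> labelled A n. label_lang n E \<noteq> H}"
  let ?h = "halt_prob (draw_subgroup idx as) m"
  have finL: "finite ?L" by (rule finite_labelled[OF A(1)])
  have L0: "0 < card ?L" using ne finL by (simp add: card_gt_0_iff)
  obtain E where "E \<in> ?L" "H = label_lang n E" using H subgroups_of_size_eq[OF A(1) n] by auto
  then have X: "card ?X = fact (n - 1)" using card_fibre[OF A(1) n] by simp
  have "card (?X \<union> ?Y) = card ?X + card ?Y" by (rule card_Un_disjoint) (use finL in auto)
  moreover have "?X \<union> ?Y = ?L" by auto
  ultimately have XY: "card ?L = card ?X + card ?Y" by metis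
  have 1: "real (card ?X) / real (card ?L) \<le> ?h ?P"
    by (rule draw_halt[OF A big m ne]) (use attempted_labelled(2) in auto)
  have 2: "real (card ?Y) / real (card ?L) \<le> ?h (\<lambda>m'. \<not> ?P m')"
    by (rule draw_halt[OF A big m ne]) (use attempted_labelled(3) in auto)
  have "real (card ?X) / real (card ?L) + real (card ?Y) / real (card ?L) = 1"
  proof -
    have "real (card ?X) + real (card ?Y) = real (card ?L)" unfolding XY by simp
    then show ?thesis using L0 by (simp only: add_divide_distrib[symmetric]) simp
  qed
  with 1 2 halt_prob_compl[of "draw_subgroup idx as" m ?P] have "?h ?P = real (card ?X) / real (card ?L)" by linarith
  also have "\<dots> = 1 / real (card (subgroups_of_size A n))"
    using L0 unfolding X card_labelled[OF A(1) n] by simp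
  finally show "?h ?P = 1 / real (card (subgroups_of_size A n))" .
qed

lemma draw_cost:
  fixes A :: "'a set"
  assumes A: "finite A" "set as = A" "distinct as" "inj_on idx A" and big: "fits M (2 * int (length as))"
    and m: "content m (Input, 0) = int n" and ne: "labelled A n \<noteq> {}"
    and \<delta>: "0 < \<delta>" "\<delta> * real (card (graphs A {1..int n})) \<le> real (card (labelled A n))"
    and C: "ops_bounded C M w"
  shows "expected_cost C (draw_subgroup idx as) m \<le> ennreal (w * (3 + (real (n + 2) * sz (attempt idx as) + 2) / \<delta>))"
proof (rule expected_cost_le)
  fix t
  let ?b = "Eq (var 10) (Lit 0) :: 'a test" and ?body = "attempt idx as" and ?G = "graphs A {1..int n}"
  let ?I = "\<lambda>m'. content m' (Input, 0) = int n \<and> val m' 10 \<in> {0, 1}"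
  let ?k = "(n + 2) * sz ?body"
  have w: "0 \<le> w" using C by (simp add: ops_bounded_def)
  have finG: "finite ?G" by (rule finite_graphs[OF A(1)]) simp
  have finL: "finite (labelled A n)" by (rule finite_labelled[OF A(1)])
  have L0: "0 < card (labelled A n)" using ne finL by (simp add: card_gt_0_iff)
  have LG: "card (labelled A n) \<le> card ?G" by (rule card_mono[OF finG labelled_sub])
  have body: "\<exists>p. sure M ?body m1 ?k p \<and> (\<forall>m'\<in>set_pmf p. ?I m') \<and> measure_pmf.prob p {m'. eval_test m' ?b} \<le> 1 - \<delta>"
    if m1: "?I m1" "eval_test m1 ?b" for m1
  proof -
    have "content m1 (Input, 0) = int n" "val m1 10 = 0" using m1 by auto
    from attempt_law[OF A big this] obtain p where p: "sure M ?body m1 ?k p"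
      "\<forall>m'\<in>set_pmf p. attempted A m'"
      "\<And>Y. Y \<subseteq> ?G \<Longrightarrow> measure_pmf.prob p {m'. snd (output_graph A n m') \<in> Y} = real (card Y) / real (card ?G)" by auto
    have "measure_pmf.prob p {m'. eval_test m' ?b} = measure_pmf.prob p {m'. snd (output_graph A n m') \<in> ?G - labelled A n}"
      by (rule measure_pmf.finite_measure_eq_AE)
         (use p(2) attempted_fail[of A] in \<open>auto simp: AE_measure_pmf_iff\<close>)
    also have "\<dots> = real (card (?G - labelled A n)) / real (card ?G)" by (rule p(3)) blast
    also have "card (?G - labelled A n) = card ?G - card (labelled A n)" by (rule card_Diff_subset[OF finL labelled_sub])
    also have "real (card ?G - card (labelled A n)) / real (card ?G) \<le> 1 - \<delta>"
      using LG L0 \<delta>(2) by (simp add: of_nat_diff field_simps)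
    finally have "measure_pmf.prob p {m'. eval_test m' ?b} \<le> 1 - \<delta>" .
    moreover have "\<forall>m'\<in>set_pmf p. ?I m'" using p(2) by (auto simp: attempted_def)
    ultimately show ?thesis using p(1) by blast
  qed
  let ?W = "real (test_ops ?b) * w + (real ?k * w + real (test_ops ?b) * w) / \<delta>"
  have while: "cost_upto C t (While ?b ?body) (\<lambda>_. 0) m' \<le> ennreal ?W" if "?I m'" for m'
  proof -
    have "cost_upto C t (While ?b ?body) (\<lambda>_. 0) m' \<le> ennreal (real (test_ops ?b) * w +
        (if eval_test m' ?b then (real ?k * w + real (test_ops ?b) * w) / \<delta> else 0))"
      by (rule While_upper[where I = ?I and M = M, OF _ body C \<delta>(1) that]) (auto simp: fits01)
    also have "\<dots> \<le> ennreal ?W" using w \<delta>(1) by (intro ennreal_leI) auto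
    finally show ?thesis .
  qed
  have set: "sure M (set_var 10 (Lit 0)) m 1 (return_pmf (m((Work 10, 0) \<mapsto> 0)))"
    using sure.Assign[of M m "Lit 0" "Lit 0" "Work 10"] by (simp add: fits01)
  have "cost_upto C t (draw_subgroup idx as) (\<lambda>_. 0) m \<le> cost_upto C t (set_var 10 (Lit 0)) (cost_upto C t (While ?b ?body) (\<lambda>_. 0)) m"
    unfolding draw_subgroup_def by (rule cost_upto_Seq_le)
  also have "\<dots> \<le> ennreal (real 1 * w) + cost_upto C t (While ?b ?body) (\<lambda>_. 0) (m((Work 10, 0) \<mapsto> 0))"
    using sure_upper[OF set C, of t "cost_upto C t (While ?b ?body) (\<lambda>_. 0)"] by simp
  also have "\<dots> \<le> ennreal (real 1 * w) + ennreal ?W" by (intro add_left_mono while) (use m in auto)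
  also have "\<dots> = ennreal (real 1 * w + ?W)"
    using w \<delta>(1) by (intro ennreal_plus[symmetric]) auto
  also have "real 1 * w + ?W = w * (3 + (real (n + 2) * sz ?body + 2) / \<delta>)"
    by (simp add: algebra_simps add_divide_distrib)
  finally show "cost_upto C t (draw_subgroup idx as) (\<lambda>_. 0) m \<le> ennreal (w * (3 + (real (n + 2) * sz ?body + 2) / \<delta>))" .
qed

end

theorem mainTheorem1:
  fixes A :: "'a set"
  assumes "finite A" and "card A \<ge> 2"
  shows "\<exists>pre draw :: 'a com.
    random_free pre \<and>
    (\<forall>n\<ge>1. halt_prob pre (input_mem n) (\<lambda>_. True) = 1) \<and>
    (\<forall>n\<ge>1. finite (subgroups_of_size A n) \<and> subgroups_of_size A n \<noteq> {} \<and>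
       (\<forall>m. ready pre draw n m \<longrightarrow> uniform_subgroup_output A n draw m)) \<and>
    (\<exists>T\<in>O(\<lambda>n. real n). \<forall>n\<ge>1.
       expected_cost unit_cost pre (input_mem n) \<le> ennreal (T n)) \<and>
    (\<exists>T\<in>O(\<lambda>n. real n). \<forall>n\<ge>1. \<forall>m. ready pre draw n m \<longrightarrow>
       expected_cost unit_cost draw m \<le> ennreal (T n)) \<and>
    (\<exists>S\<in>O(\<lambda>n. real n ^ 2 * ln (real n)). \<forall>n\<ge>1. \<forall>(c, m)\<in>reachable pre (input_mem n).
       bit_space m \<le> S n) \<and>
    (\<forall>C. bit_cost_model C \<longrightarrow>
       (\<exists>T\<in>O(\<lambda>n. real n ^ 2 * ln (real n)). \<forall>n\<ge>1.
          expected_cost C pre (input_mem n) \<le> ennreal (T n)) \<and>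
       (\<exists>T\<in>O(\<lambda>n. real n ^ 2 * (ln (real n)) ^ 2). \<forall>n\<ge>1. \<forall>m. ready pre draw n m \<longrightarrow>
          expected_cost C draw m \<le> ennreal (T n)))"
proof -
  obtain as where as: "set as = A" "distinct as" using finite_distinct_list[OF assms(1)] by blast
  obtain idx :: "'a \<Rightarrow> nat" where idx: "inj_on idx A" using finite_imp_inj_to_nat_seg[OF assms(1)] by blast
  note A = assms(1) as idx
  obtain a where a: "a \<in> A" using assms(2) by fastforce
  obtain \<delta> where \<delta>: "0 < \<delta>" "\<And>n. n \<ge> 1 \<Longrightarrow> \<delta> * real (card (graphs A {1..int n})) \<le> real (card (labelled A n))"
    using admissible_fraction[OF assms] by blast
  let ?draw = "draw_subgroup idx as" and ?d = "2 * card A"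
  \<comment> \<open>The summand \<open>?d\<close> makes room for the counter of half-edges, of which each vertex may have that many.\<close>
  let ?M = "\<lambda>n::nat. (int n + 1) ^ (4 * n + 4 + ?d)"
  have mach: "machine n (?M n)" if "n \<ge> 1" for n
    by unfold_locales (use that in \<open>auto intro!: power_increasing\<close>)
  have big: "fits (?M n) (2 * int (length as))" if n: "n \<ge> 1" for n
  proof -
    have "2 * int (length as) = int ?d" using as by (metis distinct_card of_nat_mult of_nat_numeral)
    also have "int ?d \<le> 2 ^ ?d" by (metis less_exp of_nat_less_iff of_nat_numeral of_nat_power order_less_imp_le)
    also have "\<dots> \<le> (int n + 1) ^ ?d" using n by (intro power_mono) auto
    also have "\<dots> \<le> ?M n" by (rule power_increasing) auto
    finally show ?thesis by (simp add: fits_def)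
  qed
  have ne: "labelled A n \<noteq> {}" if "n \<ge> 1" for n by (rule labelled_nonempty[OF a that])
  have Skip_cost: "expected_cost C Skip m \<le> ennreal 0" for C and m :: "'a mem"
    by (rule expected_cost_le) simp
  have Skip_halt: "halt_prob Skip m (\<lambda>_. True) = 1" for m :: "'a mem"
    by (simp add: halt_prob_def run_Skip indicator_def)
  define k where "k = real (sz (attempt idx as))"
  have cost: "expected_cost C ?draw m \<le> ennreal (w * (3 + (real (n + 2) * k + 2) / \<delta>))"
    if "n \<ge> 1" "ready Skip ?draw n m" "ops_bounded C (?M n) w" for C n m w
    unfolding k_def
    by (rule machine.draw_cost[OF mach A big ready_input ne \<delta>(1) \<delta>(2)]) (use that in auto)
  show ?thesis
  proof (rule exI[of _ Skip], rule exI[of _ ?draw], intro conjI allI impI)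
    show "random_free Skip" by simp
    show "halt_prob Skip (input_mem n :: 'a mem) (\<lambda>_. True) = 1" if "n \<ge> 1" for n by (rule Skip_halt)
    show "finite (subgroups_of_size A n)" "subgroups_of_size A n \<noteq> {}" if "n \<ge> 1" for n
      using ne[OF that] finite_labelled[OF assms(1)] by (simp_all add: subgroups_of_size_eq[OF assms(1) that])
    show "uniform_subgroup_output A n ?draw m" if "n \<ge> 1" "ready Skip ?draw n m" for n m
      by (rule machine.draw_uniform[OF mach A big ready_input ne]) (use that in auto)
    show "\<exists>T\<in>O(\<lambda>n. real n). \<forall>n\<ge>1. expected_cost unit_cost Skip (input_mem n :: 'a mem) \<le> ennreal (T n)"
      by (rule bexI[of _ "\<lambda>_. 0"]) (use Skip_cost in auto)
    show "\<exists>T\<in>O(\<lambda>n. real n). \<forall>n\<ge>1. \<forall>m. ready Skip ?draw n m \<longrightarrow> expected_cost unit_cost ?draw m \<le> ennreal (T n)"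
    proof (rule bexI[of _ "\<lambda>n. 1 * (3 + (real (n + 2) * k + 2) / \<delta>)"])
      show "(\<lambda>n. 1 * (3 + (real (n + 2) * k + 2) / \<delta>)) \<in> O(\<lambda>n. real n)"
        using \<delta>(1) by real_asymp
    qed (use cost ops_bounded_unit in blast)
    show "\<exists>S\<in>O(\<lambda>n. real n ^ 2 * ln (real n)). \<forall>n\<ge>1. \<forall>(c, m)\<in>reachable Skip (input_mem n :: 'a mem). bit_space m \<le> S n"
    proof (rule bexI[of _ "\<lambda>n. log 2 (real n) + 3"])
      show "(\<lambda>n. log 2 (real n) + 3) \<in> O(\<lambda>n. real n ^ 2 * ln (real n))" by real_asymp
      show "\<forall>n\<ge>1. \<forall>(c, m)\<in>reachable Skip (input_mem n :: 'a mem). bit_space m \<le> log 2 (real n) + 3"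
      proof (intro allI impI)
        fix n :: nat assume n: "n \<ge> 1"
        have "bit_length (int n) \<le> log 2 (real_of_int (int n)) + 2" by (rule bit_length_le) (use n in \<open>auto simp: fits_def\<close>)
        moreover have "bit_length 0 = 1" by (simp add: bit_length_def bitlen_def floorlog_def)
        moreover have "dom (input_mem n :: 'a mem) = {(Input, 0)}" "content (input_mem n :: 'a mem) (Input, 0) = int n"
          by (auto simp: input_mem_def content_def)
        ultimately show "\<forall>(c, m)\<in>reachable Skip (input_mem n :: 'a mem). bit_space m \<le> log 2 (real n) + 3"
          by (simp add: reachable_Skip bit_space_def)
      qed
    qed
    fix C assume C: "bit_cost_model C"
    show "\<exists>T\<in>O(\<lambda>n. real n ^ 2 * ln (real n)). \<forall>n\<ge>1. expected_cost C Skip (input_mem n :: 'a mem) \<le> ennreal (T n)"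
      by (rule bexI[of _ "\<lambda>_. 0"]) (use Skip_cost in auto)
    obtain B where B: "0 \<le> B" "\<And>n. n \<ge> 1 \<Longrightarrow> ops_bounded C (?M n) (B * (real (n + 1) * (log 2 (real (n + 1)))\<^sup>2))"
      using ops_bounded_bit[OF C, of ?d] by blast
    show "\<exists>T\<in>O(\<lambda>n. real n ^ 2 * (ln (real n)) ^ 2). \<forall>n\<ge>1. \<forall>m. ready Skip ?draw n m \<longrightarrow> expected_cost C ?draw m \<le> ennreal (T n)"
    proof (rule bexI[of _ "\<lambda>n. (B * (real (n + 1) * (log 2 (real (n + 1)))\<^sup>2)) * (3 + (real (n + 2) * k + 2) / \<delta>)"])
      have 1: "(\<lambda>n. real (n + 1) * (log 2 (real (n + 1)))\<^sup>2) \<in> O(\<lambda>n. real n * (ln (real n))\<^sup>2)" by real_asymp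
      have 2: "(\<lambda>n. 3 + (real (n + 2) * k + 2) / \<delta>) \<in> O(\<lambda>n. real n)" using \<delta>(1) by real_asymp
      have "(\<lambda>n. (B * (real (n + 1) * (log 2 (real (n + 1)))\<^sup>2)) * (3 + (real (n + 2) * k + 2) / \<delta>)) \<in> O(\<lambda>n. (1 * (real n * (ln (real n))\<^sup>2)) * real n)"
        by (intro landau_o.big.mult[OF landau_o.big.mult[OF bigo_const 1] 2])
      then show "(\<lambda>n. (B * (real (n + 1) * (log 2 (real (n + 1)))\<^sup>2)) * (3 + (real (n + 2) * k + 2) / \<delta>)) \<in> O(\<lambda>n. real n ^ 2 * (ln (real n)) ^ 2)"
        by (simp add: power2_eq_square mult_ac)
    qed (use cost B(2) in blast)
  qed
qed

end
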